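(* Let $d,\alpha,k$ be positive integers with $k\le\alpha$, let $\beta=\frac d2-1$ and $a=(a_0,\dots,a_{k-1})\in\mathbb{R}^k$. With the notation of the context, for $n\in\mathbb{N}_0$, $i\in\mathbb{N}_0$ with $i\le\frac n2$, and $j\in\{1,2,\dots,\sigma_{n-2i}\}$ define $$Q_{n,i,j}(x)=\hat q^{\,\alpha,d/2-1;a}_{i,n-2i}(\|x\|^2)\,Y^{n-2i}_j(x),\qquad x\in\mathbb{R}^d .$$ Then the polynomials $\{Q_{n,i,j}(x)\}$ form a basis for $\mathbb{R}[x_1,\dots,x_d]$, and for every $f\in\mathcal{A}^{\alpha,d/2-1;a}$ and all such $n,i,j$ we have $$B_f\!\left(\tfrac12\,x\cdot\nabla_x,\ \tfrac14\Delta_x\right)Q_{n,i,j}(x)=f\!\left(\lambda^{\alpha+d/2-1}_{(n-k)/2}\right)Q_{n,i,j}(x).$$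
   Context: Notation. $(c)_0=1$, $(c)_m=c(c+1)\cdots(c+m-1)$ for $m\ge1$. For $x\in\mathbb{R}$ (or a polynomial in $n$) and $\sigma\in\mathbb{R}$, $\lambda_x^{\sigma}=x(x+\sigma+1)$. Jacobi polynomials, for parameters $\alpha,\beta$ and $n\in\mathbb{N}_0$: $$p^{\alpha,\beta}_n(z)=(-1)^n\frac{(\alpha+\beta+1)_n}{n!}\,{}_2F_1(-n,n+\alpha+\beta+1;\beta+1;z),$$ and $p^{\alpha,\beta}_n(z)=0$ for $n<0$. Discrete Wronskian: $\mathrm{Wr}_n(h^{(1)}_n,\dots,h^{(m)}_n)=\det\big(h^{(i)}_{n-j+1}\big)_{1\le i,j\le m}$. For $0\le j\le k-1$ define the polynomials in $n$ (which are evaluated at arbitrary real $n$) $$\phi^{1,j}_n=\frac{(-1)^j(n+1)_j(-n-\alpha-\beta)_j}{j!\,(1-\alpha)_j},\qquad \phi^{2,j}_n=\frac{(-1)^j(n+1)_\alpha(n+\beta+1)_\alpha(-n)_j(n+\alpha+\beta+1)_j}{j!\,\alpha!\,(1+\alpha)_j(1+\beta)_\alpha},$$ $$\psi^{(j);\alpha,\beta;a}_n=\sum_{l=0}^{j}a_{j-l}\,\phi^{1,l}_n+\phi^{2,j}_n .$$ Put $$q_n(z)=\mathrm{Wr}_n(\psi^{(0);\alpha,\beta;a}_n,\dots,\psi^{(k-1);\alpha,\beta;a}_n,p^{\alpha,\beta}_n(z)),\qquad \tau_n=\mathrm{Wr}_n(\psi^{(0);\alpha,\beta;a}_n,\dots,\psi^{(k-1);\alpha,\beta;a}_n)\in\mathbb{R}[n],$$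 and for $s\in\mathbb{N}_0$ $$\hat q^{\,\alpha,\beta;a}_{n,s}(z)=\mathrm{Wr}_n(\psi^{(0);\alpha,\beta;a}_{n+s/2},\dots,\psi^{(k-1);\alpha,\beta;a}_{n+s/2},p^{\alpha,\beta+s}_n(z)),\qquad n\in\mathbb{N}_0 .$$ $\mathcal{A}^{\alpha,\beta;a}$ is the algebra of all $f\in\mathbb{R}[t]$ such that $f(\lambda^{\alpha+\beta}_{n-k/2})-f(\lambda^{\alpha+\beta}_{n-k/2-1})$ is divisible by $\tau_{n-1}$ in $\mathbb{R}[n]$. The operators $B_f$. Let $\mathcal{D}_1=z\partial_z$, $\mathcal{D}_2=z\partial_z^2+(\beta+1)\partial_z$, and let $\mathfrak{D}_\beta=\mathbb{R}\langle\mathcal{D}_1,\mathcal{D}_2\rangle$ be the associative unital algebra of differential operators they generate; one has $[\mathcal{D}_2,\mathcal{D}_1]=\mathcal{D}_2$, and every element of $\mathfrak{D}_\beta$ is uniquely a finite sum $\sum c_{ij}\mathcal{D}_1^i\mathcal{D}_2^j$ with $c_{ij}\in\mathbb{R}$. For each $f\in\mathcal{A}^{\alpha,\beta;a}$ (with $\alpha,k$ positive integers, $k\le\alpha$) it is known that there is a unique $B_f=B_f(\mathcal{D}_1,\mathcal{D}_2)\in\mathfrak{D}_\beta$ with $B_f\,q_n(z)=f(\lambda^{\alpha+\beta}_{n-k/2})\,q_n(z)$ for all $n\in\mathbb{N}_0$. If $X_1,X_2$ are operators with $[X_2,X_1]=X_2$, then $B_f(X_1,X_2)$ denotes the operator obtained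 from the expression of $B_f$ by replacing $\mathcal{D}_1\to X_1$, $\mathcal{D}_2\to X_2$, i.e. $\sum c_{ij}X_1^iX_2^j$. This applies to $X_1=\frac12x\cdot\nabla_x=\frac12\sum_{j}x_j\partial_{x_j}$, $X_2=\frac14\Delta_x$, where $\Delta_x=\sum_{j=1}^d\partial_{x_j}^2$, since $[\frac14\Delta_x,\frac12x\cdot\nabla_x]=\frac14\Delta_x$. Here $\beta=\frac d2-1$. Spherical harmonics. $\mathcal{H}_l$ is the space of homogeneous polynomials $Y$ of degree $l$ on $\mathbb{R}^d$ with $\Delta_xY=0$, $\sigma_l=\dim\mathcal{H}_l$, and $\{Y^l_j(x):1\le j\le\sigma_l\}$ is a fixed basis of $\mathcal{H}_l$ that is orthonormal on the unit sphere $S^{d-1}$: $\frac1{\omega_d}\int_{S^{d-1}}Y^{l_1}_{j_1}(x')Y^{l_2}_{j_2}(x')\,d\omega(x')=\delta_{l_1,l_2}\delta_{j_1,j_2}$, where $\omega$ is the Lebesgue (surface) measure on $S^{d-1}$ and $\omega_d=\omega(S^{d-1})=2\pi^{d/2}/\Gamma(d/2)$.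
   Formalization: The basis claim is stated under the added (and necessary) condition that τ_{m/2-1} ≠ 0 for all m ∈ ℕ_0; without it the claim fails, e.g. k=1, a_0=0 gives Q_{0,0,1}=0. The eigenvalue equation is stated for every a. *)

theory Defs
  imports
    "Jordan_Normal_Form.Determinant"
    "HOL-Library.Function_Algebras"
    "HOL-Computational_Algebra.Polynomial"
    "HOL-Analysis.Analysis"
begin

section \<open>Functions as a real vector space\<close>

instantiation "fun" :: (type, real_vector) real_vector
begin

definition scaleR_fun :: "real \<Rightarrow> ('a \<Rightarrow> 'b) \<Rightarrow> 'a \<Rightarrow> 'b" where
  "scaleR_fun c f = (\<lambda>x. c *\<^sub>R f x)"

instance
  by standard (auto simp: scaleR_fun_def fun_eq_iff algebra_simps)

end

text \<open>A family, not just its range, is a basis: distinct indices give distinct vectors.\<close>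

definition basis_family :: "('i \<Rightarrow> 'v::real_vector) \<Rightarrow> 'i set \<Rightarrow> 'v set \<Rightarrow> bool" where
  "basis_family v I V \<longleftrightarrow> inj_on v I \<and> independent (v ` I) \<and> span (v ` I) = V"

section \<open>Jacobi polynomials and discrete Wronskians\<close>

text \<open>Polymorphic, since \<open>x\<close> may be a real number or a polynomial in \<open>n\<close>.\<close>

definition lam :: "'a::comm_ring_1 \<Rightarrow> 'a \<Rightarrow> 'a" where
  "lam \<sigma> x = x * (x + \<sigma> + 1)"

definition hyp2F1 :: "real \<Rightarrow> real \<Rightarrow> real \<Rightarrow> real \<Rightarrow> real" where
  "hyp2F1 a b c z = (\<Sum>l. pochhammer a l * pochhammer b l / (pochhammer c l * fact l) * z ^ l)"

definition jacobi :: "real \<Rightarrow> real \<Rightarrow> int \<Rightarrow> real \<Rightarrow> real" where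
  "jacobi \<alpha> \<beta> n z =
     (if n < 0 then 0
      else (-1) ^ nat n * pochhammer (\<alpha> + \<beta> + 1) (nat n) / fact (nat n)
           * hyp2F1 (- of_int n) (of_int n + \<alpha> + \<beta> + 1) (\<beta> + 1) z)"

text \<open>Matrix and list indices start at 0, so the entry \<open>h\<^sup>(\<^sup>i\<^sup>)\<close> at \<open>n - j + 1\<close> becomes
  \<open>hs ! i\<close> at \<open>n - j\<close>.  The argument \<open>n\<close> is an integer, or the indeterminate of \<open>real poly\<close>.\<close>

definition Wr :: "('n::ring_1 \<Rightarrow> 'a::comm_ring_1) list \<Rightarrow> 'n \<Rightarrow> 'a" where
  "Wr hs n = Determinant.det
     (Matrix.mat (length hs) (length hs) (\<lambda>(i, j). (hs ! i) (n - of_nat j)))"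

section \<open>The polynomials \<open>\<psi>\<close>, \<open>\<tau>\<close>, \<open>q\<close>\<close>

text \<open>Elements of \<open>\<real>[n]\<close> are of type \<open>real poly\<close>, with \<open>n\<close> written \<open>[:0, 1:]\<close>.\<close>

definition phi1 :: "nat \<Rightarrow> real \<Rightarrow> nat \<Rightarrow> real poly" where
  "phi1 \<alpha> \<beta> j =
     Polynomial.smult ((-1) ^ j / (fact j * pochhammer (1 - real \<alpha>) j))
       (pochhammer [:1, 1:] j * pochhammer [:- real \<alpha> - \<beta>, -1:] j)"

definition phi2 :: "nat \<Rightarrow> real \<Rightarrow> nat \<Rightarrow> real poly" where
  "phi2 \<alpha> \<beta> j =
     Polynomial.smult ((-1) ^ j / (fact j * fact \<alpha> * pochhammer (1 + real \<alpha>) j * pochhammer (1 + \<beta>) \<alpha>))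
       (pochhammer [:1, 1:] \<alpha> * pochhammer [:\<beta> + 1, 1:] \<alpha>
        * pochhammer [:0, -1:] j * pochhammer [:real \<alpha> + \<beta> + 1, 1:] j)"

definition psi :: "nat \<Rightarrow> real \<Rightarrow> (nat \<Rightarrow> real) \<Rightarrow> nat \<Rightarrow> real poly" where
  "psi \<alpha> \<beta> a j = (\<Sum>l\<le>j. Polynomial.smult (a (j - l)) (phi1 \<alpha> \<beta> l)) + phi2 \<alpha> \<beta> j"

definition tau :: "nat \<Rightarrow> nat \<Rightarrow> real \<Rightarrow> (nat \<Rightarrow> real) \<Rightarrow> real poly" where
  "tau k \<alpha> \<beta> a = Wr (map (\<lambda>i x. pcompose (psi \<alpha> \<beta> a i) x) [0..<k]) [:0, 1:]"

definition qfun :: "nat \<Rightarrow> nat \<Rightarrow> real \<Rightarrow> (nat \<Rightarrow> real) \<Rightarrow> nat \<Rightarrow> real \<Rightarrow> real" where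
  "qfun k \<alpha> \<beta> a n z =
     Wr (map (\<lambda>i m. poly (psi \<alpha> \<beta> a i) (of_int m)) [0..<k] @ [\<lambda>m. jacobi \<alpha> \<beta> m z]) (int n)"

definition qhat :: "nat \<Rightarrow> nat \<Rightarrow> real \<Rightarrow> (nat \<Rightarrow> real) \<Rightarrow> nat \<Rightarrow> nat \<Rightarrow> real \<Rightarrow> real" where
  "qhat k \<alpha> \<beta> a n s z =
     Wr (map (\<lambda>i m. poly (psi \<alpha> \<beta> a i) (of_int m + real s / 2)) [0..<k]
         @ [\<lambda>m. jacobi \<alpha> (\<beta> + real s) m z]) (int n)"

text \<open>Up to a nonzero factor, the coefficient of \<open>z\<^sup>n\<close> in \<open>qhat k \<alpha> \<beta> a n s\<close> is the value of \<open>\<tau>\<close>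
  at \<open>(2 n + s) / 2 - 1\<close>, so \<open>qhat\<close> has degree \<open>n\<close> exactly if \<open>\<tau>\<close> does not vanish there.\<close>

section \<open>The algebra \<open>\<A>\<close> and the operators \<open>B\<^sub>f\<close>\<close>

definition alg :: "nat \<Rightarrow> nat \<Rightarrow> real \<Rightarrow> (nat \<Rightarrow> real) \<Rightarrow> real poly set" where
  "alg k \<alpha> \<beta> a =
     {f. pcompose (tau k \<alpha> \<beta> a) [:-1, 1:] dvd
           pcompose f (lam [:real \<alpha> + \<beta>:] [:- real k / 2, 1:])
           - pcompose f (lam [:real \<alpha> + \<beta>:] [:- real k / 2 - 1, 1:])}"

text \<open>An operator \<open>\<Sum> c\<^sub>i\<^sub>j D\<^sub>1\<^sup>i D\<^sub>2\<^sup>j\<close> is given by its finitely supported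
  coefficient array \<open>c\<close>; \<open>subst_op c X1 X2\<close> is \<open>\<Sum> c\<^sub>i\<^sub>j X\<^sub>1\<^sup>i X\<^sub>2\<^sup>j\<close>.\<close>

definition finite_array :: "(nat \<Rightarrow> nat \<Rightarrow> real) \<Rightarrow> bool" where
  "finite_array c \<longleftrightarrow> finite {(i, j). c i j \<noteq> 0}"

definition subst_op ::
  "(nat \<Rightarrow> nat \<Rightarrow> real) \<Rightarrow> ('v \<Rightarrow> 'v) \<Rightarrow> ('v \<Rightarrow> 'v) \<Rightarrow> 'v \<Rightarrow> 'v::real_vector" where
  "subst_op c X1 X2 g = (\<Sum>(i, j)\<in>{(i, j). c i j \<noteq> 0}. c i j *\<^sub>R (X1 ^^ i) ((X2 ^^ j) g))"

definition D1 :: "(real \<Rightarrow> real) \<Rightarrow> real \<Rightarrow> real" where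
  "D1 g = (\<lambda>z. z * deriv g z)"

definition D2 :: "real \<Rightarrow> (real \<Rightarrow> real) \<Rightarrow> real \<Rightarrow> real" where
  "D2 \<beta> g = (\<lambda>z. z * deriv (deriv g) z + (\<beta> + 1) * deriv g z)"

definition B_coeffs ::
  "nat \<Rightarrow> nat \<Rightarrow> real \<Rightarrow> (nat \<Rightarrow> real) \<Rightarrow> real poly \<Rightarrow> nat \<Rightarrow> nat \<Rightarrow> real" where
  "B_coeffs k \<alpha> \<beta> a f =
     (THE c. finite_array c \<and>
        (\<forall>n. subst_op c D1 (D2 \<beta>) (qfun k \<alpha> \<beta> a n)
             = poly f (lam (real \<alpha> + \<beta>) (real n - real k / 2)) *\<^sub>R qfun k \<alpha> \<beta> a n))"

section \<open>Differential operators and spherical harmonics on \<open>\<real>\<^sup>d\<close>\<close>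

definition partial :: "'d \<Rightarrow> (real ^ 'd \<Rightarrow> real) \<Rightarrow> real ^ 'd \<Rightarrow> real" where
  "partial j g = (\<lambda>x. frechet_derivative g (at x) (axis j 1))"

definition euler :: "(real ^ 'd \<Rightarrow> real) \<Rightarrow> real ^ 'd \<Rightarrow> real" where
  "euler g = (\<lambda>x. \<Sum>j\<in>UNIV. vec_nth x j * partial j g x)"

definition laplacian :: "(real ^ 'd \<Rightarrow> real) \<Rightarrow> real ^ 'd \<Rightarrow> real" where
  "laplacian g = (\<lambda>x. \<Sum>j\<in>UNIV. partial j (partial j g) x)"

definition harm :: "nat \<Rightarrow> (real ^ 'd \<Rightarrow> real) set" where
  "harm l = {Y. real_polynomial_function Y \<and> (\<forall>c x. Y (c *\<^sub>R x) = c ^ l * Y x)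
                \<and> laplacian Y = (\<lambda>x. 0)}"

text \<open>Surface measure via polar coordinates:
  \<open>\<omega>(A) = d \<cdot> vol {r x | x \<in> A, 0 < r < 1}\<close> for \<open>A \<subseteq> S\<^sup>d\<^sup>-\<^sup>1\<close>; note that \<open>sgn x = x / \<parallel>x\<parallel>\<close>.
  For \<open>d = 1\<close> this is the counting measure on \<open>{-1, 1}\<close>.\<close>

definition surface_measure :: "(real ^ 'd) measure" where
  "surface_measure =
     scale_measure (of_nat CARD('d))
       (distr (restrict_space lborel (ball 0 1 - {0})) (restrict_space borel (sphere 0 1)) sgn)"

definition sphere_inner :: "(real ^ 'd \<Rightarrow> real) \<Rightarrow> (real ^ 'd \<Rightarrow> real) \<Rightarrow> real" where
  "sphere_inner Y Z =
     (1 / measure (surface_measure :: (real ^ 'd) measure) (sphere 0 1))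
     * (\<integral>x. Y x * Z x \<partial>surface_measure)"

text \<open>\<open>Y l j\<close> matters only for \<open>1 \<le> j \<le> dim (harm l)\<close>.\<close>

definition harmonic_basis :: "(nat \<Rightarrow> nat \<Rightarrow> real ^ 'd \<Rightarrow> real) \<Rightarrow> bool" where
  "harmonic_basis Y \<longleftrightarrow>
     (\<forall>l. basis_family (Y l) {1..dim (harm l :: (real ^ 'd \<Rightarrow> real) set)} (harm l)) \<and>
     (\<forall>l1 l2. \<forall>j1\<in>{1..dim (harm l1 :: (real ^ 'd \<Rightarrow> real) set)}.
              \<forall>j2\<in>{1..dim (harm l2 :: (real ^ 'd \<Rightarrow> real) set)}.
        sphere_inner (Y l1 j1) (Y l2 j2) = (if l1 = l2 \<and> j1 = j2 then 1 else 0))"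

definition Q_index :: "'d::finite itself \<Rightarrow> (nat \<times> nat \<times> nat) set" where
  "Q_index _ = {(n, i, j). 2 * i \<le> n \<and>
                  j \<in> {1..dim (harm (n - 2 * i) :: (real ^ 'd \<Rightarrow> real) set)}}"

definition Qfun ::
  "nat \<Rightarrow> nat \<Rightarrow> (nat \<Rightarrow> real) \<Rightarrow> (nat \<Rightarrow> nat \<Rightarrow> real ^ 'd \<Rightarrow> real)
     \<Rightarrow> nat \<times> nat \<times> nat \<Rightarrow> real ^ 'd \<Rightarrow> real" where
  "Qfun k \<alpha> a Y = (\<lambda>(n, i, j) x.
     qhat k \<alpha> (real CARD('d) / 2 - 1) a i (n - 2 * i) ((norm x)\<^sup>2) * Y (n - 2 * i) j x)"

end

theory Submission
  imports Defs
begin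

text \<open>
  Write \<open>c = \<alpha> + \<beta> + 1\<close> and \<open>\<lambda>\<^sub>x = x (x + c)\<close>.  In the basis \<open>e\<^sub>l = z\<^sup>l / ((\<beta> + 1)\<^sub>l l!)\<close> the generators act by
  \<open>D\<^sub>1 e\<^sub>l = l e\<^sub>l\<close> and \<open>D\<^sub>2 e\<^sub>l = e\<^bsub>l-1\<^esub>\<close>, and the coefficients of the Jacobi polynomials involve \<open>\<alpha>\<close> and \<open>\<beta>\<close> through \<open>c\<close>
  alone.  If \<open>Y\<close> is a harmonic polynomial of degree \<open>s\<close>, the functions \<open>\<parallel>x\<parallel>\<^bsup>2l\<^esup> Y / ((\<beta> + s + 1)\<^sub>l l!)\<close> obey the same
  rules for \<open>x \<cdot> \<nabla> / 2\<close> and \<open>\<Delta> / 4\<close>, except that \<open>l\<close> is replaced by \<open>l + s / 2\<close> in the first (\<open>ladder_hyp_term\<close>,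
  \<open>ladder_solid\<close>).  Both sides of the theorem are therefore statements about coefficient sequences that differ
  only in an offset \<open>\<delta> = s / 2\<close>, and \<open>Q\<close> is obtained from \<open>q\<close> by moving the argument \<open>i\<close> to \<open>i + \<delta> = n / 2\<close>
  (\<open>qhat_expand\<close>).

  It remains to know that \<open>B\<^sub>f\<close> exists, is unique, and has its spectral property at every offset.  The
  operator can be written down.  The functions \<open>\<psi>\<close> are polynomials in \<open>\<lambda>\<^sub>x\<close>, so an operator in the algebra can
  multiply \<open>p\<^sub>n\<close> by \<open>\<psi>\<^sub>n\<close>; and \<open>S = D\<^sub>1 + c / 2\<close> acts on the Jacobi polynomials by summation,
  \<open>S p\<^sub>n = (2 n + c) p\<^sub>n / 2 + \<Sum>\<^bsub>m<n\<^esub> (2 m + c) p\<^sub>m\<close>.  Since \<open>q\<^sub>n\<close> is a determinant with rows \<open>\<psi>\<close>, the sum of the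
  \<open>\<psi>\<^bsub>n-r\<^esub> p\<^bsub>n-r\<^esub>\<close> with the cofactors of \<open>p\<^bsub>n-r\<^esub>\<close> as weights is mapped by \<open>S\<close> to a combination of \<open>p\<^sub>n, \<dots>, p\<^bsub>n-k\<^esub>\<close>
  only.  If \<open>\<tau>\<^bsub>n-1\<^esub>\<close> divides \<open>f(\<lambda>\<^bsub>n-k/2\<^esub>) - f(\<lambda>\<^bsub>n-k/2-1\<^esub>)\<close>, then cofactors of \<open>\<tau>\<close>, weighted by the quotient, are
  coefficients for which a combination of such operators reproduces \<open>q\<^sub>n\<close> times a telescoping sum of
  these differences (\<open>coef_identity\<close>, \<open>spectral_operator\<close>).  The argument is valid for real \<open>n + \<delta>\<close>, so the offset
  costs nothing.  Uniqueness (\<open>act_determined\<close>) holds because \<open>q\<^sub>n\<close> has degree \<open>n\<close> for almost all \<open>n\<close>: its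
  leading coefficient is a multiple of \<open>\<tau>\<^bsub>n-1\<^esub>\<close>, and \<open>\<tau>\<close> is not the zero polynomial, being a Casoratian of
  polynomials of distinct degrees (\<open>casoratian_distinct_degrees\<close>).

  For the basis, every polynomial is a sum of functions \<open>\<parallel>x\<parallel>\<^bsup>2l\<^esup> h\<close> with \<open>h\<close> harmonic and homogeneous
  (\<open>fischer_decomposition\<close>), and if \<open>\<tau>\<close> has no zero among the numbers \<open>m / 2 - 1\<close>, the change from
  \<open>\<parallel>x\<parallel>\<^bsup>2i\<^esup> Y\<close> to \<open>Q\<close> is triangular with nonzero diagonal.  Independence is tested by powers of \<open>\<Delta>\<close>, which
  lower the radial degree (\<open>Q_spans\<close>, \<open>Q_independent\<close>).
\<close>

section \<open>Determinants of arrays\<close>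

text \<open>Determinants are taken of arrays of entries, so that entries can be rewritten directly and the size
  is an ordinary number.\<close>

definition fdet :: "nat \<Rightarrow> (nat \<Rightarrow> nat \<Rightarrow> 'a::comm_ring_1) \<Rightarrow> 'a" where
  "fdet n g = Determinant.det (Matrix.mat n n (\<lambda>(i, j). g i j))"

lemma fdet_cong:
  assumes "\<And>i j. i < n \<Longrightarrow> j < n \<Longrightarrow> g i j = h i j"
  shows "fdet n g = fdet n h"
proof -
  have "Matrix.mat n n (\<lambda>(i, j). g i j) = Matrix.mat n n (\<lambda>(i, j). h i j)"
    using assms by (intro eq_matI) auto
  then show ?thesis by (simp add: fdet_def)
qed

lemma fdet_leibniz:
  "fdet n g = (\<Sum>p | p permutes {0..<n}. signof p * (\<Prod>i=0..<n. g i (p i)))"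
proof -
  have "fdet n g = (\<Sum>p | p permutes {0..<n}. signof p *
      (\<Prod>i=0..<n. Matrix.mat n n (\<lambda>(i, j). g i j) $$ (i, p i)))"
    unfolding fdet_def by (rule det_def') simp
  also have "\<dots> = (\<Sum>p | p permutes {0..<n}. signof p * (\<Prod>i=0..<n. g i (p i)))"
    by (intro sum.cong refl arg_cong2[of _ _ _ _ "(*)"] prod.cong)
       (auto dest: permutes_in_image)
  finally show ?thesis .
qed

lemma fdet_mult:
  "fdet n g * fdet n h = fdet n (\<lambda>i j. \<Sum>s<n. g i s * h s j)"
proof -
  have "Matrix.mat n n (\<lambda>(i, j). g i j) * Matrix.mat n n (\<lambda>(i, j). h i j)
      = Matrix.mat n n (\<lambda>(i, j). \<Sum>s<n. g i s * h s j)"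
    by (rule eq_matI) (auto simp: times_mat_def scalar_prod_def atLeast0LessThan intro!: sum.cong)
  then show ?thesis
    unfolding fdet_def by (subst det_mult[symmetric, where n = n]) auto
qed

lemma fdet_replace_col:
  assumes "j < n"
  shows "fdet n (\<lambda>i t. if t = j then w i else g i t)
    = (\<Sum>h<n. w h * cofactor (Matrix.mat n n (\<lambda>(i, j). g i j)) h j)"
proof -
  let ?A = "Matrix.mat n n (\<lambda>(i, t). if t = j then w i else g i t)"
  have *: "mat_delete ?A h j = mat_delete (Matrix.mat n n (\<lambda>(i, j). g i j)) h j" if "h < n" for h
    using that assms by (intro eq_matI) (auto simp: mat_delete_def)
  have "fdet n (\<lambda>i t. if t = j then w i else g i t) = (\<Sum>h<n. ?A $$ (h, j) * cofactor ?A h j)"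
    unfolding fdet_def by (rule laplace_expansion_column) (use assms in auto)
  also have "\<dots> = (\<Sum>h<n. w h * cofactor (Matrix.mat n n (\<lambda>(i, j). g i j)) h j)"
    using assms by (intro sum.cong refl) (auto simp: cofactor_def *)
  finally show ?thesis .
qed

lemma fdet_replace_row:
  assumes "i < n"
  shows "fdet n (\<lambda>s j. if s = i then w j else g s j)
    = (\<Sum>h<n. w h * cofactor (Matrix.mat n n (\<lambda>(i, j). g i j)) i h)"
proof -
  let ?A = "Matrix.mat n n (\<lambda>(s, j). if s = i then w j else g s j)"
  have *: "mat_delete ?A i h = mat_delete (Matrix.mat n n (\<lambda>(i, j). g i j)) i h" if "h < n" for h
    using that assms by (intro eq_matI) (auto simp: mat_delete_def)
  have "fdet n (\<lambda>s j. if s = i then w j else g s j) = (\<Sum>h<n. ?A $$ (i, h) * cofactor ?A i h)"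
    unfolding fdet_def by (rule laplace_expansion_row) (use assms in auto)
  also have "\<dots> = (\<Sum>h<n. w h * cofactor (Matrix.mat n n (\<lambda>(i, j). g i j)) i h)"
    using assms by (intro sum.cong refl) (auto simp: cofactor_def *)
  finally show ?thesis .
qed

lemma fdet_equal_rows:
  assumes "i < n" "h < n" "i \<noteq> h" "\<And>j. j < n \<Longrightarrow> g i j = g h j"
  shows "fdet n g = 0"
  unfolding fdet_def
  by (rule Determinant.det_identical_rows[where i = i and j = h]) (use assms in \<open>auto intro!: eq_vecI\<close>)

lemma fdet_equal_cols:
  assumes "i < n" "h < n" "i \<noteq> h" "\<And>j. j < n \<Longrightarrow> g j i = g j h"
  shows "fdet n g = 0"
  unfolding fdet_def
  by (rule Determinant.det_identical_columns[where i = i and j = h]) (use assms in \<open>auto intro!: eq_vecI\<close>)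

text \<open>The sign of the permutation that reverses the order of \<open>n\<close> columns.\<close>

definition rev_sign :: "nat \<Rightarrow> real" where
  "rev_sign n = fdet n (\<lambda>i j. if i = n - 1 - j then 1 else 0)"

lemma fdet_reverse_cols: "fdet n (\<lambda>i j. g i (n - 1 - j)) = rev_sign n * fdet n g"
proof -
  have "fdet n g * rev_sign n
      = fdet n (\<lambda>i j. \<Sum>s<n. g i s * (if s = n - 1 - j then 1 else 0))"
    unfolding rev_sign_def by (rule fdet_mult)
  also have "\<dots> = fdet n (\<lambda>i j. g i (n - 1 - j))"
    by (rule fdet_cong) (simp add: if_distrib cong: if_cong)
  finally show ?thesis by (simp add: mult.commute)
qed

lemma rev_sign_square: "rev_sign n * rev_sign n = 1"
proof -
  let ?I = "\<lambda>i j. if i = j then 1 else 0 :: real"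
  have "Matrix.mat n n (\<lambda>(i, j). ?I i j) = 1\<^sub>m n" by (rule eq_matI) auto
  then have 1: "fdet n ?I = 1" by (simp add: fdet_def)
  have "fdet n ?I = fdet n (\<lambda>i j. ?I i (n - 1 - (n - 1 - j)))" by (rule fdet_cong) auto
  also have "\<dots> = rev_sign n * (rev_sign n * fdet n ?I)"
    using fdet_reverse_cols[of n "\<lambda>i j. ?I i (n - 1 - j)"] fdet_reverse_cols[of n ?I] by simp
  finally show ?thesis using 1 by simp
qed

text \<open>Laplace expansion along column \<open>j\<close>, with the cofactors written as determinants again: in this form
  the effect on them of reversing all columns can be read off.\<close>

lemma fdet_unit_replace_col:
  assumes "j < n"
  shows "fdet n (\<lambda>i t. if t = j then w i else g i t)
    = (\<Sum>h<n. w h * fdet n (\<lambda>i t. if t = j then (if i = h then 1 else 0) else g i t))"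
proof -
  have "fdet n (\<lambda>i t. if t = j then (if i = h then 1 else 0) else g i t)
      = cofactor (Matrix.mat n n (\<lambda>(i, j). g i j)) h j" if "h < n" for h
    using that by (simp add: fdet_replace_col[OF assms] if_distrib[of "\<lambda>x. x * _"] cong: if_cong)
  then show ?thesis by (simp add: fdet_replace_col[OF assms])
qed

section \<open>Polynomials invariant under a reflection\<close>

definition polyfun :: "(real \<Rightarrow> real) \<Rightarrow> bool" where
  "polyfun g \<longleftrightarrow> (\<exists>p. \<forall>x. g x = poly p x)"

lemma polyfunI: "(\<And>x. g x = poly p x) \<Longrightarrow> polyfun g"
  by (auto simp: polyfun_def)

lemma polyfun_poly: "polyfun g \<Longrightarrow> polyfun (\<lambda>x. poly p (g x))"
  unfolding polyfun_def using poly_pcompose by metis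

lemma polyfun_const [simp]: "polyfun (\<lambda>_. c)"
  by (rule polyfunI[where p = "[:c:]"]) simp

lemma polyfun_ident [simp]: "polyfun (\<lambda>x. x)"
  by (rule polyfunI[where p = "[:0, 1:]"]) simp

lemma polyfun_add: "polyfun g \<Longrightarrow> polyfun h \<Longrightarrow> polyfun (\<lambda>x. g x + h x)"
  unfolding polyfun_def using poly_add by metis

lemma polyfun_diff: "polyfun g \<Longrightarrow> polyfun h \<Longrightarrow> polyfun (\<lambda>x. g x - h x)"
  unfolding polyfun_def using poly_diff by metis

lemma polyfun_mult: "polyfun g \<Longrightarrow> polyfun h \<Longrightarrow> polyfun (\<lambda>x. g x * h x)"
  unfolding polyfun_def using poly_mult by metis

lemma polyfun_sum: "(\<And>i. i \<in> I \<Longrightarrow> polyfun (g i)) \<Longrightarrow> polyfun (\<lambda>x. \<Sum>i\<in>I. g i x)"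
  by (induction I rule: infinite_finite_induct) (auto intro: polyfun_add)

lemma polyfun_prod: "(\<And>i. i \<in> I \<Longrightarrow> polyfun (g i)) \<Longrightarrow> polyfun (\<lambda>x. \<Prod>i\<in>I. g i x)"
  by (induction I rule: infinite_finite_induct) (auto intro: polyfun_mult)

lemma polyfun_if: "polyfun g \<Longrightarrow> polyfun h \<Longrightarrow> polyfun (\<lambda>x. if b then g x else h x)"
  by (cases b) simp_all

lemma polyfun_fdet:
  assumes "\<And>i j. i < n \<Longrightarrow> j < n \<Longrightarrow> polyfun (\<lambda>x. g x i j)"
  shows "polyfun (\<lambda>x. fdet n (g x))"
  unfolding fdet_leibniz
  by (intro polyfun_sum polyfun_mult polyfun_const polyfun_prod assms) (auto dest: permutes_in_image)

lemma poly_reflect: "poly (pcompose q [:- c, -1:]) x = poly q (- x - c :: real)"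
proof -
  have "poly (pcompose q [:- c, -1:]) x = poly q (- c - x)" by (simp add: poly_pcompose)
  also have "- c - x = - x - c" by (rule minus_diff_commute)
  finally show ?thesis .
qed

text \<open>Subtracting the common value at \<open>0\<close> and \<open>- c\<close> leaves a multiple of \<open>x (x + c)\<close>, whose
  cofactor is invariant again and of smaller degree.\<close>

lemma invariant_polynomial_in_lambda:
  fixes p :: "real poly"
  assumes "c \<noteq> 0" and "\<And>x. poly p (- x - c) = poly p x"
  shows "\<exists>M. \<forall>x. poly p x = poly M (x * (x + c))"
  using assms(2)
proof (induction "degree p" arbitrary: p rule: less_induct)
  case less
  define \<Lambda> :: "real poly" where "\<Lambda> = [:0, 1:] * [:c, 1:]"
  have ev: "poly \<Lambda> x = x * (x + c)" for x by (simp add: \<Lambda>_def algebra_simps)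
  have "\<Lambda> \<noteq> 0" by (simp add: \<Lambda>_def)
  let ?p0 = "p - [:poly p 0:]"
  have "[:0, 1:] dvd ?p0" using poly_eq_0_iff_dvd[of ?p0 0] by simp
  then obtain r where r: "?p0 = [:0, 1:] * r" by (elim dvdE)
  have "poly ?p0 (- c) = 0" using less.prems[of 0] by simp
  then have "poly r (- c) = 0" using assms(1) unfolding r by simp
  then obtain q where "r = [:c, 1:] * q" using poly_eq_0_iff_dvd[of r "- c"] by (auto elim: dvdE)
  with r have q: "?p0 = \<Lambda> * q" by (simp only: \<Lambda>_def mult.assoc)
  have val: "poly p x = poly p 0 + x * (x + c) * poly q x" for x
    using arg_cong[OF q, of "\<lambda>w. poly w x"] by (simp add: ev)
  show ?case
  proof (cases "q = 0")
    case True
    then show ?thesis using val by (intro exI[of _ "[:poly p 0:]"]) simp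
  next
    case False
    have "degree \<Lambda> = 2" by (simp add: \<Lambda>_def degree_mult_eq)
    then have "degree ?p0 = 2 + degree q" unfolding q using False \<open>\<Lambda> \<noteq> 0\<close> by (simp add: degree_mult_eq)
    moreover have "degree ?p0 \<le> degree p" by (rule degree_diff_le) auto
    ultimately have "degree q < degree p" by simp
    moreover have "poly q (- x - c) = poly q x" for x
    proof -
      have "poly (\<Lambda> * (pcompose q [:- c, -1:] - q)) x = 0" for x
        using less.prems[of x] val[of x] val[of "- x - c"] by (simp add: ev poly_reflect algebra_simps)
      then have "\<Lambda> * (pcompose q [:- c, -1:] - q) = 0" using poly_all_0_iff_0 by blast
      then have "pcompose q [:- c, -1:] = q" using \<open>\<Lambda> \<noteq> 0\<close> by simp
      then have "poly (pcompose q [:- c, -1:]) x = poly q x" by simp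
      then show ?thesis by (simp add: poly_reflect)
    qed
    ultimately obtain M where M: "\<And>x. poly q x = poly M (x * (x + c))" using less.hyps by blast
    show ?thesis
      by (intro exI[of _ "[:poly p 0, 1:] + (M - [:1:]) * [:0, 1:]"] allI, subst val) (simp add: M algebra_simps)
  qed
qed

lemma invariant_polyfun:
  assumes "polyfun g" "c \<noteq> 0" "\<And>x. g (- x - c) = g x"
  shows "\<exists>M. \<forall>x. g x = poly M (x * (x + c))"
proof -
  obtain p where p: "\<And>x. g x = poly p x" using assms(1) by (auto simp: polyfun_def)
  show ?thesis using invariant_polynomial_in_lambda[of c p] assms p by simp
qed

text \<open>An odd polynomial vanishes at the centre \<open>- c / 2\<close> of the reflection, and dividing by \<open>2 x + c\<close> leaves an
  invariant one.\<close>

lemma anti_invariant_polyfun: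
  assumes "polyfun g" "c \<noteq> 0" "\<And>x. g (- x - c) = - g x"
  shows "\<exists>M. \<forall>x. g x = (2 * x + c) * poly M (x * (x + c))"
proof -
  obtain p where p: "\<And>x. g x = poly p x" using assms(1) by (auto simp: polyfun_def)
  have "poly p (- c / 2) = 0" using assms(3)[of "- c / 2"] p by simp
  then obtain q where q: "p = [:c / 2, 1:] * q" using poly_eq_0_iff_dvd[of p "- c / 2"] by (auto elim: dvdE)
  have "poly ([:c / 2, 1:] * (pcompose q [:- c, -1:] - q)) x = 0" for x
    using assms(3)[of x] unfolding p q by (simp add: poly_reflect field_simps)
  then have "[:c / 2, 1:] * (pcompose q [:- c, -1:] - q) = 0" using poly_all_0_iff_0 by blast
  then have *: "pcompose q [:- c, -1:] = q" unfolding mult_eq_0_iff by simp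
  have "poly q (- x - c) = poly q x" for x
    using arg_cong[OF *, of "\<lambda>w. poly w x"] by (simp add: poly_reflect)
  then obtain M where "\<And>x. poly q x = poly M (x * (x + c))"
    using invariant_polynomial_in_lambda[of c q] assms(2) by blast
  then have "g x = (2 * x + c) * poly (Polynomial.smult (1/2) M) (x * (x + c))" for x
    unfolding p q by (simp add: field_simps)
  then show ?thesis by blast
qed

section \<open>Operators on coefficient sequences\<close>

text \<open>A sequence \<open>v\<close> stands for \<open>\<Sum> v l e\<^sub>l\<close>, where \<open>D\<^sub>1 e\<^sub>l = (l + \<delta>) e\<^sub>l\<close> and \<open>D\<^sub>2 e\<^sub>l = e\<^bsub>l-1\<^esub>\<close>.  On coefficients \<open>D\<^sub>1\<close>
  multiplies by \<open>l + \<delta>\<close> and \<open>D\<^sub>2\<close> is the shift \<open>v l \<mapsto> v (l + 1)\<close>.  The polynomial \<open>B\<close> in \<open>D\<^sub>2\<close> with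
  coefficients in \<open>\<real>[D\<^sub>1]\<close> is the normally ordered element \<open>\<Sum> B\<^sub>j(D\<^sub>1) D\<^sub>2\<^sup>j\<close> of the algebra.  The offset is
  \<open>\<delta> = 0\<close> in one variable and \<open>\<delta> = s / 2\<close> on multiples of a harmonic polynomial of degree \<open>s\<close>.\<close>

definition act :: "real \<Rightarrow> real poly poly \<Rightarrow> (nat \<Rightarrow> real) \<Rightarrow> nat \<Rightarrow> real" where
  "act \<delta> B v = (\<lambda>l. \<Sum>j\<le>degree B. poly (Polynomial.coeff B j) (real l + \<delta>) * v (l + j))"

text \<open>The same \<open>B\<close> has to serve for every offset; this is what carries an operator from one variable to
  \<open>\<real>\<^sup>d\<close>.\<close>

definition ladder_op :: "(real \<Rightarrow> (nat \<Rightarrow> real) \<Rightarrow> nat \<Rightarrow> real) \<Rightarrow> bool" where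
  "ladder_op T \<longleftrightarrow> (\<exists>B. \<forall>\<delta>. T \<delta> = act \<delta> B)"

lemma act_altdef:
  assumes "degree B \<le> N"
  shows "act \<delta> B v l = (\<Sum>j\<le>N. poly (Polynomial.coeff B j) (real l + \<delta>) * v (l + j))"
  unfolding act_def using assms
  by (intro sum.mono_neutral_left) (auto simp: coeff_eq_0)

lemma ladder_opI:
  assumes "\<And>\<delta> v l. T \<delta> v l = (\<Sum>j\<le>N. poly (b j) (real l + \<delta>) * v (l + j))"
  shows "ladder_op T"
proof -
  let ?B = "\<Sum>j\<le>N. monom (b j) j"
  have c: "Polynomial.coeff ?B j = (if j \<le> N then b j else 0)" for j
    by (simp add: coeff_sum if_distrib cong: if_cong)
  have "degree ?B \<le> N" by (rule degree_le) (simp add: c)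
  then have "T \<delta> = act \<delta> ?B" for \<delta>
    by (intro ext) (simp add: act_altdef assms c)
  then show ?thesis unfolding ladder_op_def by blast
qed

lemma ladder_op_add:
  assumes "ladder_op T" "ladder_op U"
  shows "ladder_op (\<lambda>\<delta> v. T \<delta> v + U \<delta> v)"
proof -
  obtain B C where B: "\<And>\<delta>. T \<delta> = act \<delta> B" and C: "\<And>\<delta>. U \<delta> = act \<delta> C"
    using assms by (auto simp: ladder_op_def)
  let ?N = "max (degree B) (degree C)"
  show ?thesis
    by (rule ladder_opI[where N = ?N and b = "\<lambda>j. Polynomial.coeff B j + Polynomial.coeff C j"])
       (simp add: B C act_altdef[of _ ?N] sum.distrib ring_distribs)
qed

lemma ladder_op_zero: "ladder_op (\<lambda>\<delta> v. 0)"
  by (rule ladder_opI[where N = 0 and b = "\<lambda>_. 0"]) simp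

lemma ladder_op_sum: "(\<And>i. i \<in> I \<Longrightarrow> ladder_op (T i)) \<Longrightarrow> ladder_op (\<lambda>\<delta> v. \<Sum>i\<in>I. T i \<delta> v)"
  by (induction I rule: infinite_finite_induct) (auto intro: ladder_op_add ladder_op_zero)

lemma ladder_op_monomial: "ladder_op (\<lambda>\<delta> v l. poly p (real l + \<delta>) * v (l + j))"
proof (rule ladder_opI[where N = j and b = "\<lambda>i. if i = j then p else 0"])
  fix \<delta> l and v :: "nat \<Rightarrow> real"
  have "(\<Sum>i\<le>j. poly (if i = j then p else 0) (real l + \<delta>) * v (l + i))
      = (\<Sum>i\<le>j. if i = j then poly p (real l + \<delta>) * v (l + i) else 0)"
    by (intro sum.cong) auto
  then show "poly p (real l + \<delta>) * v (l + j)
      = (\<Sum>i\<le>j. poly (if i = j then p else 0) (real l + \<delta>) * v (l + i))" by simp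
qed

lemma sum_fun_app: "(\<Sum>i\<in>I. f i) x = (\<Sum>i\<in>I. f i x)" for f :: "'a \<Rightarrow> 'b \<Rightarrow> 'c::comm_monoid_add"
  by (induction I rule: infinite_finite_induct) auto

text \<open>Normal ordering: \<open>D\<^sub>2\<^sup>j b(D\<^sub>1) = b(D\<^sub>1 + j) D\<^sub>2\<^sup>j\<close>.\<close>

lemma ladder_op_comp:
  assumes "ladder_op T" "ladder_op U"
  shows "ladder_op (\<lambda>\<delta> v. T \<delta> (U \<delta> v))"
proof -
  obtain B C where B: "\<And>\<delta>. T \<delta> = act \<delta> B" and C: "\<And>\<delta>. U \<delta> = act \<delta> C"
    using assms by (auto simp: ladder_op_def)
  have "(\<lambda>\<delta> v. T \<delta> (U \<delta> v)) = (\<lambda>\<delta> v. \<Sum>j\<le>degree B. \<Sum>i\<le>degree C. (\<lambda>l.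
      poly (Polynomial.coeff B j * pcompose (Polynomial.coeff C i) [:real j, 1:]) (real l + \<delta>) * v (l + (j + i))))"
    by (intro ext) (simp add: B C act_def sum_fun_app sum_distrib_left poly_pcompose add_ac mult_ac)
  then show ?thesis by (simp only:) (intro ladder_op_sum ladder_op_monomial)
qed

lemma ladder_op_multiplier: "ladder_op (\<lambda>\<delta> v l. poly p (real l + \<delta>) * v l)"
  using ladder_op_monomial[of p 0] by simp

lemma ladder_op_shift: "ladder_op (\<lambda>\<delta> v l. v (Suc l))"
  using ladder_op_monomial[of 1 1] by simp

lemma ladder_op_id: "ladder_op (\<lambda>\<delta> v. v)"
  using ladder_op_monomial[of 1 0] by simp

lemma ladder_op_scale: "ladder_op T \<Longrightarrow> ladder_op (\<lambda>\<delta> v. r *\<^sub>R T \<delta> v)"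
  using ladder_op_comp[OF ladder_op_monomial[of "[:r:]" 0]] by (simp add: scaleR_fun_def)

lemma ladder_op_funpow: "ladder_op T \<Longrightarrow> ladder_op (\<lambda>\<delta>. T \<delta> ^^ m)"
proof (induction m)
  case 0
  then show ?case using ladder_op_id by (simp add: id_def)
next
  case (Suc m)
  then show ?case using ladder_op_comp[of T "\<lambda>\<delta>. T \<delta> ^^ m"] by (simp add: comp_def)
qed

lemma linear_act: "linear (act \<delta> B)"
  by (rule linearI) (auto simp: fun_eq_iff act_def scaleR_fun_def algebra_simps sum.distrib sum_distrib_left)

lemma linear_weyl: "ladder_op T \<Longrightarrow> linear (T \<delta>)"
  unfolding ladder_op_def using linear_act by metis

definition polyop :: "real poly \<Rightarrow> ('v::real_vector \<Rightarrow> 'v) \<Rightarrow> 'v \<Rightarrow> 'v" where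
  "polyop g T v = (\<Sum>i\<le>degree g. Polynomial.coeff g i *\<^sub>R (T ^^ i) v)"

lemma ladder_op_polyop: "ladder_op T \<Longrightarrow> ladder_op (\<lambda>\<delta>. polyop g (T \<delta>))"
  unfolding polyop_def by (intro ladder_op_sum ladder_op_scale ladder_op_funpow)

lemma funpow_eigenvector:
  assumes "linear T" "T v = \<mu> *\<^sub>R v"
  shows "(T ^^ i) v = (\<mu> ^ i) *\<^sub>R v"
  by (induction i) (use assms in \<open>auto simp: linear_scale mult.commute\<close>)

lemma polyop_eigenvector:
  assumes "linear T" "T v = \<mu> *\<^sub>R v"
  shows "polyop g T v = poly g \<mu> *\<^sub>R v"
  by (simp add: polyop_def funpow_eigenvector[OF assms] poly_altdef scaleR_sum_left)

section \<open>Jacobi sequences\<close>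

text \<open>The coefficients of the Jacobi polynomial of degree \<open>n\<close> with respect to \<open>e\<^sub>l = z\<^sup>l / ((\<beta> + 1)\<^sub>l l!)\<close>.  In this
  basis they depend on the parameters only through \<open>c = \<alpha> + \<beta> + 1\<close>.\<close>

definition jac :: "real \<Rightarrow> int \<Rightarrow> nat \<Rightarrow> real" where
  "jac c n l = (if int l \<le> n
     then (-1) ^ (nat n + l) * pochhammer c (nat n + l) / fact (nat n - l) else 0)"

lemma jac_below: "jac c (int (l + m)) l = (-1) ^ m * pochhammer c (2 * l + m) / fact m"
proof -
  have "(-1::real) ^ (l + m + l) = (-1) ^ m" by (simp add: power_add flip: mult_2)
  moreover have "pochhammer c (2 * l + m) = pochhammer c (l + m + l)"
    by (rule arg_cong[where f = "pochhammer c"]) simp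
  ultimately show ?thesis by (simp add: jac_def nat_add_distrib del: add.assoc)
qed

lemma jac_above: "n < int l \<Longrightarrow> jac c n l = 0"
  by (simp add: jac_def)

lemma jac_Suc_below:
  "jac c (int (l + Suc m)) l = - (real (2 * l + m) + c) / real (Suc m) * jac c (int (l + m)) l"
  unfolding jac_below by (simp add: pochhammer_Suc field_simps)

lemma jac_step_degree:
  "(of_int n + real l + c - 1) * jac c (n - 1) l = - (of_int n - real l) * jac c n l"
proof (cases "int l < n")
  case True
  define m where "m = nat n - Suc l"
  have n: "n = int (l + Suc m)" using True by (simp add: m_def)
  have n1: "n - 1 = int (l + m)" using n by simp
  show ?thesis unfolding n1 unfolding n jac_Suc_below by (simp add: field_simps)
next
  case False
  then show ?thesis by (cases "n = int l") (simp_all add: jac_above)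
qed

lemma jac_step_coeff:
  "jac c n (Suc l) = - (of_int n - real l) * (of_int n + real l + c) * jac c n l"
proof (cases "int l < n")
  case True
  define m where "m = nat n - Suc l"
  have n: "n = int (l + Suc m)" and n': "n = int (Suc l + m)" using True by (simp_all add: m_def)
  have "jac c n (Suc l) = (-1) ^ m * pochhammer c (Suc (Suc (2 * l + m))) / fact m"
    unfolding n' jac_below by simp
  also have "\<dots> = (c + real (2 * l + m)) * (c + real (2 * l + m) + 1) * jac c (int (l + m)) l"
    unfolding jac_below by (simp add: pochhammer_Suc algebra_simps add_divide_distrib)
  also have "\<dots> = - (of_int n - real l) * (of_int n + real l + c) * jac c n l"
    unfolding n jac_Suc_below by (simp add: field_simps)
  finally show ?thesis .
next
  case False
  then show ?thesis by (cases "n = int l") (simp_all add: jac_above)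
qed

text \<open>The hypergeometric operator \<open>D\<^sub>1 (D\<^sub>1 + c) - D\<^sub>2\<close>, of which the Jacobi polynomials are eigenfunctions.\<close>

definition hyp_op :: "real \<Rightarrow> real \<Rightarrow> (nat \<Rightarrow> real) \<Rightarrow> nat \<Rightarrow> real" where
  "hyp_op c \<delta> v l = (real l + \<delta>) * (real l + \<delta> + c) * v l - v (Suc l)"

definition sum_op :: "real \<Rightarrow> real \<Rightarrow> (nat \<Rightarrow> real) \<Rightarrow> nat \<Rightarrow> real" where
  "sum_op c \<delta> v l = (real l + \<delta> + c / 2) * v l"

lemma ladder_op_hyp_op: "ladder_op (hyp_op c)"
proof -
  have "hyp_op c = (\<lambda>\<delta> v. (\<lambda>l. poly [:0, c, 1:] (real l + \<delta>) * v l) + (-1) *\<^sub>R (\<lambda>l. v (Suc l)))"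
    by (intro ext) (simp add: hyp_op_def scaleR_fun_def algebra_simps)
  then show ?thesis by (simp only:) (intro ladder_op_add ladder_op_multiplier ladder_op_scale ladder_op_shift)
qed

lemma ladder_op_sum_op: "ladder_op (sum_op c)"
proof -
  have "sum_op c = (\<lambda>\<delta> v l. poly [:c / 2, 1:] (real l + \<delta>) * v l)"
    by (intro ext) (simp add: sum_op_def algebra_simps)
  then show ?thesis by (simp only:) (rule ladder_op_multiplier)
qed

lemma hyp_op_jac:
  "hyp_op c \<delta> (jac (c + 2 * \<delta>) n) = ((of_int n + \<delta>) * (of_int n + \<delta> + c)) *\<^sub>R jac (c + 2 * \<delta>) n"
  by (rule ext) (simp add: hyp_op_def scaleR_fun_def jac_step_coeff algebra_simps)

text \<open>For \<open>S = D\<^sub>1 + c / 2\<close> and \<open>g m = 2 (m + \<delta>) + c\<close> this says \<open>S p\<^sub>n - S p\<^bsub>n-1\<^esub> = (g n p\<^sub>n + g (n - 1) p\<^bsub>n-1\<^esub>) / 2\<close>, so \<open>S\<close> acts on the Jacobi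
  sequences by summation over the degree.  It is the contiguity relation \<open>jac_step_degree\<close>, rearranged.\<close>

lemma sum_op_jac:
  "sum_op c \<delta> (jac (c + 2 * \<delta>) n) = sum_op c \<delta> (jac (c + 2 * \<delta>) (n - 1))
     + ((2 * (of_int n + \<delta>) + c) / 2) *\<^sub>R jac (c + 2 * \<delta>) n
     + ((2 * (of_int (n - 1) + \<delta>) + c) / 2) *\<^sub>R jac (c + 2 * \<delta>) (n - 1)"
proof
  fix l
  show "sum_op c \<delta> (jac (c + 2 * \<delta>) n) l = (sum_op c \<delta> (jac (c + 2 * \<delta>) (n - 1))
     + ((2 * (of_int n + \<delta>) + c) / 2) *\<^sub>R jac (c + 2 * \<delta>) n
     + ((2 * (of_int (n - 1) + \<delta>) + c) / 2) *\<^sub>R jac (c + 2 * \<delta>) (n - 1)) l"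
    using jac_step_degree[of n l "c + 2 * \<delta>"]
    by (simp add: sum_op_def scaleR_fun_def field_simps)
qed

section \<open>Bordered Casoratians\<close>

definition casoratian :: "nat \<Rightarrow> (nat \<Rightarrow> real \<Rightarrow> real) \<Rightarrow> real \<Rightarrow> real" where
  "casoratian k \<psi> x = fdet k (\<lambda>i j. \<psi> i (x - real j))"

text \<open>The cofactors of the last row when the Casoratian matrix of \<open>\<psi> 0, \<dots>, \<psi> (k - 1)\<close> is bordered by a further
  function, as in the definition of \<open>q\<^sub>n\<close>.\<close>

definition border_coef :: "nat \<Rightarrow> (nat \<Rightarrow> real \<Rightarrow> real) \<Rightarrow> real \<Rightarrow> nat \<Rightarrow> real" where
  "border_coef k \<psi> x r = cofactor (Matrix.mat (Suc k) (Suc k) (\<lambda>(i, j). \<psi> i (x - real j))) k r"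

lemma border_expand:
  "fdet (Suc k) (\<lambda>i j. if i = k then w j else \<psi> i (x - real j)) = (\<Sum>r\<le>k. w r * border_coef k \<psi> x r)"
  unfolding border_coef_def by (subst fdet_replace_row) (auto simp: lessThan_Suc_atMost)

text \<open>A bordered determinant with a repeated row vanishes.\<close>

lemma border_coef_annihilates: 
  assumes "h < k"
  shows "(\<Sum>r\<le>k. \<psi> h (x - real r) * border_coef k \<psi> x r) = 0"
proof -
  have "fdet (Suc k) (\<lambda>i j. if i = k then \<psi> h (x - real j) else \<psi> i (x - real j)) = 0"
    by (rule fdet_equal_rows[of k _ h]) (use assms in auto)
  then show ?thesis using border_expand[of k "\<lambda>j. \<psi> h (x - real j)" \<psi> x] by simp
qed

lemma border_coef_0: "border_coef k \<psi> x 0 = (-1) ^ k * casoratian k \<psi> (x - 1)"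
proof -
  have "mat_delete (Matrix.mat (Suc k) (Suc k) (\<lambda>(i, j). \<psi> i (x - real j))) k 0
      = Matrix.mat k k (\<lambda>(i, j). \<psi> i (x - 1 - real j))"
    by (rule eq_matI) (auto simp: mat_delete_def algebra_simps)
  then show ?thesis by (simp add: border_coef_def cofactor_def casoratian_def fdet_def)
qed

text \<open>The coefficient sequence of \<open>qhat\<close>, for \<open>\<delta> = s / 2\<close>.\<close>

definition qseq :: "nat \<Rightarrow> real \<Rightarrow> (nat \<Rightarrow> real \<Rightarrow> real) \<Rightarrow> real \<Rightarrow> int \<Rightarrow> nat \<Rightarrow> real" where
  "qseq k c \<psi> \<delta> n = (\<Sum>r\<le>k. border_coef k \<psi> (of_int n + \<delta>) r *\<^sub>R jac (c + 2 * \<delta>) (n - int r))"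

text \<open>Among \<open>p\<^sub>n, \<dots>, p\<^bsub>n-k\<^esub>\<close> only \<open>p\<^sub>n\<close> reaches degree \<open>n\<close>, and its cofactor is a Casoratian of the \<open>\<psi>\<close>.\<close>

lemma qseq_top:
  "qseq k c \<psi> \<delta> (int n) n = (-1) ^ k * casoratian k \<psi> (real n + \<delta> - 1) * pochhammer (c + 2 * \<delta>) (2 * n)"
proof -
  have "qseq k c \<psi> \<delta> (int n) n
      = (\<Sum>r\<le>k. border_coef k \<psi> (real n + \<delta>) r * jac (c + 2 * \<delta>) (int n - int r) n)"
    by (simp add: qseq_def sum_fun_app scaleR_fun_def)
  also have "\<dots> = (\<Sum>r\<in>{0}. border_coef k \<psi> (real n + \<delta>) r * jac (c + 2 * \<delta>) (int n - int r) n)"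
    by (rule sum.mono_neutral_right) (auto simp: jac_above)
  also have "\<dots> = (-1) ^ k * casoratian k \<psi> (real n + \<delta> - 1) * pochhammer (c + 2 * \<delta>) (2 * n)"
    using jac_below[of "c + 2 * \<delta>" n 0] by (simp add: border_coef_0)
  finally show ?thesis .
qed

lemma qseq_above: "n < l \<Longrightarrow> qseq k c \<psi> \<delta> (int n) l = 0"
  by (simp add: qseq_def sum_fun_app scaleR_fun_def jac_above)

section \<open>Existence of the spectral operator\<close>

text \<open>The functions \<open>\<psi>\<close> are symmetric under \<open>x \<mapsto> - x - c\<close>, which fixes \<open>\<lambda>\<^sub>x = x (x + c)\<close>.  The intended \<open>F x\<close> is
  \<open>f(\<lambda>\<^bsub>x-k/2\<^esub>)\<close>, whose centre of symmetry is displaced by \<open>k / 2\<close>, and \<open>u\<close> is the quotient whose existence puts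
  \<open>f\<close> into the algebra.\<close>

locale casorati =
  fixes k :: nat and c :: real and \<psi> :: "nat \<Rightarrow> real \<Rightarrow> real" and F u :: "real \<Rightarrow> real"
  assumes c_nonzero: "c \<noteq> 0"
    and \<psi>_polyfun: "i < k \<Longrightarrow> polyfun (\<psi> i)"
    and \<psi>_reflect: "i < k \<Longrightarrow> \<psi> i (- x - c) = \<psi> i x"
    and \<tau>_nonzero: "\<exists>x. casoratian k \<psi> x \<noteq> 0"
    and u_polyfun: "polyfun u"
    and F_polyfun: "polyfun F"
    and F_reflect: "F (real k - c - x) = F x"
    and F_diff: "F x - F (x - 1) = u x * casoratian k \<psi> (x - 1)"
begin

abbreviation \<tau> :: "real \<Rightarrow> real" where "\<tau> \<equiv> casoratian k \<psi>"

abbreviation coef :: "real \<Rightarrow> nat \<Rightarrow> real" where "coef \<equiv> border_coef k \<psi>"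


text \<open>The Casoratian over the \<open>k\<close> points \<open>x + s, x + s - 1, \<dots>, x + s - k + 1\<close>, with the column of the
  point \<open>x\<close> replaced by \<open>w\<close>.\<close>

definition window :: "real \<Rightarrow> nat \<Rightarrow> (nat \<Rightarrow> real) \<Rightarrow> real" where
  "window x s w = fdet k (\<lambda>i t. if t = s then w i else \<psi> i (x + real s - real t))"

definition unit_window :: "real \<Rightarrow> nat \<Rightarrow> nat \<Rightarrow> real" where
  "unit_window x s h = window x s (\<lambda>i. if i = h then 1 else 0)"

lemma window_expand: "s < k \<Longrightarrow> window x s w = (\<Sum>h<k. w h * unit_window x s h)"
  unfolding window_def unit_window_def by (rule fdet_unit_replace_col)

lemma window_self: "s < k \<Longrightarrow> window x s (\<lambda>i. \<psi> i x) = \<tau> (x + real s)"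
  unfolding window_def casoratian_def by (rule fdet_cong) simp

lemma window_other:
  assumes "s < k" "t < k" "t \<noteq> s"
  shows "window x s (\<lambda>i. \<psi> i (x + real s - real t)) = 0"
  unfolding window_def by (rule fdet_equal_cols[of s _ t]) (use assms in auto)

lemma coef_window:
  assumes "s < k"
  shows "(\<Sum>r\<le>k. window y s (\<lambda>h. \<psi> h (x - real r)) * coef x r) = 0"
proof -
  have "(\<Sum>r\<le>k. window y s (\<lambda>h. \<psi> h (x - real r)) * coef x r)
      = (\<Sum>r\<le>k. \<Sum>h<k. unit_window y s h * (\<psi> h (x - real r) * coef x r))"
    by (simp add: window_expand[OF assms] sum_distrib_right sum_distrib_left mult_ac)
  also have "\<dots> = (\<Sum>h<k. unit_window y s h * (\<Sum>r\<le>k. \<psi> h (x - real r) * coef x r))"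
    by (subst sum.swap) (simp add: sum_distrib_left)
  also have "\<dots> = 0" by (simp add: border_coef_annihilates)
  finally show ?thesis .
qed

text \<open>The terms sum to zero over all \<open>r \<le> k\<close>.  If \<open>x - r\<close> lies in the window and \<open>r \<noteq> t\<close>, then a column is repeated
  and the term vanishes.  For \<open>s \<ge> t\<close> this covers every \<open>r < t\<close>.  For \<open>s < t\<close> it covers every \<open>r > t\<close>, so the
  terms with \<open>r < t\<close> add up to minus the term \<open>r = t\<close>, where the window is an honest Casoratian.\<close>

lemma coef_window_partial:
  assumes "s < k" "t \<le> k"
  shows "(\<Sum>r<t. window (x - real t) s (\<lambda>h. \<psi> h (x - real r)) * coef x r)
    = (if s < t then - (coef x t * \<tau> (x - real t + real s)) else 0)"
proof -
  let ?W = "\<lambda>r. window (x - real t) s (\<lambda>h. \<psi> h (x - real r)) * coef x r"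
  have zero: "?W r = 0" if "t \<le> r + s" "r + s < t + k" "r \<noteq> t" for r
  proof -
    have "x - real r = x - real t + real s - real (r + s - t)" using that by (simp add: of_nat_diff)
    moreover have "window (x - real t) s (\<lambda>h. \<psi> h (x - real t + real s - real (r + s - t))) = 0"
      by (rule window_other) (use that assms in auto)
    ultimately show ?thesis by (simp only: mult_zero_left)
  qed
  have self: "?W t = coef x t * \<tau> (x - real t + real s)" by (simp add: window_self[OF assms(1)])
  show ?thesis
  proof (cases "s < t")
    case True
    have "{..k} = {..<t} \<union> {t..k}" using assms by auto
    then have "(\<Sum>r\<le>k. ?W r) = (\<Sum>r<t. ?W r) + (\<Sum>r\<in>{t..k}. ?W r)"
      by (simp add: sum.union_disjoint ivl_disj_int)
    also have "(\<Sum>r\<in>{t..k}. ?W r) = ?W t + (\<Sum>r\<in>{t..k} - {t}. ?W r)"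
      by (rule sum.remove) (use assms in auto)
    also have "(\<Sum>r\<in>{t..k} - {t}. ?W r) = 0"
      by (rule sum.neutral) (use True zero in auto)
    finally show ?thesis using coef_window[OF assms(1), of "x - real t" x] self True by simp
  next
    case False
    have "(\<Sum>r<t. ?W r) = 0" by (rule sum.neutral) (use False assms zero in auto)
    then show ?thesis using False by simp
  qed
qed

text \<open>The kernel \<open>\<Sum>h<k. G h x * \<psi> h y\<close> is minus the sum of the \<open>k\<close> windows through \<open>x\<close> with \<open>\<psi> y\<close> inserted, each
  weighted by the value of \<open>u\<close> belonging to its Casoratian (see \<open>kernel_eq\<close>).\<close>

definition G :: "nat \<Rightarrow> real \<Rightarrow> real" where
  "G h x = - (\<Sum>s<k. u (x + real s + 1) * unit_window x s h)"

text \<open>The average that makes the two extreme cases \<open>t = 0\<close> and \<open>t = k\<close> of \<open>coef_identity\<close> hold.\<close>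

definition P :: "real \<Rightarrow> real" where
  "P x = (F x + F (x + real k)) / 2"

lemma kernel_eq:
  "(\<Sum>h<k. G h x * \<psi> h y) = - (\<Sum>s<k. u (x + real s + 1) * window x s (\<lambda>h. \<psi> h y))"
proof -
  have "(\<Sum>h<k. G h x * \<psi> h y) = - (\<Sum>h<k. \<Sum>s<k. u (x + real s + 1) * (\<psi> h y * unit_window x s h))"
    unfolding G_def by (simp add: sum_distrib_right sum_distrib_left sum_negf mult_ac)
  also have "\<dots> = - (\<Sum>s<k. \<Sum>h<k. u (x + real s + 1) * (\<psi> h y * unit_window x s h))"
    by (subst sum.swap) simp
  also have "\<dots> = - (\<Sum>s<k. u (x + real s + 1) * window x s (\<lambda>h. \<psi> h y))"
    by (simp add: window_expand sum_distrib_left)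
  finally show ?thesis .
qed

lemma F_telescope: "(\<Sum>s<t. u (x + real s + 1) * \<tau> (x + real s)) = F (x + real t) - F x"
proof -
  have "u (x + real s + 1) * \<tau> (x + real s) = F (x + real (Suc s)) - F (x + real s)" for s
    using F_diff[of "x + real s + 1"] by (simp add: add_ac)
  then show ?thesis using sum_lessThan_telescope[of "\<lambda>s. F (x + real s)" t] by simp
qed

lemma kernel_diag: "(\<Sum>h<k. G h x * \<psi> h x) = F x - F (x + real k)"
  unfolding kernel_eq using F_telescope[of x k] by (simp add: window_self)

text \<open>The heart of the construction.  By \<open>coef_window_partial\<close> the sum over \<open>r < t\<close> picks up
  \<open>u (y + s + 1) * \<tau> (y + s) = F (y + s + 1) - F (y + s)\<close> with \<open>y = x - t\<close> for each \<open>s < t\<close>; it telescopes to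
  \<open>(F x - F y) * coef x t\<close>.  The diagonal contributes half of \<open>F y - F (y + k)\<close>, and \<open>P y\<close> completes
  this to \<open>F x\<close>.\<close>

lemma coef_identity:
  assumes "t \<le> k"
  shows "(\<Sum>r<t. (\<Sum>h<k. G h (x - real t) * \<psi> h (x - real r)) * coef x r)
     + (\<Sum>h<k. G h (x - real t) * \<psi> h (x - real t)) / 2 * coef x t
     + P (x - real t) * coef x t = F x * coef x t"
proof -
  let ?y = "x - real t"
  have "(\<Sum>r<t. (\<Sum>h<k. G h ?y * \<psi> h (x - real r)) * coef x r)
      = - (\<Sum>r<t. \<Sum>s<k. u (?y + real s + 1) * (window ?y s (\<lambda>h. \<psi> h (x - real r)) * coef x r))"
    unfolding kernel_eq by (simp add: sum_distrib_right sum_distrib_left sum_negf mult_ac)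
  also have "\<dots> = - (\<Sum>s<k. u (?y + real s + 1) * (\<Sum>r<t. window ?y s (\<lambda>h. \<psi> h (x - real r)) * coef x r))"
    by (subst sum.swap) (simp add: sum_distrib_left)
  also have "\<dots> = (\<Sum>s<k. if s < t then coef x t * (u (?y + real s + 1) * \<tau> (?y + real s)) else 0)"
    unfolding sum_negf[symmetric] 
    by (intro sum.cong refl, subst coef_window_partial) (use assms in auto)
  also have "\<dots> = (\<Sum>s<t. coef x t * (u (?y + real s + 1) * \<tau> (?y + real s)))"
    using assms by (intro sum.mono_neutral_cong_right) auto
  also have "\<dots> = coef x t * (F (?y + real t) - F ?y)"
    unfolding sum_distrib_left[symmetric] F_telescope ..
  finally show ?thesis unfolding kernel_diag P_def by (simp add: field_simps)
qed

lemma \<psi>_polyfun_affine: "i < k \<Longrightarrow> polyfun g \<Longrightarrow> polyfun (\<lambda>x. \<psi> i (g x))"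
  using \<psi>_polyfun[of i] polyfun_poly unfolding polyfun_def by metis

lemma G_polyfun: "polyfun (G h)"
proof -
  obtain q where q: "\<And>x. u x = poly q x" using u_polyfun by (auto simp: polyfun_def)
  have "polyfun (\<lambda>x. - 1 * (\<Sum>s<k. u (x + real s + 1) * unit_window x s h))"
    unfolding unit_window_def window_def q
    by (intro polyfun_mult polyfun_sum polyfun_const polyfun_poly polyfun_fdet polyfun_if
        \<psi>_polyfun_affine polyfun_add polyfun_diff polyfun_ident) auto
  then show ?thesis unfolding G_def by simp
qed

lemma \<tau>_reflect: "\<tau> (- x - c + real k - 1) = rev_sign k * \<tau> x"
proof -
  have "\<psi> i (- x - c + real k - 1 - real j) = \<psi> i (x - real (k - 1 - j))" if "i < k" "j < k" for i j
    using \<psi>_reflect[OF that(1), of "x - real (k - 1 - j)"] that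
    by (simp add: of_nat_diff algebra_simps)
  then have "\<tau> (- x - c + real k - 1) = fdet k (\<lambda>i j. \<psi> i (x - real (k - 1 - j)))"
    unfolding casoratian_def by (intro fdet_cong) auto
  then show ?thesis
    using fdet_reverse_cols[of k "\<lambda>i j. \<psi> i (x - real j)"] by (simp add: casoratian_def)
qed

text \<open>The difference \<open>F x - F (x - 1)\<close> is odd under the reflection that exchanges its two arguments, and \<open>\<tau>\<close>
  is even up to sign; cancel \<open>\<tau>\<close>.\<close>

lemma u_reflect: "u (real k + 1 - c - x) = - rev_sign k * u x"
proof -
  have 1: "(u (real k + 1 - c - x) + rev_sign k * u x) * \<tau> (x - 1) = 0" for x
  proof -
    have "u (real k + 1 - c - x) * (rev_sign k * \<tau> (x - 1)) = - (u x * \<tau> (x - 1))"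
      using F_diff[of "real k + 1 - c - x"] F_diff[of x] \<tau>_reflect[of "x - 1"]
        F_reflect[of "x - 1"] F_reflect[of x] by (simp add: algebra_simps)
    then have "rev_sign k * (rev_sign k * (u (real k + 1 - c - x) * \<tau> (x - 1)))
        = - (rev_sign k * u x * \<tau> (x - 1))" by (simp add: algebra_simps)
    then have "u (real k + 1 - c - x) * \<tau> (x - 1) = - (rev_sign k * u x * \<tau> (x - 1))"
      by (simp add: rev_sign_square flip: mult.assoc)
    then show ?thesis by (simp add: algebra_simps)
  qed
  have pu: "polyfun (\<lambda>x. u (real k + 1 - c - x) + rev_sign k * u x)"
  proof -
    obtain q where "\<And>x. u x = poly q x" using u_polyfun by (auto simp: polyfun_def)
    then show ?thesis
      by (simp only:) (intro polyfun_add polyfun_mult polyfun_poly polyfun_diff polyfun_const polyfun_ident)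
  qed
  have pt: "polyfun (\<lambda>x. \<tau> (x - 1))"
    unfolding casoratian_def
    by (intro polyfun_fdet \<psi>_polyfun_affine polyfun_diff polyfun_const polyfun_ident)
  obtain A B where A: "\<And>x. u (real k + 1 - c - x) + rev_sign k * u x = poly A x"
    and B: "\<And>x. \<tau> (x - 1) = poly B x" using pu pt unfolding polyfun_def by blast
  have "poly (A * B) x = 0" for x using 1[of x] by (simp add: A B)
  then have "A * B = 0" using poly_all_0_iff_0 by blast
  moreover have "B \<noteq> 0"
  proof
    assume "B = 0"
    then have "\<tau> (y + 1 - 1) = 0" for y using B[of "y + 1"] by simp
    then show False using \<tau>_nonzero by auto
  qed
  ultimately show ?thesis using A[of x] by simp
qed

text \<open>The reflection reverses the points of a window and moves the marked one from place \<open>s\<close> to \<open>k - 1 - s\<close>.\<close>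

lemma unit_window_reflect:
  assumes "s < k"
  shows "unit_window (- x - c) s h = rev_sign k * unit_window x (k - 1 - s) h"
proof -
  have "\<psi> i (- x - c + real s - real t) = \<psi> i (x + real (k - 1 - s) - real (k - 1 - t))"
    if "i < k" "t < k" for i t
    using \<psi>_reflect[OF that(1), of "x + real (k - 1 - s) - real (k - 1 - t)"] that assms
    by (simp add: of_nat_diff algebra_simps)
  then have "unit_window (- x - c) s h = fdet k (\<lambda>i t. if k - 1 - t = k - 1 - s
      then (if i = h then 1 else 0) else \<psi> i (x + real (k - 1 - s) - real (k - 1 - t)))"
    unfolding unit_window_def window_def using assms by (intro fdet_cong) auto
  also have "\<dots> = rev_sign k * unit_window x (k - 1 - s) h"
    unfolding unit_window_def window_def
    using fdet_reverse_cols[of k "\<lambda>i t. if t = k - 1 - s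
      then (if i = h then 1 else 0) else \<psi> i (x + real (k - 1 - s) - real t)"] by simp
  finally show ?thesis .
qed

lemma G_reflect: "G h (- x - c) = - G h x"
proof -
  have "G h (- x - c) = (\<Sum>s<k. u (x + real (k - 1 - s) + 1) * unit_window x (k - 1 - s) h)"
    unfolding G_def sum_negf[symmetric]
  proof (rule sum.cong[OF refl])
    fix s assume "s \<in> {..<k}"
    then have s: "s < k" by simp
    have "u (- x - c + real s + 1) = - rev_sign k * u (x + real (k - 1 - s) + 1)"
      using u_reflect[of "x + real (k - 1 - s) + 1"] s by (simp add: of_nat_diff algebra_simps)
    then have "- (u (- x - c + real s + 1) * unit_window (- x - c) s h)
        = (rev_sign k * rev_sign k) * (u (x + real (k - 1 - s) + 1) * unit_window x (k - 1 - s) h)"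
      by (simp add: unit_window_reflect[OF s] del: rev_sign_square)
    then show "- (u (- x - c + real s + 1) * unit_window (- x - c) s h)
        = u (x + real (k - 1 - s) + 1) * unit_window x (k - 1 - s) h"
      by (simp only: rev_sign_square mult_1)
  qed
  also have "\<dots> = (\<Sum>s<k. u (x + real s + 1) * unit_window x s h)"
    by (rule sum.reindex_bij_witness[of _ "\<lambda>s. k - 1 - s" "\<lambda>s. k - 1 - s"]) auto
  finally show ?thesis by (simp add: G_def)
qed

lemma P_reflect: "P (- x - c) = P x"
  using F_reflect[of x] F_reflect[of "x + real k"] by (simp add: P_def algebra_simps minus_diff_commute)

lemma P_polyfun: "polyfun P"
proof -
  obtain q where q: "\<And>x. F x = poly q x" using F_polyfun by (auto simp: polyfun_def)
  have "polyfun (\<lambda>x. 1/2 * (F x + F (x + real k)))" unfolding q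
    by (intro polyfun_add polyfun_mult polyfun_poly polyfun_const polyfun_ident)
  then show ?thesis by (simp add: P_def[abs_def])
qed

end

lemma sum_triangle:
  fixes f :: "nat \<Rightarrow> nat \<Rightarrow> 'a::comm_monoid_add"
  shows "(\<Sum>r\<le>k. \<Sum>t\<in>{r<..k}. f r t) = (\<Sum>t\<le>k. \<Sum>r<t. f r t)"
proof -
  have "(\<Sum>r\<le>k. \<Sum>t\<in>{r<..k}. f r t) = (\<Sum>r\<le>k. \<Sum>t | t \<in> {..k} \<and> r < t. f r t)"
    by (intro sum.cong) auto
  also have "\<dots> = (\<Sum>t\<le>k. \<Sum>r | r \<in> {..k} \<and> r < t. f r t)"
    by (rule sum.swap_restrict) auto
  also have "\<dots> = (\<Sum>t\<le>k. \<Sum>r<t. f r t)"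
    by (intro sum.cong) auto
  finally show ?thesis .
qed

text \<open>Up to a vector that does not depend on \<open>r\<close>, the image of \<open>p\<^bsub>n-r\<^esub>\<close> involves only \<open>p\<^bsub>n-r\<^esub>, \<dots>, p\<^bsub>n-k\<^esub>\<close>.\<close>

lemma sum_op_jac_descend:
  fixes c \<delta> :: real and n :: int
  assumes "r \<le> k"
  defines "p \<equiv> \<lambda>r. jac (c + 2 * \<delta>) (n - int r)" and "g \<equiv> \<lambda>r. 2 * (of_int n + \<delta> - real r) + c"
  shows "sum_op c \<delta> (p r) = (sum_op c \<delta> (p k) - (g k / 2) *\<^sub>R p k)
    + (g r / 2) *\<^sub>R p r + (\<Sum>t\<in>{r<..k}. g t *\<^sub>R p t)"
  using assms(1)
proof (induction r rule: inc_induct)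
  case base
  then show ?case by simp
next
  case (step r)
  have "{r<..k} = insert (Suc r) {Suc r<..k}" using step by auto
  then have "(\<Sum>t\<in>{r<..k}. g t *\<^sub>R p t) = g (Suc r) *\<^sub>R p (Suc r) + (\<Sum>t\<in>{Suc r<..k}. g t *\<^sub>R p t)"
    by simp
  moreover have "g (Suc r) *\<^sub>R p (Suc r) = (g (Suc r) / 2) *\<^sub>R p (Suc r) + (g (Suc r) / 2) *\<^sub>R p (Suc r)"
    by (simp flip: scaleR_add_left)
  moreover have "sum_op c \<delta> (p r) = sum_op c \<delta> (p (Suc r)) + (g r / 2) *\<^sub>R p r + (g (Suc r) / 2) *\<^sub>R p (Suc r)"
    using sum_op_jac[of c \<delta> "n - int r"] by (simp add: p_def g_def algebra_simps)
  ultimately show ?case using step.IH by (simp add: algebra_simps)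
qed

context casorati
begin

text \<open>Write \<open>\<psi> h = \<Psi>\<^sub>h(\<lambda>\<^sub>x)\<close>, \<open>G h = (2 x + c) M\<^sub>h(\<lambda>\<^sub>x)\<close> and \<open>P = \<Phi>(\<lambda>\<^sub>x)\<close>, let \<open>H\<close> be the hypergeometric operator and \<open>S\<close> the
  operator \<open>sum_op\<close>.  The operator is \<open>\<Sum>\<^sub>h M\<^sub>h(H) S \<Psi>\<^sub>h(H) + \<Phi>(H)\<close>.  Applied to \<open>\<Sum>\<^sub>r coef\<^sub>r p\<^bsub>n-r\<^esub>\<close>, the factor \<open>\<Psi>\<^sub>h(H)\<close>
  inserts \<open>\<psi> h (x - r)\<close>; the part of \<open>S p\<^bsub>n-r\<^esub>\<close> that does not depend on \<open>r\<close> is then killed by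
  \<open>border_coef_annihilates\<close>, and comparing the coefficients of \<open>p\<^sub>n, \<dots>, p\<^bsub>n-k\<^esub>\<close> leaves \<open>coef_identity\<close>.\<close>

theorem spectral_operator:
  "\<exists>T. ladder_op T \<and> (\<forall>\<delta> n. T \<delta> (qseq k c \<psi> \<delta> n) = F (of_int n + \<delta>) *\<^sub>R qseq k c \<psi> \<delta> n)"
proof -
  have "\<forall>h. \<exists>M. h < k \<longrightarrow> (\<forall>x. \<psi> h x = poly M (x * (x + c)))"
    using invariant_polyfun[OF \<psi>_polyfun c_nonzero \<psi>_reflect] by blast
  then obtain \<Psi> where \<Psi>: "\<And>h x. h < k \<Longrightarrow> \<psi> h x = poly (\<Psi> h) (x * (x + c))" by metis
  have "\<forall>h. \<exists>M. \<forall>x. G h x = (2 * x + c) * poly M (x * (x + c))"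
    using anti_invariant_polyfun[OF G_polyfun c_nonzero G_reflect] by blast
  then obtain M where M: "\<And>h x. G h x = (2 * x + c) * poly (M h) (x * (x + c))" by metis
  obtain \<Phi> where \<Phi>: "\<And>x. P x = poly \<Phi> (x * (x + c))"
    using invariant_polyfun[OF P_polyfun c_nonzero P_reflect] by blast
  define T where "T = (\<lambda>\<delta> v. (\<Sum>h<k. polyop (M h) (hyp_op c \<delta>) (sum_op c \<delta> (polyop (\<Psi> h) (hyp_op c \<delta>) v)))
      + polyop \<Phi> (hyp_op c \<delta>) v)"
  have "ladder_op T" unfolding T_def
    by (intro ladder_op_add ladder_op_sum ladder_op_polyop[OF ladder_op_hyp_op]
        ladder_op_comp[OF ladder_op_polyop[OF ladder_op_hyp_op] ladder_op_comp[OF ladder_op_sum_op ladder_op_polyop[OF ladder_op_hyp_op]]])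
  moreover have "T \<delta> (qseq k c \<psi> \<delta> n) = F (of_int n + \<delta>) *\<^sub>R qseq k c \<psi> \<delta> n" for \<delta> n
  proof -
    define x where "x = of_int n + \<delta>"
    define p where "p = (\<lambda>r. jac (c + 2 * \<delta>) (n - int r))"
    define g where "g = (\<lambda>r. 2 * (x - real r) + c)"
    have lin: "linear (polyop m (hyp_op c \<delta>))" for m
      by (rule linear_weyl[OF ladder_op_polyop[OF ladder_op_hyp_op]])
    have linS: "linear (sum_op c \<delta>)" by (rule linear_weyl[OF ladder_op_sum_op])
    have "hyp_op c \<delta> (p r) = ((x - real r) * (x - real r + c)) *\<^sub>R p r" for r
      unfolding p_def hyp_op_jac by (simp add: x_def algebra_simps)
    then have eig: "polyop m (hyp_op c \<delta>) (p r) = poly m ((x - real r) * (x - real r + c)) *\<^sub>R p r" for m r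
      by (rule polyop_eigenvector[OF linear_weyl[OF ladder_op_hyp_op]])
    have q: "qseq k c \<psi> \<delta> n = (\<Sum>r\<le>k. coef x r *\<^sub>R p r)" by (simp add: qseq_def x_def p_def)
    define C where "C = sum_op c \<delta> (p k) - (g k / 2) *\<^sub>R p k"
    have S: "sum_op c \<delta> (p r) = C + (g r / 2) *\<^sub>R p r + (\<Sum>t\<in>{r<..k}. g t *\<^sub>R p t)" if "r \<le> k" for r
      using sum_op_jac_descend[OF that, of c \<delta> n] unfolding C_def p_def g_def x_def .
    have summand: "polyop (M h) (hyp_op c \<delta>) (sum_op c \<delta> (polyop (\<Psi> h) (hyp_op c \<delta>) (qseq k c \<psi> \<delta> n)))
        = (\<Sum>t\<le>k. (G h (x - real t) * ((\<Sum>r<t. \<psi> h (x - real r) * coef x r) 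
            + \<psi> h (x - real t) * coef x t / 2)) *\<^sub>R p t)" if h: "h < k" for h
    proof -
      define w where "w = (\<lambda>r. \<psi> h (x - real r) * coef x r)"
      have "polyop (\<Psi> h) (hyp_op c \<delta>) (qseq k c \<psi> \<delta> n) = (\<Sum>r\<le>k. w r *\<^sub>R p r)"
        unfolding q by (simp add: linear_sum[OF lin] linear_scale[OF lin] eig w_def \<Psi>[OF h] mult.commute)
      then have "sum_op c \<delta> (polyop (\<Psi> h) (hyp_op c \<delta>) (qseq k c \<psi> \<delta> n))
          = (\<Sum>r\<le>k. w r *\<^sub>R (C + (g r / 2) *\<^sub>R p r + (\<Sum>t\<in>{r<..k}. g t *\<^sub>R p t)))"
        by (simp add: linear_sum[OF linS] linear_scale[OF linS] S)
      also have "\<dots> = (\<Sum>r\<le>k. w r) *\<^sub>R C + (\<Sum>r\<le>k. (w r * g r / 2) *\<^sub>R p r)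
          + (\<Sum>r\<le>k. \<Sum>t\<in>{r<..k}. (w r * g t) *\<^sub>R p t)"
        by (simp add: scaleR_add_right sum.distrib scaleR_sum_left scaleR_sum_right)
      also have "(\<Sum>r\<le>k. w r) = 0" unfolding w_def by (rule border_coef_annihilates[OF h])
      also have "(\<Sum>r\<le>k. \<Sum>t\<in>{r<..k}. (w r * g t) *\<^sub>R p t) = (\<Sum>t\<le>k. \<Sum>r<t. (w r * g t) *\<^sub>R p t)"
        by (rule sum_triangle)
      also have "0 *\<^sub>R C + (\<Sum>r\<le>k. (w r * g r / 2) *\<^sub>R p r) + (\<Sum>t\<le>k. \<Sum>r<t. (w r * g t) *\<^sub>R p t)
          = (\<Sum>t\<le>k. (g t * ((\<Sum>r<t. w r) + w t / 2)) *\<^sub>R p t)"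
        by (simp add: sum.distrib[symmetric] scaleR_sum_left[symmetric] scaleR_add_left[symmetric]
            sum_distrib_left distrib_left mult_ac add_ac)
      finally have "polyop (M h) (hyp_op c \<delta>) (sum_op c \<delta> (polyop (\<Psi> h) (hyp_op c \<delta>) (qseq k c \<psi> \<delta> n)))
        = (\<Sum>t\<le>k. (g t * ((\<Sum>r<t. w r) + w t / 2) * poly (M h) ((x - real t) * (x - real t + c))) *\<^sub>R p t)"
        by (simp add: linear_sum[OF lin] linear_scale[OF lin] eig)
      then show ?thesis by (simp add: M g_def w_def mult_ac)
    qed
    have "T \<delta> (qseq k c \<psi> \<delta> n) = (\<Sum>h<k. \<Sum>t\<le>k. (G h (x - real t) * ((\<Sum>r<t. \<psi> h (x - real r) * coef x r) 
            + \<psi> h (x - real t) * coef x t / 2)) *\<^sub>R p t) + (\<Sum>t\<le>k. (P (x - real t) * coef x t) *\<^sub>R p t)"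
      unfolding T_def
      by (intro arg_cong2[of _ _ _ _ "(+)"] sum.cong refl summand)
         (simp_all add: q linear_sum[OF lin] linear_scale[OF lin] eig \<Phi> mult.commute)
    also have "\<dots> = (\<Sum>t\<le>k. ((\<Sum>h<k. G h (x - real t) * ((\<Sum>r<t. \<psi> h (x - real r) * coef x r) 
            + \<psi> h (x - real t) * coef x t / 2)) + P (x - real t) * coef x t) *\<^sub>R p t)"
      by (subst sum.swap) (simp add: scaleR_sum_left scaleR_add_left sum.distrib)
    also have "\<dots> = (\<Sum>t\<le>k. (F x * coef x t) *\<^sub>R p t)"
    proof (intro sum.cong refl arg_cong2[of _ _ _ _ scaleR])
      fix t assume "t \<in> {..k}"
      then have t: "t \<le> k" by simp
      have "(\<Sum>h<k. G h (x - real t) * ((\<Sum>r<t. \<psi> h (x - real r) * coef x r) + \<psi> h (x - real t) * coef x t / 2))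
          = (\<Sum>h<k. \<Sum>r<t. G h (x - real t) * (\<psi> h (x - real r) * coef x r))
            + (\<Sum>h<k. G h (x - real t) * \<psi> h (x - real t)) / 2 * coef x t"
        by (simp add: distrib_left sum.distrib sum_distrib_left sum_distrib_right sum_divide_distrib mult_ac)
      also have "(\<Sum>h<k. \<Sum>r<t. G h (x - real t) * (\<psi> h (x - real r) * coef x r))
          = (\<Sum>r<t. (\<Sum>h<k. G h (x - real t) * \<psi> h (x - real r)) * coef x r)"
        by (subst sum.swap) (simp add: sum_distrib_right mult.assoc)
      finally show "(\<Sum>h<k. G h (x - real t) * ((\<Sum>r<t. \<psi> h (x - real r) * coef x r)
          + \<psi> h (x - real t) * coef x t / 2)) + P (x - real t) * coef x t = F x * coef x t"
        using coef_identity[OF t, of x] by simp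
    qed
    also have "\<dots> = F x *\<^sub>R qseq k c \<psi> \<delta> n" by (simp add: q scaleR_sum_right)
    finally show ?thesis by (simp add: x_def)
  qed
  ultimately show ?thesis by blast
qed

end

section \<open>Casoratians of polynomials of distinct degrees\<close>

text \<open>The backward difference.\<close>

definition bdiff :: "real poly \<Rightarrow> real poly" where
  "bdiff p = p - pcompose p [:-1, 1:]"

lemma bdiff_pCons: "bdiff (pCons a p) = pCons 0 (bdiff p) - bdiff p + p"
proof -
  have "pCons 0 p = [:0, 1:] * p" "pCons 0 (pcompose p [:-1, 1:]) = [:0, 1:] * pcompose p [:-1, 1:]"
    by simp_all
  then show ?thesis by (simp add: bdiff_def pcompose_pCons algebra_simps)
qed

lemma bdiff_leading:
  assumes "degree p \<le> Suc d"
  shows "degree (bdiff p) \<le> d \<and> Polynomial.coeff (bdiff p) d = real (Suc d) * Polynomial.coeff p (Suc d)"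
  using assms
proof (induction p arbitrary: d rule: pCons_induct)
  case 0
  then show ?case by (simp add: bdiff_def)
next
  case (pCons a p)
  then have dp: "degree p \<le> d" by (auto split: if_splits)
  show ?case
  proof (cases d)
    case 0
    then obtain b where "p = [:b:]" using dp by (auto elim: degree_eq_zeroE)
    then show ?thesis using 0 by (simp add: bdiff_pCons) (simp add: bdiff_def)
  next
    case (Suc e)
    then have IH: "degree (bdiff p) \<le> e"
      "Polynomial.coeff (bdiff p) e = real (Suc e) * Polynomial.coeff p (Suc e)"
      using pCons.IH[of e] dp by auto
    have "degree (pCons 0 (bdiff p) - bdiff p + p) \<le> d"
      using IH(1) dp Suc by (intro degree_add_le degree_diff_le) (auto intro: order_trans[OF degree_pCons_le])
    moreover have "Polynomial.coeff (bdiff p) (Suc e) = 0" using IH(1) by (simp add: coeff_eq_0)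
    ultimately show ?thesis using IH(2) Suc by (simp add: bdiff_pCons algebra_simps)
  qed
qed

definition falling :: "nat \<Rightarrow> nat \<Rightarrow> real" where
  "falling d j = (\<Prod>i<j. real d - real i)"

lemma falling_eq_0: "j < i \<Longrightarrow> falling j i = 0"
  unfolding falling_def by (rule prod_zero) auto

lemma bdiff_funpow_leading:
  assumes "degree p \<le> d" "j \<le> d"
  shows "degree ((bdiff ^^ j) p) \<le> d - j
    \<and> Polynomial.coeff ((bdiff ^^ j) p) (d - j) = falling d j * Polynomial.coeff p d"
  using assms(2)
proof (induction j)
  case 0
  then show ?case using assms(1) by (simp add: falling_def)
next
  case (Suc j)
  then have "d - j = Suc (d - Suc j)" by simp
  then show ?case using Suc bdiff_leading[of "(bdiff ^^ j) p" "d - Suc j"]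
    by (simp add: falling_def of_nat_diff)
qed

lemma bdiff_funpow_expand:
  "\<exists>U. \<forall>p x. poly ((bdiff ^^ j) p) x = (\<Sum>s\<le>j. U s * poly p (x - real s))"
proof (induction j)
  case 0
  show ?case by (intro exI[of _ "\<lambda>_. 1"]) simp
next
  case (Suc j)
  then obtain U where U: "\<And>p x. poly ((bdiff ^^ j) p) x = (\<Sum>s\<le>j. U s * poly p (x - real s))" by blast
  let ?V = "\<lambda>s. (if s \<le> j then U s else 0) - (if s = 0 then 0 else U (s - 1))"
  have "poly ((bdiff ^^ Suc j) p) x = (\<Sum>s\<le>Suc j. ?V s * poly p (x - real s))" for p x
  proof -
    have "poly ((bdiff ^^ Suc j) p) x = poly ((bdiff ^^ j) p) x - poly ((bdiff ^^ j) p) (x - 1)"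
      by (simp add: bdiff_def poly_pcompose)
    also have "poly ((bdiff ^^ j) p) x = (\<Sum>s\<le>Suc j. (if s \<le> j then U s else 0) * poly p (x - real s))"
      by (simp add: U)
    also have "poly ((bdiff ^^ j) p) (x - 1)
        = (\<Sum>s\<le>Suc j. (if s = 0 then 0 else U (s - 1)) * poly p (x - real s))"
      by (subst sum.atMost_Suc_shift) (simp add: U algebra_simps)
    finally show ?thesis by (simp only: sum_subtractf[symmetric] left_diff_distrib[symmetric])
  qed
  then show ?case by (intro exI[of _ ?V] allI)
qed

lemma coeff_mult_bound:
  fixes p q :: "'a::comm_ring_1 poly"
  assumes "degree p \<le> m" "degree q \<le> n"
  shows "Polynomial.coeff (p * q) (m + n) = Polynomial.coeff p m * Polynomial.coeff q n"
proof -
  have "Polynomial.coeff (p * q) (m + n) = (\<Sum>i\<le>m + n. Polynomial.coeff p i * Polynomial.coeff q (m + n - i))"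
    by (rule coeff_mult)
  also have "\<dots> = (\<Sum>i\<in>{m}. Polynomial.coeff p i * Polynomial.coeff q (m + n - i))"
  proof (rule sum.mono_neutral_right)
    show "\<forall>i\<in>{..m + n} - {m}. Polynomial.coeff p i * Polynomial.coeff q (m + n - i) = 0"
    proof
      fix i assume "i \<in> {..m + n} - {m}"
      then have "m < i \<or> n < m + n - i" by auto
      then show "Polynomial.coeff p i * Polynomial.coeff q (m + n - i) = 0"
        using assms by (auto simp: coeff_eq_0)
    qed
  qed auto
  finally show ?thesis by simp
qed

lemma coeff_prod_bound:
  fixes f :: "'i \<Rightarrow> 'a::comm_ring_1 poly"
  assumes "finite I" "\<And>i. i \<in> I \<Longrightarrow> degree (f i) \<le> e i"
  shows "degree (\<Prod>i\<in>I. f i) \<le> (\<Sum>i\<in>I. e i)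
    \<and> Polynomial.coeff (\<Prod>i\<in>I. f i) (\<Sum>i\<in>I. e i) = (\<Prod>i\<in>I. Polynomial.coeff (f i) (e i))"
  using assms
proof (induction I)
  case empty
  then show ?case by simp
next
  case (insert i I)
  then have IH: "degree (\<Prod>i\<in>I. f i) \<le> (\<Sum>i\<in>I. e i)" "degree (f i) \<le> e i"
    "Polynomial.coeff (\<Prod>i\<in>I. f i) (\<Sum>i\<in>I. e i) = (\<Prod>i\<in>I. Polynomial.coeff (f i) (e i))" by auto
  have "degree (f i * (\<Prod>i\<in>I. f i)) \<le> e i + (\<Sum>i\<in>I. e i)"
    using degree_mult_le[of "f i" "\<Prod>i\<in>I. f i"] IH by linarith
  then show ?case using insert.hyps IH coeff_mult_bound[OF IH(2,1)] by simp
qed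

text \<open>If the entry \<open>(i, j)\<close> has degree at most \<open>d i - j\<close>, every permutation contributes in degree at most
  \<open>\<Sum> d i - \<Sum> j\<close>, so the leading coefficient may be taken entrywise.\<close>

lemma coeff_fdet:
  fixes g :: "nat \<Rightarrow> nat \<Rightarrow> real poly"
  assumes "\<And>i j. i < n \<Longrightarrow> j < n \<Longrightarrow> j \<le> d i"
    and "\<And>i j. i < n \<Longrightarrow> j < n \<Longrightarrow> degree (g i j) \<le> d i - j"
  shows "Polynomial.coeff (fdet n g) ((\<Sum>i=0..<n. d i) - (\<Sum>j=0..<n. j))
    = fdet n (\<lambda>i j. Polynomial.coeff (g i j) (d i - j))"
proof -
  let ?N = "(\<Sum>i=0..<n. d i) - (\<Sum>j=0..<n. j)"
  have "Polynomial.coeff (signof p * (\<Prod>i=0..<n. g i (p i))) ?N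
      = signof p * (\<Prod>i=0..<n. Polynomial.coeff (g i (p i)) (d i - p i))" if p: "p permutes {0..<n}" for p
  proof -
    have lt: "p i < n" if "i < n" for i using permutes_in_image[OF p, of i] that by simp
    have "(\<Sum>i=0..<n. d i - p i) = (\<Sum>i=0..<n. d i) - (\<Sum>i=0..<n. p i)"
      by (rule sum_subtractf_nat) (use assms(1) lt in auto)
    also have "(\<Sum>i=0..<n. p i) = (\<Sum>j=0..<n. j)" 
      using sum.permute[OF p, of "\<lambda>j. j"] by (simp add: comp_def)
    finally have N: "?N = (\<Sum>i=0..<n. d i - p i)" by simp
    have "Polynomial.coeff (\<Prod>i=0..<n. g i (p i)) ?N = (\<Prod>i=0..<n. Polynomial.coeff (g i (p i)) (d i - p i))"
      unfolding N using coeff_prod_bound[of "{0..<n}" "\<lambda>i. g i (p i)" "\<lambda>i. d i - p i"] assms(2) lt by simp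
    then show ?thesis by (simp add: sign_def)
  qed
  then show ?thesis unfolding fdet_leibniz coeff_sum by (intro sum.cong) auto
qed

text \<open>A combination of the falling factorials with \<open>j < n\<close> has degree below \<open>n\<close>, so it is the zero polynomial
  if it vanishes at the \<open>n\<close> distinct numbers \<open>d i\<close>.\<close>

lemma falling_combination_zero:
  fixes v :: "nat \<Rightarrow> real"
  assumes "inj_on d {..<n}" "\<And>i. i < n \<Longrightarrow> (\<Sum>j<n. v j * falling (d i) j) = 0"
  shows "\<forall>j<n. v j = 0"
proof (rule ccontr)
  assume "\<not> ?thesis"
  then obtain j where j: "j < n" "v j \<noteq> 0" "\<And>i. i < j \<Longrightarrow> v i = 0"
    using exists_least_iff[of "\<lambda>j. j < n \<and> v j \<noteq> 0"] by (metis order.strict_trans)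
  define h where "h = (\<Sum>j<n. Polynomial.smult (v j) (\<Prod>i<j. [:- real i, 1:]))"
  have h: "poly h (real m) = (\<Sum>j<n. v j * falling m j)" for m
    by (simp add: h_def poly_sum poly_prod falling_def)
  have "degree h < n"
  proof -
    have "degree (Polynomial.smult (v j) (\<Prod>i<j. [:- real i, 1:])) \<le> n - 1" if "j < n" for j
    proof -
      have "degree (\<Prod>i<j. [:- real i, 1:]) \<le> (\<Sum>i<j. degree [:- real i, 1:])" 
        using degree_prod_sum_le[of "{..<j}" "\<lambda>i. [:- real i, 1:]"] by (simp add: comp_def)
      then show ?thesis using that degree_smult_le[of "v j" "\<Prod>i<j. [:- real i, 1:]"] by simp
    qed
    then have "degree h \<le> n - 1" unfolding h_def by (intro degree_sum_le) auto
    then show ?thesis using j by linarith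
  qed
  have "card ((\<lambda>i. real (d i)) ` {..<n}) = n"
    using assms(1) by (subst card_image) (auto simp: inj_on_def)
  moreover have "(\<lambda>i. real (d i)) ` {..<n} \<subseteq> {x. poly h x = 0}" using assms(2) h by auto
  ultimately have "h \<noteq> 0 \<Longrightarrow> n \<le> card {x. poly h x = 0}"
    by (metis card_mono poly_roots_finite)
  then have "h = 0"
    using card_poly_roots_bound[of h] \<open>degree h < n\<close> by linarith
  then have "(\<Sum>i<n. v i * falling j i) = 0" using h[of j] by simp
  \<comment> \<open>At the argument \<open>j\<close>, the least index with \<open>v j \<noteq> 0\<close>, the falling factorials of order above \<open>j\<close> vanish.\<close>
  moreover have "(\<Sum>i<n. v i * falling j i) = (\<Sum>i\<in>{j}. v i * falling j i)"
  proof (rule sum.mono_neutral_right)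
    show "\<forall>i\<in>{..<n} - {j}. v i * falling j i = 0"
    proof
      fix i assume "i \<in> {..<n} - {j}"
      then show "v i * falling j i = 0" using j(3)[of i] falling_eq_0[of j i] by (cases "i < j") auto
    qed
  qed (use j in auto)
  moreover have "falling j j \<noteq> 0" by (simp add: falling_def)
  ultimately show False using j by simp
qed

text \<open>Column operations turn the shifts \<open>p i (x - j)\<close> into the backward differences \<open>\<nabla>\<^sup>j (p i)\<close>, of degree
  \<open>degree (p i) - j\<close>.  The leading coefficient of their determinant is the product of the leading coefficients of the
  \<open>p i\<close> with a determinant of falling factorials of the degrees, and the latter is nonsingular because the
  degrees are distinct.\<close>

theorem casoratian_distinct_degrees:
  fixes p :: "nat \<Rightarrow> real poly"
  assumes "inj_on (\<lambda>i. degree (p i)) {..<k}" "\<And>i. i < k \<Longrightarrow> p i \<noteq> 0" "\<And>i. i < k \<Longrightarrow> k \<le> Suc (degree (p i))"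
  shows "\<exists>x. casoratian k (\<lambda>i. poly (p i)) x \<noteq> 0"
proof (rule ccontr)
  assume "\<not> ?thesis"
  then have zero: "fdet k (\<lambda>i j. poly (p i) (x - real j)) = 0" for x by (simp add: casoratian_def)
  obtain U where U: "\<And>j p x. poly ((bdiff ^^ j) p) x = (\<Sum>s\<le>j. U j s * poly p (x - real s))"
    using bdiff_funpow_expand by metis
  let ?D = "fdet k (\<lambda>i j. (bdiff ^^ j) (p i))"
  have "poly ?D x = 0" for x
  proof -
    have "poly ?D x = fdet k (\<lambda>i j. poly ((bdiff ^^ j) (p i)) x)"
      by (simp add: fdet_leibniz poly_sum poly_prod sign_def if_distrib[of "\<lambda>q. poly q x"] cong: if_cong)
    also have "\<dots> = fdet k (\<lambda>i j. \<Sum>s<k. poly (p i) (x - real s) * (if s \<le> j then U j s else 0))"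
    proof (rule fdet_cong)
      fix i j assume "i < k" "j < k"
      have "poly ((bdiff ^^ j) (p i)) x = (\<Sum>s\<le>j. poly (p i) (x - real s) * (if s \<le> j then U j s else 0))"
        by (simp add: U mult.commute)
      also have "\<dots> = (\<Sum>s<k. poly (p i) (x - real s) * (if s \<le> j then U j s else 0))"
        using \<open>j < k\<close> by (intro sum.mono_neutral_left) auto
      finally show "poly ((bdiff ^^ j) (p i)) x = (\<Sum>s<k. poly (p i) (x - real s) * (if s \<le> j then U j s else 0))" .
    qed
    also have "\<dots> = 0" using fdet_mult[of k "\<lambda>i s. poly (p i) (x - real s)" "\<lambda>s j. if s \<le> j then U j s else 0"]
      by (simp add: zero)
    finally show ?thesis .
  qed
  then have "?D = 0" using poly_all_0_iff_0 by blast
  have le: "j \<le> degree (p i)" if "i < k" "j < k" for i j using assms(3)[OF that(1)] that by simp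
  let ?g = "\<lambda>i j. falling (degree (p i)) j * lead_coeff (p i)"
  have "fdet k ?g = fdet k (\<lambda>i j. Polynomial.coeff ((bdiff ^^ j) (p i)) (degree (p i) - j))"
    by (rule fdet_cong) (use bdiff_funpow_leading le in auto)
  also have "\<dots> = 0"
    using coeff_fdet[of k "\<lambda>i. degree (p i)" "\<lambda>i j. (bdiff ^^ j) (p i)"] \<open>?D = 0\<close> bdiff_funpow_leading le by simp
  finally have "Determinant.det (Matrix.mat k k (\<lambda>(i, j). ?g i j)) = 0" by (simp add: fdet_def)
  then obtain v where v: "v \<in> carrier_vec k" "v \<noteq> 0\<^sub>v k" "Matrix.mat k k (\<lambda>(i, j). ?g i j) *\<^sub>v v = 0\<^sub>v k"
    using det_0_iff_vec_prod_zero_field[of "Matrix.mat k k (\<lambda>(i, j). ?g i j)" k] by auto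
  have "(\<Sum>j<k. Matrix.vec_index v j * falling (degree (p i)) j) = 0" if "i < k" for i
  proof -
    have "Matrix.vec_index (Matrix.mat k k (\<lambda>(i, j). ?g i j) *\<^sub>v v) i
        = (\<Sum>j<k. ?g i j * Matrix.vec_index v j)"
      using that v(1) by (auto simp: scalar_prod_def atLeast0LessThan intro!: sum.cong)
    moreover have "Matrix.vec_index (Matrix.mat k k (\<lambda>(i, j). ?g i j) *\<^sub>v v) i = 0"
      unfolding v(3) using that by simp
    ultimately have "lead_coeff (p i) * (\<Sum>j<k. Matrix.vec_index v j * falling (degree (p i)) j) = 0"
      by (simp add: sum_distrib_left mult_ac)
    then show ?thesis using assms(2)[OF that] by simp
  qed
  then have "\<forall>j<k. Matrix.vec_index v j = 0" by (rule falling_combination_zero[OF assms(1)])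
  then have "v = 0\<^sub>v k" using v(1) by (intro eq_vecI) auto
  then show False using v(2) by simp
qed

section \<open>The Casoratian \<open>\<tau>\<close>\<close>

lemma pochhammer_linear_nonzero: "e \<noteq> 0 \<Longrightarrow> pochhammer [:b, e:] n \<noteq> (0 :: real poly)"
  by (auto simp: pochhammer_prod of_nat_poly)

lemma degree_pochhammer_linear:
  assumes "e \<noteq> 0"
  shows "degree (pochhammer [:b, e:] n :: real poly) = n"
proof (induction n)
  case (Suc n)
  have eq: "[:b, e:] + of_nat n = [:b + real n, e:]" by (simp add: of_nat_poly)
  have "degree (pochhammer [:b, e:] n * [:b + real n, e:]) = degree (pochhammer [:b, e:] n) + degree [:b + real n, e:]"
    by (rule degree_mult_eq) (simp_all add: assms pochhammer_linear_nonzero)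
  also have "\<dots> = Suc n" using assms Suc by (simp del: mult_pCons_right)
  finally show ?case by (simp only: pochhammer_Suc eq)
qed simp

lemma poly_pochhammer: "poly (pochhammer p n) x = pochhammer (poly p x) n"
  by (induction n) (auto simp: pochhammer_Suc)

lemma degree_phi1: "degree (phi1 \<alpha> \<beta> j) \<le> 2 * j"
proof -
  have "degree (pochhammer [:1, 1:] j * pochhammer [:- real \<alpha> - \<beta>, -1:] j) \<le> j + j"
    using degree_mult_le[of "pochhammer [:1, 1::real:] j" "pochhammer [:- real \<alpha> - \<beta>, -1:] j"]
    by (simp add: degree_pochhammer_linear)
  then show ?thesis unfolding phi1_def using degree_smult_le order_trans by fastforce
qed

lemma degree_phi2:
  assumes "\<beta> > -1"
  shows "degree (phi2 \<alpha> \<beta> j) = 2 * \<alpha> + 2 * j \<and> phi2 \<alpha> \<beta> j \<noteq> 0"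
proof -
  have "pochhammer (1 + \<beta>) \<alpha> \<noteq> 0" "pochhammer (1 + real \<alpha>) j \<noteq> 0"
    using assms by (auto intro!: pochhammer_pos less_imp_neq[THEN not_sym])
  then show ?thesis
    by (simp add: phi2_def degree_mult_eq pochhammer_linear_nonzero degree_pochhammer_linear)
qed

text \<open>The summand \<open>phi2\<close> dominates, because of its extra factor of degree \<open>2 \<alpha>\<close>.\<close>

lemma degree_psi:
  assumes "\<beta> > -1" "0 < \<alpha>"
  shows "degree (psi \<alpha> \<beta> a j) = 2 * \<alpha> + 2 * j \<and> psi \<alpha> \<beta> a j \<noteq> 0"
proof -
  have "degree (\<Sum>l\<le>j. Polynomial.smult (a (j - l)) (phi1 \<alpha> \<beta> l)) \<le> 2 * j"
    by (rule degree_sum_le) (auto intro!: order_trans[OF degree_smult_le] order_trans[OF degree_phi1])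
  then have "degree (\<Sum>l\<le>j. Polynomial.smult (a (j - l)) (phi1 \<alpha> \<beta> l)) < degree (phi2 \<alpha> \<beta> j)"
    using degree_phi2[OF assms(1), of \<alpha> j] assms(2) by simp
  then have "degree (psi \<alpha> \<beta> a j) = degree (phi2 \<alpha> \<beta> j)"
    unfolding psi_def by (rule degree_add_eq_right)
  then show ?thesis using degree_phi2[OF assms(1), of \<alpha> j] assms(2) by auto
qed

lemma casoratian_psi_nonzero:
  assumes "\<beta> > -1" "0 < \<alpha>" "k \<le> \<alpha>"
  shows "\<exists>x. casoratian k (\<lambda>i. poly (psi \<alpha> \<beta> a i)) x \<noteq> 0"
  by (rule casoratian_distinct_degrees) (use degree_psi[OF assms(1,2)] assms in \<open>auto simp: inj_on_def\<close>)

text \<open>The two rising factorials trade places.\<close>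

lemma poly_phi1_reflect: "poly (phi1 \<alpha> \<beta> j) (- x - (real \<alpha> + \<beta> + 1)) = poly (phi1 \<alpha> \<beta> j) x"
proof -
  have "1 + (- x - (real \<alpha> + \<beta> + 1)) = - real \<alpha> - \<beta> - x" 
    "- real \<alpha> - \<beta> - (- x - (real \<alpha> + \<beta> + 1)) = 1 + x" by simp_all
  then show ?thesis by (simp add: phi1_def poly_pochhammer)
qed

text \<open>The factors of order \<open>j\<close> trade places; so do those of order \<open>\<alpha>\<close>, each with its factors in
  reverse order and a sign \<open>(-1)\<^sup>\<alpha>\<close>, and the two signs cancel.\<close>

lemma poly_phi2_reflect: "poly (phi2 \<alpha> \<beta> j) (- x - (real \<alpha> + \<beta> + 1)) = poly (phi2 \<alpha> \<beta> j) x"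
proof -
  let ?y = "- x - (real \<alpha> + \<beta> + 1)"
  have a: "pochhammer (1 + ?y) \<alpha> = (-1) ^ \<alpha> * pochhammer (\<beta> + 1 + x) \<alpha>"
    using pochhammer_minus[of "real \<alpha> + \<beta> + x" \<alpha>] by (simp add: algebra_simps)
  have b: "pochhammer (\<beta> + 1 + ?y) \<alpha> = (-1) ^ \<alpha> * pochhammer (1 + x) \<alpha>"
    using pochhammer_minus[of "real \<alpha> + x" \<alpha>] by (simp add: algebra_simps)
  have c: "- ?y = real \<alpha> + \<beta> + 1 + x" "real \<alpha> + \<beta> + 1 + ?y = - x" by simp_all
  have "pochhammer (1 + ?y) \<alpha> * pochhammer (\<beta> + 1 + ?y) \<alpha>
      = ((-1) ^ \<alpha> * (-1) ^ \<alpha>) * (pochhammer (1 + x) \<alpha> * pochhammer (\<beta> + 1 + x) \<alpha>)"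
    unfolding a b by simp
  also have "(-1) ^ \<alpha> * (-1) ^ \<alpha> = (1::real)" by (simp flip: power_mult_distrib)
  finally have d: "pochhammer (1 + ?y) \<alpha> * pochhammer (\<beta> + 1 + ?y) \<alpha>
      = pochhammer (1 + x) \<alpha> * pochhammer (\<beta> + 1 + x) \<alpha>" by simp
  have p: "poly (phi2 \<alpha> \<beta> j) z = (-1) ^ j / (fact j * fact \<alpha> * pochhammer (1 + real \<alpha>) j * pochhammer (1 + \<beta>) \<alpha>) *
    ((pochhammer (1 + z) \<alpha> * pochhammer (\<beta> + 1 + z) \<alpha>) * (pochhammer (- z) j * pochhammer (real \<alpha> + \<beta> + 1 + z) j))" for z
    by (simp add: phi2_def poly_pochhammer)
  show ?thesis unfolding p d c by (simp add: mult.commute)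
qed

lemma poly_psi_reflect: "poly (psi \<alpha> \<beta> a j) (- x - (real \<alpha> + \<beta> + 1)) = poly (psi \<alpha> \<beta> a j) x"
  by (simp only: psi_def poly_add poly_sum poly_smult poly_phi1_reflect poly_phi2_reflect)

lemma poly_tau: "poly (tau k \<alpha> \<beta> a) x = casoratian k (\<lambda>i. poly (psi \<alpha> \<beta> a i)) x"
proof -
  have "tau k \<alpha> \<beta> a = fdet k (\<lambda>i j. pcompose (psi \<alpha> \<beta> a i) ([:0, 1:] - of_nat j))"
    unfolding tau_def Wr_def fdet_def by (intro arg_cong[of _ _ Determinant.det] eq_matI) auto
  then show ?thesis
    by (simp add: casoratian_def fdet_leibniz poly_sum poly_prod sign_def poly_pcompose of_nat_poly
        if_distrib[of "\<lambda>q. poly q x"] cong: if_cong)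
qed

section \<open>Realizations of the algebra\<close>

definition combo :: "(nat \<Rightarrow> 'v::real_vector) \<Rightarrow> nat \<Rightarrow> (nat \<Rightarrow> real) \<Rightarrow> 'v" where
  "combo e L v = (\<Sum>l\<le>L. v l *\<^sub>R e l)"

text \<open>\<open>X1\<close> and \<open>X2\<close> act on the combinations of the \<open>e l\<close> as the two generators act on their coefficient sequences with
  offset \<open>\<delta>\<close>.  The condition on \<open>v (Suc L)\<close> keeps the truncation at \<open>L\<close> from losing a term.\<close>

definition ladder :: "real \<Rightarrow> ('v::real_vector \<Rightarrow> 'v) \<Rightarrow> ('v \<Rightarrow> 'v) \<Rightarrow> (nat \<Rightarrow> 'v) \<Rightarrow> bool" where
  "ladder \<delta> X1 X2 e \<longleftrightarrow>
     (\<forall>L v. X1 (combo e L v) = combo e L (\<lambda>l. (real l + \<delta>) * v l)) \<and>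
     (\<forall>L v. v (Suc L) = 0 \<longrightarrow> X2 (combo e L v) = combo e L (\<lambda>l. v (Suc l)))"

definition coeff_array :: "real poly poly \<Rightarrow> nat \<Rightarrow> nat \<Rightarrow> real" where
  "coeff_array B = (\<lambda>i j. Polynomial.coeff (Polynomial.coeff B j) i)"

lemma combo_scale: "combo e L (r *\<^sub>R v) = r *\<^sub>R combo e L v"
  by (simp add: combo_def scaleR_fun_def scaleR_sum_right)

lemma ladder_funpow1:
  assumes "ladder \<delta> X1 X2 e"
  shows "(X1 ^^ i) (combo e L v) = combo e L (\<lambda>l. (real l + \<delta>) ^ i * v l)"
  by (induction i) (use assms in \<open>auto simp: ladder_def mult.assoc\<close>)

lemma ladder_funpow2:
  assumes "ladder \<delta> X1 X2 e" "\<And>l. l > L \<Longrightarrow> v l = 0"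
  shows "(X2 ^^ j) (combo e L v) = combo e L (\<lambda>l. v (l + j))"
  by (induction j) (use assms in \<open>auto simp: ladder_def\<close>)

lemma coeff_array_bound:
  "\<exists>D. \<forall>i j. coeff_array B i j \<noteq> 0 \<longrightarrow> i \<le> D \<and> j \<le> degree B"
proof -
  define D where "D = (\<Sum>j\<le>degree B. degree (Polynomial.coeff B j))"
  have "i \<le> D \<and> j \<le> degree B" if "coeff_array B i j \<noteq> 0" for i j
  proof -
    have j: "j \<le> degree B" using that by (auto simp: coeff_array_def intro!: le_degree)
    moreover have "i \<le> degree (Polynomial.coeff B j)" using that by (auto simp: coeff_array_def intro!: le_degree)
    moreover have "degree (Polynomial.coeff B j) \<le> D"
      unfolding D_def using j by (intro member_le_sum) auto
    ultimately show ?thesis by linarith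
  qed
  then show ?thesis by blast
qed

lemma finite_coeff_array: "finite_array (coeff_array B)"
proof -
  obtain D where "\<And>i j. coeff_array B i j \<noteq> 0 \<Longrightarrow> i \<le> D \<and> j \<le> degree B" using coeff_array_bound by blast
  then have "{(i, j). coeff_array B i j \<noteq> 0} \<subseteq> {..D} \<times> {..degree B}" by auto
  then show ?thesis unfolding finite_array_def by (rule finite_subset) auto
qed

lemma finite_array_is_coeff_array:
  assumes "finite_array c"
  shows "\<exists>B. c = coeff_array B"
proof -
  let ?S = "{(i, j). c i j \<noteq> 0}"
  define N where "N = Max (insert 0 (fst ` ?S \<union> snd ` ?S))"
  have fin: "finite (insert 0 (fst ` ?S \<union> snd ` ?S))" using assms by (simp add: finite_array_def)
  have N: "i \<le> N \<and> j \<le> N" if "c i j \<noteq> 0" for i j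
  proof -
    have "i \<in> fst ` ?S" "j \<in> snd ` ?S" using that by force+
    then show ?thesis unfolding N_def using fin by (auto intro!: Max_ge)
  qed
  let ?B = "\<Sum>j\<le>N. monom (\<Sum>i\<le>N. monom (c i j) i) j"
  have "Polynomial.coeff ?B j = (if j \<le> N then \<Sum>i\<le>N. monom (c i j) i else 0)" for j
    by (simp add: coeff_sum if_distrib cong: if_cong)
  then have "coeff_array ?B i j = (if j \<le> N then if i \<le> N then c i j else 0 else 0)" for i j
    by (simp add: coeff_array_def coeff_sum if_distrib cong: if_cong)
  then have "coeff_array ?B = c" using N by (intro ext) auto
  then have "c = coeff_array ?B" by (rule sym)
  then show ?thesis by (rule exI)
qed

lemma subst_op_ladder:
  assumes "ladder \<delta> X1 X2 e" "\<And>l. l > L \<Longrightarrow> v l = 0"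
  shows "subst_op (coeff_array B) X1 X2 (combo e L v) = combo e L (act \<delta> B v)"
proof -
  obtain D where D: "\<And>i j. coeff_array B i j \<noteq> 0 \<Longrightarrow> i \<le> D \<and> j \<le> degree B" using coeff_array_bound by blast
  let ?t = "\<lambda>i j. coeff_array B i j *\<^sub>R (X1 ^^ i) ((X2 ^^ j) (combo e L v))"
  have "subst_op (coeff_array B) X1 X2 (combo e L v) = (\<Sum>(i, j)\<in>{..D} \<times> {..degree B}. ?t i j)"
    unfolding subst_op_def
    by (intro sum.mono_neutral_left) (use D in auto)
  also have "\<dots> = (\<Sum>i\<le>D. \<Sum>j\<le>degree B. ?t i j)" by (rule sum.cartesian_product[symmetric])
  also have "\<dots> = (\<Sum>i\<le>D. \<Sum>j\<le>degree B. \<Sum>l\<le>L. 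
      (coeff_array B i j * (real l + \<delta>) ^ i * v (l + j)) *\<^sub>R e l)"
    by (simp add: ladder_funpow2[OF assms] ladder_funpow1[OF assms(1)])
       (simp add: combo_def scaleR_sum_right mult.assoc)
  also have "\<dots> = (\<Sum>i\<le>D. \<Sum>l\<le>L. \<Sum>j\<le>degree B. 
      (coeff_array B i j * (real l + \<delta>) ^ i * v (l + j)) *\<^sub>R e l)"
    by (intro sum.cong refl sum.swap)
  also have "\<dots> = (\<Sum>l\<le>L. \<Sum>i\<le>D. \<Sum>j\<le>degree B. 
      (coeff_array B i j * (real l + \<delta>) ^ i * v (l + j)) *\<^sub>R e l)"
    by (rule sum.swap)
  also have "\<dots> = (\<Sum>l\<le>L. \<Sum>j\<le>degree B. \<Sum>i\<le>D.
      (coeff_array B i j * (real l + \<delta>) ^ i * v (l + j)) *\<^sub>R e l)"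
    by (intro sum.cong refl sum.swap)
  also have "\<dots> = combo e L (act \<delta> B v)"
    unfolding combo_def
  proof (intro sum.cong refl)
    fix l
    have "poly (Polynomial.coeff B j) y = (\<Sum>i\<le>D. coeff_array B i j * y ^ i)" for j y
    proof -
      have "poly (Polynomial.coeff B j) y = (\<Sum>i\<le>degree (Polynomial.coeff B j). coeff_array B i j * y ^ i)"
        by (simp add: poly_altdef coeff_array_def)
      also have "\<dots> = (\<Sum>i\<le>max D (degree (Polynomial.coeff B j)). coeff_array B i j * y ^ i)"
        by (rule sum.mono_neutral_left) (auto simp: coeff_array_def coeff_eq_0)
      also have "\<dots> = (\<Sum>i\<le>D. coeff_array B i j * y ^ i)"
        by (rule sum.mono_neutral_right) (use D in force)+
      finally show ?thesis .
    qed
    then show "(\<Sum>j\<le>degree B. \<Sum>i\<le>D. (coeff_array B i j * (real l + \<delta>) ^ i * v (l + j)) *\<^sub>R e l)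
        = act \<delta> B v l *\<^sub>R e l"
      by (simp add: act_def scaleR_sum_left sum_distrib_right)
  qed
  finally show ?thesis .
qed

lemma act_diff: "act \<delta> (B - C) v l = act \<delta> B v l - act \<delta> C v l"
proof -
  let ?N = "max (degree B) (degree C)"
  have "degree (B - C) \<le> ?N" by (rule degree_diff_le_max)
  then show ?thesis
    by (simp add: act_altdef[of _ ?N] left_diff_distrib sum_subtractf)
qed

text \<open>Uniqueness of \<open>B\<^sub>f\<close>.  Let \<open>j\<close> be the least power of \<open>D\<^sub>2\<close> in \<open>B - C \<noteq> 0\<close>.  The coefficient of index \<open>n - j\<close> of its image
  of \<open>q n\<close> is the coefficient of \<open>D\<^sub>2\<^sup>j\<close> at \<open>n - j\<close> times the top coefficient of \<open>q n\<close>.  The latter is nonzero for almost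
  all \<open>n\<close>, so a nonzero polynomial would have infinitely many zeros.\<close>

lemma act_determined:
  assumes t: "t \<noteq> 0" and q: "\<And>n l. n < l \<Longrightarrow> q n l = 0" and top: "\<And>n. poly t (real n - 1) \<noteq> 0 \<Longrightarrow> q n n \<noteq> 0"
    and eq: "\<And>n l. l \<le> n \<Longrightarrow> act 0 B (q n) l = act 0 C (q n) l"
  shows "B = C"
proof (rule ccontr)
  assume "B \<noteq> C"
  define E where "E = B - C"
  have "E \<noteq> 0" using \<open>B \<noteq> C\<close> by (simp add: E_def)
  then have "\<exists>j. Polynomial.coeff E j \<noteq> 0" by (metis leading_coeff_0_iff)
  then obtain j where j: "Polynomial.coeff E j \<noteq> 0" "\<And>i. i < j \<Longrightarrow> Polynomial.coeff E i = 0"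
    using exists_least_iff[of "\<lambda>j. Polynomial.coeff E j \<noteq> 0"] by metis
  have "poly (Polynomial.coeff E j) (real n - real j) = 0 \<or> poly t (real n - 1) = 0" if "j \<le> n" for n
  proof -
    have "0 = act 0 E (q n) (n - j)" using eq[of "n - j" n] by (simp add: E_def act_diff)
    also have "\<dots> = (\<Sum>i\<le>degree E. poly (Polynomial.coeff E i) (real (n - j)) * q n (n - j + i))"
      by (simp add: act_def)
    also have "\<dots> = (\<Sum>i\<in>{j}. poly (Polynomial.coeff E i) (real (n - j)) * q n (n - j + i))"
    proof (rule sum.mono_neutral_right)
      show "\<forall>i\<in>{..degree E} - {j}. poly (Polynomial.coeff E i) (real (n - j)) * q n (n - j + i) = 0"
      proof
        fix i assume "i \<in> {..degree E} - {j}"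
        then have "i < j \<or> n < n - j + i" using that by auto
        then show "poly (Polynomial.coeff E i) (real (n - j)) * q n (n - j + i) = 0" using j(2) q by auto
      qed
    qed (use j in \<open>auto intro!: le_degree\<close>)
    finally show ?thesis using top[of n] that by (auto simp: of_nat_diff)
  qed
  then have "poly (pcompose (Polynomial.coeff E j) [:- real j, 1:] * pcompose t [:-1, 1:]) (real n) = 0" if "j \<le> n" for n
    using that by (force simp: poly_pcompose)
  then have "real ` {j..} \<subseteq> {x. poly (pcompose (Polynomial.coeff E j) [:- real j, 1:] * pcompose t [:-1, 1:]) x = 0}"
    by auto
  moreover have "infinite (real ` {j..})" by (simp add: finite_image_iff infinite_Ici)
  ultimately have "pcompose (Polynomial.coeff E j) [:- real j, 1:] * pcompose t [:-1, 1:] = 0"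
    using poly_roots_finite finite_subset by blast
  then consider "pcompose (Polynomial.coeff E j) [:- real j, 1:] = 0" | "pcompose t [:-1, 1:] = 0" by auto
  then show False using j(1) t by cases (auto dest: pcompose_eq_0)
qed

section \<open>The hypergeometric realization\<close>

definition hyp_term :: "real \<Rightarrow> nat \<Rightarrow> real \<Rightarrow> real" where
  "hyp_term \<gamma> l = (\<lambda>z. z ^ l / (pochhammer (\<gamma> + 1) l * fact l))"

definition combo_poly :: "real \<Rightarrow> nat \<Rightarrow> (nat \<Rightarrow> real) \<Rightarrow> real poly" where
  "combo_poly \<gamma> L v = (\<Sum>l\<le>L. monom (v l / (pochhammer (\<gamma> + 1) l * fact l)) l)"

lemma combo_hyp_term: "combo (hyp_term \<gamma>) L v = poly (combo_poly \<gamma> L v)"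
  by (rule ext) (simp add: combo_def combo_poly_def hyp_term_def sum_fun_app scaleR_fun_def poly_sum poly_monom)

lemma combo_hyp_term_inject:
  assumes "\<gamma> > -1" "combo (hyp_term \<gamma>) L v = combo (hyp_term \<gamma>) L w" "l \<le> L"
  shows "v l = w l"
proof -
  have c: "Polynomial.coeff (combo_poly \<gamma> L v) l = v l / (pochhammer (\<gamma> + 1) l * fact l)" for v
    using assms(3) by (simp add: combo_poly_def coeff_sum if_distrib cong: if_cong)
  have "combo_poly \<gamma> L v = combo_poly \<gamma> L w" using assms(2) by (simp add: combo_hyp_term poly_eq_poly_eq_iff)
  then have "v l / (pochhammer (\<gamma> + 1) l * fact l) = w l / (pochhammer (\<gamma> + 1) l * fact l)" using c by metis
  moreover have "pochhammer (\<gamma> + 1) l > 0" using assms(1) by (intro pochhammer_pos) auto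
  ultimately show ?thesis by simp
qed

lemma deriv_poly: "deriv (poly p) = poly (pderiv p)"
  by (rule ext) (auto intro: DERIV_imp_deriv poly_DERIV)

lemma pderiv_sum_fun: "pderiv (\<Sum>i\<in>I. p i) = (\<Sum>i\<in>I. pderiv (p i))"
  using higher_pderiv_sum[of 1 p I] by simp

lemma sum_shift_down:
  fixes f :: "nat \<Rightarrow> 'a::ab_group_add"
  assumes "f 0 = 0" "f (Suc L) = 0"
  shows "(\<Sum>l\<le>L. f l) = (\<Sum>l\<le>L. f (Suc l))"
  using sum.atMost_Suc[of f L] sum.atMost_Suc_shift[of f L] assms by simp

lemma ladder_hyp_term:
  assumes "\<gamma> > -1"
  shows "ladder 0 D1 (D2 \<gamma>) (hyp_term \<gamma>)"
  unfolding ladder_def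
proof (intro conjI allI impI)
  fix L v
  let ?a = "\<lambda>l. pochhammer (\<gamma> + 1) l * fact l :: real"
  have pd: "pderiv (combo_poly \<gamma> L v) = (\<Sum>l\<le>L. monom (real l * (v l / ?a l)) (l - 1))"
    by (simp add: combo_poly_def pderiv_sum_fun pderiv_monom)
  have z: "z * (r * z ^ (l - 1)) = r * z ^ l" if "l = 0 \<longrightarrow> r = 0" for z r :: real and l
    using that by (cases l) auto
  show "D1 (combo (hyp_term \<gamma>) L v) = combo (hyp_term \<gamma>) L (\<lambda>l. (real l + 0) * v l)"
  proof
    fix x
    have "D1 (combo (hyp_term \<gamma>) L v) x = (\<Sum>l\<le>L. x * (real l * (v l / ?a l) * x ^ (l - 1)))"
      by (simp only: D1_def combo_hyp_term deriv_poly pd poly_sum poly_monom sum_distrib_left)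
    also have "\<dots> = (\<Sum>l\<le>L. real l * (v l / ?a l) * x ^ l)"
      by (intro sum.cong refl z) simp
    also have "\<dots> = combo (hyp_term \<gamma>) L (\<lambda>l. (real l + 0) * v l) x"
      by (simp add: combo_def hyp_term_def sum_fun_app scaleR_fun_def)
    finally show "D1 (combo (hyp_term \<gamma>) L v) x = combo (hyp_term \<gamma>) L (\<lambda>l. (real l + 0) * v l) x" .
  qed
  assume v: "v (Suc L) = 0"
  show "D2 \<gamma> (combo (hyp_term \<gamma>) L v) = combo (hyp_term \<gamma>) L (\<lambda>l. v (Suc l))"
  proof
    fix x
    have pd2: "pderiv (pderiv (combo_poly \<gamma> L v)) = (\<Sum>l\<le>L. monom (real (l - 1) * (real l * (v l / ?a l))) (l - 1 - 1))"
      unfolding pd by (simp add: pderiv_sum_fun pderiv_monom)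
    have "D2 \<gamma> (combo (hyp_term \<gamma>) L v) x = (\<Sum>l\<le>L. x * (real (l - 1) * (real l * (v l / ?a l)) * x ^ (l - 1 - 1))
        + (\<gamma> + 1) * (real l * (v l / ?a l) * x ^ (l - 1)))"
      by (simp only: D2_def combo_hyp_term deriv_poly pd2) 
         (simp only: pd poly_sum poly_monom sum_distrib_left sum.distrib)
    also have "\<dots> = (\<Sum>l\<le>L. (real (l - 1) + \<gamma> + 1) * real l * (v l / ?a l) * x ^ (l - 1))"
    proof (intro sum.cong refl)
      fix l
      have "x * (real (l - 1) * (real l * (v l / ?a l)) * x ^ (l - 1 - 1))
          = real (l - 1) * (real l * (v l / ?a l)) * x ^ (l - 1)" by (rule z) simp
      then show "x * (real (l - 1) * (real l * (v l / ?a l)) * x ^ (l - 1 - 1))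
          + (\<gamma> + 1) * (real l * (v l / ?a l) * x ^ (l - 1))
        = (real (l - 1) + \<gamma> + 1) * real l * (v l / ?a l) * x ^ (l - 1)"
        by (simp only: distrib_right mult.assoc add.assoc)
    qed
    also have "\<dots> = (\<Sum>l\<le>L. (real l + \<gamma> + 1) * real (Suc l) * (v (Suc l) / ?a (Suc l)) * x ^ l)"
      by (subst sum_shift_down) (use v in auto)
    also have "\<dots> = (\<Sum>l\<le>L. v (Suc l) / ?a l * x ^ l)"
    proof (intro sum.cong refl)
      fix l
      have "real l + \<gamma> + 1 > 0" "pochhammer (\<gamma> + 1) l > 0" using assms by (auto intro: pochhammer_pos)
      then have "(real l + \<gamma> + 1) * real (Suc l) * (v (Suc l) / ?a (Suc l)) = v (Suc l) / ?a l"
        by (simp add: pochhammer_Suc divide_simps del: of_nat_Suc)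
      then show "(real l + \<gamma> + 1) * real (Suc l) * (v (Suc l) / ?a (Suc l)) * x ^ l = v (Suc l) / ?a l * x ^ l"
        by (simp only:)
    qed
    also have "\<dots> = combo (hyp_term \<gamma>) L (\<lambda>l. v (Suc l)) x"
      by (simp add: combo_def hyp_term_def sum_fun_app scaleR_fun_def)
    finally show "D2 \<gamma> (combo (hyp_term \<gamma>) L v) x = combo (hyp_term \<gamma>) L (\<lambda>l. v (Suc l)) x" .
  qed
qed

lemma pochhammer_neg_nat: "l \<le> n \<Longrightarrow> pochhammer (- real n) l = (-1) ^ l * fact n / fact (n - l)"
proof (induction l)
  case (Suc l)
  then have "n - l = Suc (n - Suc l)" by simp
  then have f: "fact (n - l) = (real n - real l) * fact (n - Suc l)" using Suc by (simp add: of_nat_diff)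
  have "real n - real l \<noteq> 0" using Suc by simp
  moreover have "pochhammer (- real n) (Suc l) = - (real n - real l) * ((-1) ^ l * fact n / ((real n - real l) * fact (n - Suc l)))"
    using Suc by (simp add: pochhammer_Suc f[symmetric])
  moreover have "- d * ((-1) ^ l * fact n / (d * F)) = (-1) ^ Suc l * fact n / F" if "d \<noteq> 0" for d F :: real
    using that by simp
  ultimately show ?case by (simp only: not_False_eq_True)
qed simp

text \<open>The factors combine by \<open>(c)\<^sub>n (n + c)\<^sub>l = (c)\<^bsub>n+l\<^esub>\<close> and \<open>(- n)\<^sub>l = (-1)\<^sup>l n! / (n - l)!\<close>.\<close>

lemma jacobi_expand:
  assumes "m \<le> int L"
  shows "jacobi \<alpha> \<gamma> m z = combo (hyp_term \<gamma>) L (jac (\<alpha> + \<gamma> + 1) m) z"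
proof (cases "m < 0")
  case True
  then show ?thesis
    by (simp add: jacobi_def combo_def sum_fun_app scaleR_fun_def jac_above)
next
  case False
  then obtain n where n: "m = int n" by (metis nonneg_int_cases not_less)
  let ?h = "\<lambda>l. pochhammer (- real n) l * pochhammer (real n + \<alpha> + \<gamma> + 1) l / (pochhammer (\<gamma> + 1) l * fact l) * z ^ l"
  have "hyp2F1 (- real n) (real n + \<alpha> + \<gamma> + 1) (\<gamma> + 1) z = (\<Sum>l\<le>L. ?h l)"
    unfolding hyp2F1_def using assms n 
    by (intro suminf_finite) (auto simp: pochhammer_of_nat_eq_0_iff)
  then have "jacobi \<alpha> \<gamma> m z = (\<Sum>l\<le>L. (-1) ^ n * pochhammer (\<alpha> + \<gamma> + 1) n / fact n * ?h l)"
    by (simp add: jacobi_def n sum_distrib_left)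
  also have "\<dots> = (\<Sum>l\<le>L. jac (\<alpha> + \<gamma> + 1) m l * hyp_term \<gamma> l z)"
  proof (intro sum.cong refl)
    fix l
    show "(-1) ^ n * pochhammer (\<alpha> + \<gamma> + 1) n / fact n * ?h l = jac (\<alpha> + \<gamma> + 1) m l * hyp_term \<gamma> l z"
    proof (cases "l \<le> n")
      case True
      have "pochhammer (\<alpha> + \<gamma> + 1) (n + l) = pochhammer (\<alpha> + \<gamma> + 1) n * pochhammer (real n + \<alpha> + \<gamma> + 1) l"
        using pochhammer_product'[of "\<alpha> + \<gamma> + 1" n l] by (simp add: add_ac)
      then show ?thesis using True
        by (simp add: n jac_def hyp_term_def pochhammer_neg_nat power_add)
    next
      case False
      then show ?thesis by (simp add: n jac_above pochhammer_of_nat_eq_0_iff)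
    qed
  qed
  also have "\<dots> = combo (hyp_term \<gamma>) L (jac (\<alpha> + \<gamma> + 1) m) z"
    by (simp add: combo_def sum_fun_app scaleR_fun_def)
  finally show ?thesis .
qed

text \<open>The shift of \<open>\<beta>\<close> by \<open>s\<close> in the Jacobi polynomials and the shift of the argument of \<open>\<psi>\<close> by \<open>s / 2\<close> are both
  accounted for by the offset \<open>\<delta> = s / 2\<close>, since \<open>c + 2 \<delta> = \<alpha> + (\<beta> + s) + 1\<close>.\<close>

lemma qhat_expand:
  "qhat k \<alpha> \<beta> a n s z = combo (hyp_term (\<beta> + real s)) n
     (qseq k (real \<alpha> + \<beta> + 1) (\<lambda>i. poly (psi \<alpha> \<beta> a i)) (real s / 2) (int n)) z"
proof -
  let ?\<psi> = "\<lambda>i. poly (psi \<alpha> \<beta> a i)" and ?c = "real \<alpha> + \<beta> + 1" and ?x = "real n + real s / 2"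
  have "qhat k \<alpha> \<beta> a n s z = fdet (Suc k) (\<lambda>i j. if i = k then jacobi (real \<alpha>) (\<beta> + real s) (int n - int j) z
      else ?\<psi> i (?x - real j))"
    unfolding qhat_def Wr_def fdet_def
    by (intro arg_cong[of _ _ Determinant.det] eq_matI) (auto simp: nth_append algebra_simps)
  also have "\<dots> = (\<Sum>r\<le>k. jacobi (real \<alpha>) (\<beta> + real s) (int n - int r) z * border_coef k ?\<psi> ?x r)"
    by (rule border_expand)
  also have "\<dots> = (\<Sum>r\<le>k. \<Sum>l\<le>n. border_coef k ?\<psi> ?x r * jac (?c + 2 * (real s / 2)) (int n - int r) l * hyp_term (\<beta> + real s) l z)"
    by (simp add: jacobi_expand[of _ n] combo_def sum_fun_app scaleR_fun_def sum_distrib_left sum_distrib_right mult_ac add_ac)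
  also have "\<dots> = combo (hyp_term (\<beta> + real s)) n (qseq k ?c ?\<psi> (real s / 2) (int n)) z"
    by (subst sum.swap) (simp add: combo_def qseq_def sum_fun_app scaleR_fun_def sum_distrib_right)
  finally show ?thesis .
qed

lemma qfun_qhat: "qfun k \<alpha> \<beta> a n = qhat k \<alpha> \<beta> a n 0"
  by (rule ext) (simp add: qfun_def qhat_def)

section \<open>The operator \<open>B\<^sub>f\<close>\<close>

lemma casorati_alg:
  assumes "0 < \<alpha>" "k \<le> \<alpha>" "\<beta> > -1" "f \<in> alg k \<alpha> \<beta> a"
  shows "\<exists>u. casorati k (real \<alpha> + \<beta> + 1) (\<lambda>i. poly (psi \<alpha> \<beta> a i))
    (\<lambda>x. poly f (lam (real \<alpha> + \<beta>) (x - real k / 2))) (poly u)"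
proof -
  obtain u where u: "pcompose f (lam [:real \<alpha> + \<beta>:] [:- real k / 2, 1:])
           - pcompose f (lam [:real \<alpha> + \<beta>:] [:- real k / 2 - 1, 1:]) = pcompose (tau k \<alpha> \<beta> a) [:-1, 1:] * u"
    using assms(4) unfolding alg_def by (auto elim: dvdE)
  let ?F = "\<lambda>x. poly f (lam (real \<alpha> + \<beta>) (x - real k / 2))"
  have lamp: "poly (lam [:real \<alpha> + \<beta>:] [:b, 1:]) x = lam (real \<alpha> + \<beta>) (x + b)" for b x
    by (simp add: lam_def algebra_simps)
  have "casorati k (real \<alpha> + \<beta> + 1) (\<lambda>i. poly (psi \<alpha> \<beta> a i)) ?F (poly u)"
  proof
    show "real \<alpha> + \<beta> + 1 \<noteq> 0" using assms by simp
    show "\<exists>x. casoratian k (\<lambda>i. poly (psi \<alpha> \<beta> a i)) x \<noteq> 0"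
      by (rule casoratian_psi_nonzero) (use assms in auto)
    show "?F x - ?F (x - 1) = poly u x * casoratian k (\<lambda>i. poly (psi \<alpha> \<beta> a i)) (x - 1)" for x
    proof -
      have "?F x - ?F (x - 1) = poly f (lam (real \<alpha> + \<beta>) (x + - real k / 2)) - poly f (lam (real \<alpha> + \<beta>) (x + (- real k / 2 - 1)))"
        by (intro arg_cong2[of _ _ _ _ "(-)"] arg_cong[where f = "\<lambda>y. poly f (lam _ y)"]) simp_all
      also have "\<dots> = poly (pcompose (tau k \<alpha> \<beta> a) [:-1, 1:] * u) x"
        unfolding u[symmetric] by (simp only: poly_diff poly_pcompose lamp)
      also have "\<dots> = poly u x * casoratian k (\<lambda>i. poly (psi \<alpha> \<beta> a i)) (x - 1)"
        by (simp add: poly_pcompose poly_tau mult.commute)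
      finally show ?thesis .
    qed
    show "?F (real k - (real \<alpha> + \<beta> + 1) - x) = ?F x" for x
      by (rule arg_cong[where f = "poly f"]) (simp add: lam_def algebra_simps)
    show "polyfun ?F" unfolding lam_def
      by (intro polyfun_poly polyfun_mult polyfun_add polyfun_diff polyfun_ident polyfun_const)
  qed (auto intro: polyfunI simp: poly_psi_reflect)
  then show ?thesis by blast
qed

text \<open>The definite description picks the operator of \<open>spectral_operator\<close>, which has the spectral property at every
  offset, while the description itself only speaks of \<open>\<delta> = 0\<close>.\<close>

lemma B_coeffs_spectral:
  assumes "0 < \<alpha>" "k \<le> \<alpha>" "\<beta> > -1" "f \<in> alg k \<alpha> \<beta> a"
  defines "q \<equiv> qseq k (real \<alpha> + \<beta> + 1) (\<lambda>i. poly (psi \<alpha> \<beta> a i))"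
    and "F \<equiv> \<lambda>x. poly f (lam (real \<alpha> + \<beta>) (x - real k / 2))"
  shows "\<exists>B. B_coeffs k \<alpha> \<beta> a f = coeff_array B \<and>
    (\<forall>\<delta> n. act \<delta> B (q \<delta> n) = F (of_int n + \<delta>) *\<^sub>R q \<delta> n)"
proof -
  obtain u where "casorati k (real \<alpha> + \<beta> + 1) (\<lambda>i. poly (psi \<alpha> \<beta> a i)) F (poly u)"
    using casorati_alg[OF assms(1-4)] unfolding F_def by blast
  then obtain T where "ladder_op T" and T: "\<And>\<delta> n. T \<delta> (q \<delta> n) = F (of_int n + \<delta>) *\<^sub>R q \<delta> n"
    using casorati.spectral_operator unfolding q_def by blast
  then obtain B where B: "\<And>\<delta>. T \<delta> = act \<delta> B" by (auto simp: ladder_op_def)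
  have qf: "qfun k \<alpha> \<beta> a n = combo (hyp_term \<beta>) n (q 0 (int n))" for n
    by (rule ext) (simp add: qfun_qhat qhat_expand q_def)
  have above: "q \<delta> (int n) l = 0" if "n < l" for \<delta> n l using that by (simp add: q_def qseq_above)
  have sub: "subst_op (coeff_array C) D1 (D2 \<beta>) (qfun k \<alpha> \<beta> a n) = combo (hyp_term \<beta>) n (act 0 C (q 0 (int n)))" for C n
    unfolding qf by (rule subst_op_ladder[OF ladder_hyp_term]) (use above assms in auto)
  have "B_coeffs k \<alpha> \<beta> a f = coeff_array B"
    unfolding B_coeffs_def
  proof (rule the_equality)
    have "subst_op (coeff_array B) D1 (D2 \<beta>) (qfun k \<alpha> \<beta> a n)
        = poly f (lam (real \<alpha> + \<beta>) (real n - real k / 2)) *\<^sub>R qfun k \<alpha> \<beta> a n" for n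
      using T[of 0 "int n"] unfolding sub unfolding B qf by (simp add: combo_scale F_def)
    then show "finite_array (coeff_array B) \<and> (\<forall>n. subst_op (coeff_array B) D1 (D2 \<beta>) (qfun k \<alpha> \<beta> a n)
        = poly f (lam (real \<alpha> + \<beta>) (real n - real k / 2)) *\<^sub>R qfun k \<alpha> \<beta> a n)"
      using finite_coeff_array by blast
  next
    fix c
    assume c: "finite_array c \<and> (\<forall>n. subst_op c D1 (D2 \<beta>) (qfun k \<alpha> \<beta> a n)
        = poly f (lam (real \<alpha> + \<beta>) (real n - real k / 2)) *\<^sub>R qfun k \<alpha> \<beta> a n)"
    then obtain C where C: "c = coeff_array C" using finite_array_is_coeff_array by blast
    have "C = B"
    proof (rule act_determined[of "tau k \<alpha> \<beta> a" "\<lambda>n. q 0 (int n)"])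
      show "tau k \<alpha> \<beta> a \<noteq> 0" using casoratian_psi_nonzero[OF assms(3,1,2), of a] by (metis poly_0 poly_tau)
      show "q 0 (int n) n \<noteq> 0" if "poly (tau k \<alpha> \<beta> a) (real n - 1) \<noteq> 0" for n
      proof -
        have "pochhammer (real \<alpha> + \<beta> + 1) (2 * n) > 0" using assms by (intro pochhammer_pos) auto
        then show ?thesis using that by (simp add: q_def qseq_top poly_tau)
      qed
      show "act 0 C (q 0 (int n)) l = act 0 B (q 0 (int n)) l" if "l \<le> n" for n l
      proof (rule combo_hyp_term_inject[OF assms(3) _ that])
        have "combo (hyp_term \<beta>) n (act 0 C (q 0 (int n)))
            = poly f (lam (real \<alpha> + \<beta>) (real n - real k / 2)) *\<^sub>R qfun k \<alpha> \<beta> a n"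
          using c by (simp add: C sub)
        also have "\<dots> = combo (hyp_term \<beta>) n (act 0 B (q 0 (int n)))"
          using T[of 0 "int n"] by (simp add: B qf combo_scale F_def)
        finally show "combo (hyp_term \<beta>) n (act 0 C (q 0 (int n))) = combo (hyp_term \<beta>) n (act 0 B (q 0 (int n)))" .
      qed
    qed (use above in auto)
    then show "c = coeff_array B" using C by simp
  qed
  then show ?thesis using T B by metis
qed

section \<open>Polynomial functions on Euclidean space\<close>

abbreviation rpf :: "('a::real_normed_vector \<Rightarrow> real) \<Rightarrow> bool" where
  "rpf \<equiv> real_polynomial_function"

abbreviation sqnorm :: "real ^ 'd \<Rightarrow> real" where
  "sqnorm \<equiv> (\<lambda>x. (norm x)\<^sup>2)"

lemmas rpf_intros = real_polynomial_function.intros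

lemma rpf_plus: "rpf f \<Longrightarrow> rpf g \<Longrightarrow> rpf (f + g)"
  unfolding plus_fun_def by (rule rpf_intros(3))

lemma rpf_scale: "rpf f \<Longrightarrow> rpf (c *\<^sub>R f)"
  unfolding scaleR_fun_def real_scaleR_def by (intro rpf_intros(4) rpf_intros(2))

lemma rpf_zero: "rpf 0"
  unfolding zero_fun_def by (rule rpf_intros(2))

lemma rpf_subspace: "subspace {f. rpf f}"
  by (intro subspaceI) (auto intro: rpf_plus rpf_scale rpf_zero)

lemma rpf_sum_scale: "(\<And>i. i \<in> I \<Longrightarrow> rpf (f i)) \<Longrightarrow> rpf (\<Sum>i\<in>I. c i *\<^sub>R f i)"
  using subspace_sum[OF rpf_subspace, of I "\<lambda>i. c i *\<^sub>R f i"] by (auto intro: rpf_scale)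

lemma rpf_differentiable: "rpf f \<Longrightarrow> f differentiable (at x)"
  by (induction rule: real_polynomial_function.induct) (auto simp: bounded_linear_imp_differentiable)

lemma rpf_has_derivative: "rpf f \<Longrightarrow> (f has_derivative frechet_derivative f (at x)) (at x)"
  using rpf_differentiable frechet_derivative_works by blast

lemma partial_eqI: "(f has_derivative f') (at x) \<Longrightarrow> partial j f x = f' (axis j 1)"
  unfolding partial_def using frechet_derivative_at by metis

lemma partial_const: "partial j (\<lambda>x. c) = (\<lambda>x. 0)"
  by (rule ext, rule partial_eqI) (rule has_derivative_const)

lemma partial_linear: "bounded_linear f \<Longrightarrow> partial j f = (\<lambda>x. f (axis j 1))"
  by (rule ext, rule partial_eqI) (rule bounded_linear_imp_has_derivative)

lemma partial_add:
  assumes "rpf f" "rpf g"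
  shows "partial j (\<lambda>x. f x + g x) = (\<lambda>x. partial j f x + partial j g x)"
  by (rule ext, subst partial_eqI[OF has_derivative_add[OF rpf_has_derivative rpf_has_derivative], OF assms])
     (simp add: partial_def)

lemma partial_mult:
  assumes "rpf f" "rpf g"
  shows "partial j (\<lambda>x. f x * g x) = (\<lambda>x. f x * partial j g x + partial j f x * g x)"
  by (rule ext, subst partial_eqI[OF has_derivative_mult[OF rpf_has_derivative rpf_has_derivative], OF assms])
     (simp add: partial_def)

lemma rpf_partial: "rpf f \<Longrightarrow> rpf (partial j f)"
  by (induction rule: real_polynomial_function.induct) (auto simp: partial_linear partial_const partial_add partial_mult)

lemma partial_plus: "rpf f \<Longrightarrow> rpf g \<Longrightarrow> partial j (f + g) = partial j f + partial j g"
  unfolding plus_fun_def by (rule partial_add)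

lemma partial_scale: "rpf f \<Longrightarrow> partial j (c *\<^sub>R f) = c *\<^sub>R partial j f"
  unfolding scaleR_fun_def real_scaleR_def
  by (subst partial_mult) (auto simp: partial_const)

lemma partial_cmult: "rpf f \<Longrightarrow> partial j (\<lambda>x. c * f x) = (\<lambda>x. c * partial j f x)"
  using partial_scale[of f j c] by (simp only: scaleR_fun_def real_scaleR_def)

lemma rpf_laplacian: "rpf f \<Longrightarrow> rpf (laplacian f)"
  unfolding laplacian_def by (intro real_polynomial_function_sum rpf_partial) auto

lemma rpf_coord: "rpf (\<lambda>x. vec_nth x j)"
  by (intro rpf_intros(1) bounded_linear_vec_nth)

lemma rpf_sqnorm: "rpf (sqnorm :: real ^ 'd \<Rightarrow> real)"
proof -
  have "sqnorm = (\<lambda>x :: real ^ 'd. \<Sum>i\<in>UNIV. vec_nth x i * vec_nth x i)"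
    by (rule ext) (simp only: power2_norm_eq_inner inner_vec_def inner_real_def)
  then show ?thesis by (simp only:) (intro real_polynomial_function_sum rpf_intros(4) rpf_coord finite)
qed

lemma euler_plus: "rpf f \<Longrightarrow> rpf g \<Longrightarrow> euler (f + g) = euler f + euler g"
  by (rule ext) (simp add: euler_def partial_plus distrib_left sum.distrib)

lemma euler_scale: "rpf f \<Longrightarrow> euler (c *\<^sub>R f) = c *\<^sub>R euler f"
  by (rule ext) (simp add: euler_def partial_cmult scaleR_fun_def sum_distrib_left mult_ac)

lemma laplacian_plus: "rpf f \<Longrightarrow> rpf g \<Longrightarrow> laplacian (f + g) = laplacian f + laplacian g"
  by (rule ext) (simp add: laplacian_def partial_plus rpf_partial sum.distrib)

lemma laplacian_scale: "rpf f \<Longrightarrow> laplacian (c *\<^sub>R f) = c *\<^sub>R laplacian f"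
  by (rule ext) (simp add: laplacian_def partial_cmult rpf_partial scaleR_fun_def sum_distrib_left)

lemma linear_on_rpf_sum:
  fixes T :: "(real ^ 'd \<Rightarrow> real) \<Rightarrow> real ^ 'd \<Rightarrow> real"
  assumes "\<And>f g. rpf f \<Longrightarrow> rpf g \<Longrightarrow> T (f + g) = T f + T g" "\<And>f c. rpf f \<Longrightarrow> T (c *\<^sub>R f) = c *\<^sub>R T f"
    and "\<And>i. i \<in> I \<Longrightarrow> rpf (f i)" "finite I"
  shows "T (\<Sum>i\<in>I. c i *\<^sub>R f i) = (\<Sum>i\<in>I. c i *\<^sub>R T (f i))"
  using assms(4,3)
proof (induction I)
  case empty
  then show ?case using assms(2)[OF rpf_zero, of 0] by (simp only: scaleR_zero_left sum.empty)
next
  case (insert i I)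
  have "T (\<Sum>i\<in>insert i I. c i *\<^sub>R f i) = T (c i *\<^sub>R f i + (\<Sum>i\<in>I. c i *\<^sub>R f i))"
    by (simp only: sum.insert[OF insert.hyps])
  also have "\<dots> = T (c i *\<^sub>R f i) + T (\<Sum>i\<in>I. c i *\<^sub>R f i)"
    by (rule assms(1)) (use insert.prems in \<open>auto intro: rpf_scale rpf_sum_scale\<close>)
  also have "\<dots> = c i *\<^sub>R T (f i) + (\<Sum>i\<in>I. c i *\<^sub>R T (f i))"
    using insert.IH insert.prems assms(2) by simp
  finally show ?case by (simp only: sum.insert[OF insert.hyps])
qed

lemma laplacian_mult:
  assumes "rpf f" "rpf g"
  shows "laplacian (\<lambda>x. f x * g x) x
    = f x * laplacian g x + 2 * (\<Sum>j\<in>UNIV. partial j f x * partial j g x) + laplacian f x * g x"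
proof -
  have "partial j (partial j (\<lambda>x. f x * g x)) x
      = f x * partial j (partial j g) x + 2 * (partial j f x * partial j g x) + partial j (partial j f) x * g x" for j
    using assms by (simp add: partial_mult partial_add rpf_partial rpf_intros(4))
  then show ?thesis by (simp add: laplacian_def sum.distrib sum_distrib_left sum_distrib_right)
qed

lemma partial_sqnorm: "partial (j :: 'd::finite) sqnorm = (\<lambda>x. 2 * vec_nth x j)"
proof
  fix x :: "real ^ 'd"
  have "((\<lambda>x :: real ^ 'd. inner x x) has_derivative (\<lambda>h. inner x h + inner h x)) (at x)"
    by (rule has_derivative_inner) auto
  then have "partial j (\<lambda>x :: real ^ 'd. inner x x) x = inner x (axis j 1) + inner (axis j 1) x" by (rule partial_eqI)
  then show "partial j sqnorm x = 2 * vec_nth x j"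
    by (simp add: power2_norm_eq_inner inner_axis inner_commute)
qed

lemma laplacian_sqnorm: "laplacian sqnorm (x :: real ^ 'd) = 2 * real CARD('d)"
proof -
  have "partial j (\<lambda>x. 2 * vec_nth x j) x = 2" for j and x :: "real ^ 'd"
  proof -
    have "bounded_linear (\<lambda>x :: real ^ 'd. 2 * vec_nth x j)"
      by (intro bounded_linear_mult_right[THEN bounded_linear_compose] bounded_linear_vec_nth)
    then show ?thesis by (simp add: partial_linear)
  qed
  then show ?thesis by (simp add: laplacian_def partial_sqnorm)
qed

lemma laplacian_sqnorm_mult:
  assumes "rpf g"
  shows "laplacian (\<lambda>x :: real ^ 'd. sqnorm x * g x) x
    = sqnorm x * laplacian g x + 4 * euler g x + 2 * real CARD('d) * g x"
  unfolding laplacian_mult[OF rpf_sqnorm assms] laplacian_sqnorm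
  by (simp add: partial_sqnorm euler_def sum_distrib_left mult_ac)

section \<open>Homogeneous polynomials\<close>

definition homog :: "nat \<Rightarrow> (real ^ 'd \<Rightarrow> real) set" where
  "homog n = {f. rpf f \<and> (\<forall>c x. f (c *\<^sub>R x) = c ^ n * f x)}"

lemma harm_eq: "harm n = {f \<in> homog n. laplacian f = 0}"
  by (auto simp: harm_def homog_def zero_fun_def)

lemma homog_subspace: "subspace (homog n)"
  by (intro subspaceI) (auto simp: homog_def rpf_plus rpf_scale rpf_zero scaleR_fun_def distrib_left)

lemma homog_mult: "f \<in> homog m \<Longrightarrow> g \<in> homog n \<Longrightarrow> (\<lambda>x. f x * g x) \<in> homog (m + n)"
  by (auto simp: homog_def power_add)

lemma sqnorm_homog: "sqnorm \<in> homog 2"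
  by (auto simp: homog_def rpf_sqnorm power_mult_distrib)

lemma sqnorm_power_homog: "(\<lambda>x. sqnorm x ^ l) \<in> homog (2 * l)"
proof (induction l)
  case 0
  then show ?case by (auto simp: homog_def)
next
  case (Suc l)
  then show ?case using homog_mult[OF sqnorm_homog Suc] by simp
qed

lemma frechet_sum:
  fixes f :: "real ^ 'd \<Rightarrow> real"
  assumes "rpf f"
  shows "(\<Sum>j\<in>UNIV. vec_nth h j * partial j f x) = frechet_derivative f (at x) h"
proof -
  have "linear (frechet_derivative f (at x))"
    using rpf_has_derivative[OF assms] by (rule has_derivative_linear)
  then have "frechet_derivative f (at x) (\<Sum>j\<in>UNIV. vec_nth h j *\<^sub>R axis j 1) = (\<Sum>j\<in>UNIV. vec_nth h j * partial j f x)"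
    by (simp add: linear_sum linear_scale partial_def)
  moreover have "(\<Sum>j\<in>UNIV. vec_nth h j *\<^sub>R axis j 1) = h"
    using basis_expansion[of h] by (simp add: scalar_mult_eq_scaleR)
  ultimately show ?thesis by simp
qed

lemma euler_homog:
  fixes f :: "real ^ 'd \<Rightarrow> real"
  assumes "f \<in> homog n"
  shows "euler f = real n *\<^sub>R f"
proof
  fix x :: "real ^ 'd"
  have f: "rpf f" "\<And>c x. f (c *\<^sub>R x) = c ^ n * f x" using assms by (auto simp: homog_def)
  have 1: "((\<lambda>c. c *\<^sub>R x) has_derivative (\<lambda>h. h *\<^sub>R x)) (at (1::real))"
    by (auto intro!: derivative_eq_intros)
  have "(f has_derivative frechet_derivative f (at x)) (at (1 *\<^sub>R x))" using rpf_has_derivative[OF f(1)] by simp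
  from has_derivative_compose[OF 1 this]
  have "((\<lambda>c. c ^ n * f x) has_derivative (\<lambda>h. frechet_derivative f (at x) (h *\<^sub>R x))) (at 1)" by (simp add: f(2))
  moreover have "((\<lambda>c. c ^ n * f x) has_derivative (\<lambda>h. h * (real n * f x))) (at 1)"
    by (auto intro!: derivative_eq_intros)
  ultimately have "(\<lambda>h. frechet_derivative f (at x) (h *\<^sub>R x)) = (\<lambda>h. h * (real n * f x))"
    by (rule has_derivative_unique)
  then have "frechet_derivative f (at x) (1 *\<^sub>R x) = 1 * (real n * f x)" by (rule fun_cong)
  then show "euler f x = (real n *\<^sub>R f) x"
    unfolding euler_def frechet_sum[OF f(1)] by (simp add: scaleR_fun_def)
qed

lemma partial_dilate:
  assumes "rpf f"
  shows "partial j (\<lambda>x. f (c *\<^sub>R x)) x = c * partial j f (c *\<^sub>R x)"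
proof -
  have 1: "((\<lambda>x. c *\<^sub>R x) has_derivative (\<lambda>h. c *\<^sub>R h)) (at x)" by (auto intro!: derivative_eq_intros)
  have "partial j (\<lambda>x. f (c *\<^sub>R x)) x = frechet_derivative f (at (c *\<^sub>R x)) (c *\<^sub>R axis j 1)"
    by (rule partial_eqI[OF has_derivative_compose[OF 1 rpf_has_derivative[OF assms]]])
  then show ?thesis
    using has_derivative_linear[OF rpf_has_derivative[OF assms, of "c *\<^sub>R x"]] by (simp add: linear_scale partial_def)
qed

lemma partial_scaled:
  assumes "rpf f" "\<And>x. b * f (c *\<^sub>R x) = e * f x"
  shows "b * c * partial j f (c *\<^sub>R x) = e * partial j f x"
proof -
  have r: "rpf (\<lambda>x. f (c *\<^sub>R x))"
    using real_polynomial_function_compose[of "\<lambda>x. c *\<^sub>R x" f] assms(1)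
    by (simp add: comp_def polynomial_function_bounded_linear bounded_linear_scaleR_right)
  have "b *\<^sub>R (\<lambda>x. f (c *\<^sub>R x)) = e *\<^sub>R f" using assms(2) by (auto simp: scaleR_fun_def)
  then have "b *\<^sub>R partial j (\<lambda>x. f (c *\<^sub>R x)) = e *\<^sub>R partial j f"
    using partial_scale[OF r, of j b] partial_scale[OF assms(1), of j e] by metis
  then have "(b *\<^sub>R partial j (\<lambda>x. f (c *\<^sub>R x))) x = (e *\<^sub>R partial j f) x" by (rule fun_cong)
  then show ?thesis by (simp add: scaleR_fun_def partial_dilate[OF assms(1)])
qed

text \<open>Each derivative of \<open>f(c x) = c\<^sup>n f(x)\<close> brings out one factor \<open>c\<close>.\<close>

lemma laplacian_dilate:
  assumes "f \<in> homog n"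
  shows "c ^ 2 * laplacian f (c *\<^sub>R x) = c ^ n * laplacian f x"
proof -
  have f: "rpf f" "\<And>x. 1 * f (c *\<^sub>R x) = c ^ n * f x" using assms by (auto simp: homog_def)
  have "1 * c * partial j f (c *\<^sub>R x) = c ^ n * partial j f x" for j x by (rule partial_scaled[OF f])
  then have "1 * c * c * partial j (partial j f) (c *\<^sub>R x) = c ^ n * partial j (partial j f) x" for j x
    by (rule partial_scaled[OF rpf_partial[OF f(1)]])
  then show ?thesis by (simp add: laplacian_def sum_distrib_left power2_eq_square)
qed

lemma continuous_eq_at_0:
  fixes F G :: "real \<Rightarrow> real"
  assumes "continuous_on UNIV F" "continuous_on UNIV G" "\<And>c. c \<noteq> 0 \<Longrightarrow> F c = G c"
  shows "F 0 = G 0"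
proof -
  have "(F \<longlongrightarrow> F 0) (at 0)" "(G \<longlongrightarrow> G 0) (at 0)"
    using assms(1,2) by (auto simp: continuous_on_def)
  moreover have "(F \<longlongrightarrow> G 0) (at 0)"
    by (rule Lim_transform_eventually[OF \<open>(G \<longlongrightarrow> G 0) (at 0)\<close>]) (use assms(3) in \<open>auto simp: eventually_at_filter\<close>)
  ultimately show ?thesis using tendsto_unique[of "at (0::real)" F] by auto
qed

lemma continuous_on_rpf: "rpf f \<Longrightarrow> continuous_on UNIV f"
  using rpf_differentiable differentiable_imp_continuous_within by (fastforce simp: continuous_on_eq_continuous_within)

lemma continuous_on_rpf_ray: "rpf f \<Longrightarrow> continuous_on UNIV (\<lambda>c. f (c *\<^sub>R x))"
  by (rule continuous_on_compose2[OF continuous_on_rpf]) (auto intro: continuous_intros)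

text \<open>Dividing \<open>laplacian_dilate\<close> by \<open>c\<^sup>2\<close> gives the claim for \<open>c \<noteq> 0\<close>; both sides are continuous in \<open>c\<close>.\<close>

lemma laplacian_homog:
  assumes "f \<in> homog (n + 2)"
  shows "laplacian f \<in> homog n"
proof -
  have r: "rpf (laplacian f)" using assms by (auto simp: homog_def intro: rpf_laplacian)
  have off: "laplacian f (c *\<^sub>R x) = c ^ n * laplacian f x" if "c \<noteq> 0" for c x
  proof -
    have "c ^ 2 * laplacian f (c *\<^sub>R x) = c ^ 2 * (c ^ n * laplacian f x)"
      using laplacian_dilate[OF assms, of c x] by (simp only: power_add mult_ac)
    then show ?thesis using that by (simp only: mult_cancel_left power_eq_0_iff) simp
  qed
  have "laplacian f (0 *\<^sub>R x) = 0 ^ n * laplacian f x" for x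
    by (rule continuous_eq_at_0[of "\<lambda>c. laplacian f (c *\<^sub>R x)" "\<lambda>c. c ^ n * laplacian f x"])
       (auto intro!: continuous_on_rpf_ray r continuous_intros off)
  then have "laplacian f (c *\<^sub>R x) = c ^ n * laplacian f x" for c x using off by (cases "c = 0") simp_all
  then show ?thesis using r by (auto simp: homog_def)
qed

lemma laplacian_homog_low:
  assumes "f \<in> homog n" "n < 2"
  shows "laplacian f = 0"
proof
  fix x
  have r: "rpf (laplacian f)" using assms by (auto simp: homog_def intro: rpf_laplacian)
  have off: "c ^ (2 - n) * laplacian f (c *\<^sub>R x) = laplacian f x" if "c \<noteq> 0" for c
  proof -
    have "c ^ 2 = c ^ n * c ^ (2 - n)" using assms(2) by (simp flip: power_add)
    then show ?thesis using laplacian_dilate[OF assms(1), of c x] that by simp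
  qed
  have "0 ^ (2 - n) * laplacian f (0 *\<^sub>R x) = laplacian f x"
    by (rule continuous_eq_at_0[of "\<lambda>c. c ^ (2 - n) * laplacian f (c *\<^sub>R x)" "\<lambda>c. laplacian f x"])
       (auto intro!: continuous_on_rpf_ray r continuous_intros off)
  moreover have "(0::real) ^ (2 - n) = 0" using assms(2) by simp
  ultimately show "laplacian f x = 0 x" by simp
qed

text \<open>Induction with \<open>\<Delta>(\<parallel>x\<parallel>\<^sup>2 g) = \<parallel>x\<parallel>\<^sup>2 \<Delta>g + (4 m + 2 d) g\<close> for \<open>g\<close> homogeneous of degree \<open>m\<close>;
  the term \<open>4 m g\<close> is Euler's identity.\<close>

lemma laplacian_radial_harmonic:
  fixes h :: "real ^ 'd \<Rightarrow> real"
  assumes "h \<in> harm s"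
  shows "laplacian (\<lambda>x. sqnorm x ^ l * h x) x
    = 4 * real l * (real l + real s + real CARD('d) / 2 - 1) * (sqnorm x ^ (l - 1) * h x)"
proof (induction l arbitrary: x)
  case 0
  then show ?case using assms by (simp add: harm_eq)
next
  case (Suc l)
  have homog: "(\<lambda>x. sqnorm x ^ l * h x) \<in> homog (2 * l + s)"
    using homog_mult[OF sqnorm_power_homog] assms by (auto simp: harm_eq)
  then have r: "rpf (\<lambda>x. sqnorm x ^ l * h x)" by (simp add: homog_def)
  have "laplacian (\<lambda>x. sqnorm x ^ Suc l * h x) x = laplacian (\<lambda>x. sqnorm x * (sqnorm x ^ l * h x)) x"
    by (simp only: power_Suc mult.assoc)
  also have "\<dots> = sqnorm x * (4 * real l * (real l + real s + real CARD('d) / 2 - 1) * (sqnorm x ^ (l - 1) * h x))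
      + 4 * (real (2 * l + s) * (sqnorm x ^ l * h x)) + 2 * real CARD('d) * (sqnorm x ^ l * h x)"
    unfolding laplacian_sqnorm_mult[OF r] Suc.IH euler_homog[OF homog] by (simp add: scaleR_fun_def)
  also have "sqnorm x * (4 * real l * (real l + real s + real CARD('d) / 2 - 1) * (sqnorm x ^ (l - 1) * h x))
      = 4 * real l * (real l + real s + real CARD('d) / 2 - 1) * (sqnorm x ^ l * h x)"
    by (cases l) simp_all
  finally show ?case by (simp add: algebra_simps)
qed

section \<open>Radial multiples of harmonic polynomials\<close>

definition solid :: "real \<Rightarrow> (real ^ 'd \<Rightarrow> real) \<Rightarrow> nat \<Rightarrow> real ^ 'd \<Rightarrow> real" where
  "solid \<gamma> h l = (\<lambda>x. hyp_term \<gamma> l (sqnorm x) * h x)"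

lemma solid_eq: "solid \<gamma> h l = (1 / (pochhammer (\<gamma> + 1) l * fact l)) *\<^sub>R (\<lambda>x. sqnorm x ^ l * h x)"
  by (rule ext) (simp add: solid_def hyp_term_def scaleR_fun_def)

lemma combo_solid: "combo (solid \<gamma> h) L v x = combo (hyp_term \<gamma>) L v (sqnorm x) * h x"
  by (simp add: combo_def solid_def sum_fun_app scaleR_fun_def sum_distrib_right mult.assoc)

lemma radial_homog:
  assumes "h \<in> harm s"
  shows "(\<lambda>x. sqnorm x ^ l * h x) \<in> homog (2 * l + s)"
  using homog_mult[OF sqnorm_power_homog] assms by (auto simp: harm_eq)

lemma solid_homog: "h \<in> harm s \<Longrightarrow> solid \<gamma> h l \<in> homog (2 * l + s)"
  unfolding solid_eq using subspace_scale[OF homog_subspace] radial_homog by blast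

lemma rpf_solid: "h \<in> harm s \<Longrightarrow> rpf (solid \<gamma> h l)"
  using solid_homog[of h s \<gamma> l] by (simp add: homog_def)

lemma laplacian_solid:
  fixes h :: "real ^ 'd \<Rightarrow> real"
  assumes "h \<in> harm s" "\<gamma> = real CARD('d) / 2 - 1 + real s"
  shows "laplacian (solid \<gamma> h 0) = 0" "laplacian (solid \<gamma> h (Suc l)) = 4 *\<^sub>R solid \<gamma> h l"
proof -
  have r: "rpf (\<lambda>x. sqnorm x ^ l * h x)" for l using radial_homog[OF assms(1)] by (simp add: homog_def)
  show "laplacian (solid \<gamma> h 0) = 0"
    unfolding solid_eq laplacian_scale[OF r]
    by (rule ext) (simp add: scaleR_fun_def laplacian_radial_harmonic[OF assms(1), of 0, simplified])
  have "real CARD('d) > 0" by simp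
  then have pos: "\<gamma> + 1 > 0" using assms(2) by linarith
  show "laplacian (solid \<gamma> h (Suc l)) = 4 *\<^sub>R solid \<gamma> h l"
  proof
    fix x
    let ?a = "\<lambda>l. pochhammer (\<gamma> + 1) l * fact l :: real"
    have a: "?a (Suc l) = (real l + \<gamma> + 1) * real (Suc l) * ?a l"
      by (simp add: pochhammer_Suc algebra_simps)
    have nz: "real l + \<gamma> + 1 \<noteq> 0" "?a l \<noteq> 0" using pos pochhammer_pos[OF pos, of l] by auto
    have "laplacian (solid \<gamma> h (Suc l)) = (1 / ?a (Suc l)) *\<^sub>R laplacian (\<lambda>x. sqnorm x ^ Suc l * h x)"
      by (simp only: solid_eq laplacian_scale[OF r])
    then have "laplacian (solid \<gamma> h (Suc l)) x = 1 / ?a (Suc l) * laplacian (\<lambda>x. sqnorm x ^ Suc l * h x) x"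
      by (simp only: scaleR_fun_def real_scaleR_def)
    also have "laplacian (\<lambda>x. sqnorm x ^ Suc l * h x) x = 4 * real (Suc l) * (real l + \<gamma> + 1) * (sqnorm x ^ l * h x)"
      using laplacian_radial_harmonic[OF assms(1), of "Suc l" x] by (simp add: assms(2) add_ac)
    also have "1 / ?a (Suc l) * (4 * real (Suc l) * (real l + \<gamma> + 1) * (sqnorm x ^ l * h x)) = (4 *\<^sub>R solid \<gamma> h l) x"
    proof -
      have cancel: "1 / (A * B * C) * (4 * B * A * X) = 4 * (1 / C * X)" if "A \<noteq> 0" "B \<noteq> 0" for A B C X :: real
        using that by simp
      show ?thesis
        unfolding a solid_eq scaleR_fun_def real_scaleR_def by (rule cancel[OF nz(1)]) simp
    qed
    finally show "laplacian (solid \<gamma> h (Suc l)) x = (4 *\<^sub>R solid \<gamma> h l) x" .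
  qed
qed

text \<open>The same commutation relations as in one variable: with \<open>\<gamma> = \<beta> + s\<close> the denominators \<open>(\<gamma> + 1)\<^sub>l l!\<close> absorb the factors
  of \<open>laplacian_radial_harmonic\<close>, and the degree \<open>2 l + s\<close> produces the offset \<open>s / 2\<close>.\<close>

lemma ladder_solid:
  fixes h :: "real ^ 'd \<Rightarrow> real"
  assumes "h \<in> harm s" "\<gamma> = real CARD('d) / 2 - 1 + real s"
  shows "ladder (real s / 2) (\<lambda>g. (1/2) *\<^sub>R euler g) (\<lambda>g. (1/4) *\<^sub>R laplacian g) (solid \<gamma> h)"
  unfolding ladder_def
proof (intro conjI allI impI)
  fix L v
  have "euler (combo (solid \<gamma> h) L v) = (\<Sum>l\<le>L. v l *\<^sub>R euler (solid \<gamma> h l))"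
    unfolding combo_def by (rule linear_on_rpf_sum) (rule euler_plus euler_scale rpf_solid[OF assms(1)] finite_atMost | assumption)+
  also have "\<dots> = (\<Sum>l\<le>L. v l *\<^sub>R (real (2 * l + s) *\<^sub>R solid \<gamma> h l))"
    by (simp only: euler_homog[OF solid_homog[OF assms(1)]])
  finally show "(1/2) *\<^sub>R euler (combo (solid \<gamma> h) L v) = combo (solid \<gamma> h) L (\<lambda>l. (real l + real s / 2) * v l)"
    unfolding combo_def by (simp only: scaleR_sum_right scaleR_scaleR) (intro sum.cong refl arg_cong2[of _ _ _ _ scaleR]; simp add: field_simps)
  assume v: "v (Suc L) = 0"
  have "laplacian (combo (solid \<gamma> h) L v) = (\<Sum>l\<le>L. v l *\<^sub>R laplacian (solid \<gamma> h l))"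
    unfolding combo_def by (rule linear_on_rpf_sum) (rule laplacian_plus laplacian_scale rpf_solid[OF assms(1)] finite_atMost | assumption)+
  also have "\<dots> = (\<Sum>l\<le>L. v (Suc l) *\<^sub>R laplacian (solid \<gamma> h (Suc l)))"
    by (rule sum_shift_down) (simp_all only: laplacian_solid[OF assms] v scaleR_zero_right scaleR_zero_left)
  finally show "(1/4) *\<^sub>R laplacian (combo (solid \<gamma> h) L v) = combo (solid \<gamma> h) L (\<lambda>l. v (Suc l))"
    unfolding combo_def by (simp only: laplacian_solid[OF assms] scaleR_sum_right scaleR_scaleR) (intro sum.cong refl arg_cong2[of _ _ _ _ scaleR]; simp)
qed

section \<open>Fischer decomposition\<close>

definition radials :: "nat \<Rightarrow> (real ^ 'd \<Rightarrow> real) set" where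
  "radials n = {\<lambda>x. sqnorm x ^ l * h x | l s h. h \<in> harm s \<and> 2 * l + s = n}"

lemma span_radials_homog: "span (radials n) \<subseteq> homog n"
  by (rule span_minimal[OF _ homog_subspace]) (auto simp: radials_def radial_homog)

lemma fun_mult_plus: "(\<lambda>x. r x * (f + g) x) = (\<lambda>x. r x * f x) + (\<lambda>x. r x * g x)" for r f g :: "'a \<Rightarrow> real"
  by (simp add: fun_eq_iff distrib_left)

lemma fun_mult_scale: "(\<lambda>x. r x * (c *\<^sub>R f) x) = c *\<^sub>R (\<lambda>x. r x * f x)" for r f :: "'a \<Rightarrow> real"
  by (simp add: fun_eq_iff scaleR_fun_def)

lemma fun_mult_zero: "(\<lambda>x. r x * (0 :: 'a \<Rightarrow> real) x) = 0" for r :: "'a \<Rightarrow> real"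
  by (simp add: fun_eq_iff)

lemma subspace_mult_preimage:
  fixes r :: "'a \<Rightarrow> real"
  shows "subspace {f. (\<lambda>x. r x * f x) \<in> span W}"
  by (rule subspaceI) (simp_all only: mem_Collect_eq fun_mult_plus fun_mult_scale fun_mult_zero span_zero span_add span_scale)

lemma sqnorm_mult_radials:
  fixes u :: "real ^ 'd \<Rightarrow> real"
  assumes "u \<in> span (radials n)"
  shows "(\<lambda>x. sqnorm x * u x) \<in> span (radials (n + 2))"
proof -
  have "(radials n :: (real ^ 'd \<Rightarrow> real) set) \<subseteq> {f. (\<lambda>x. sqnorm x * f x) \<in> span (radials (n + 2))}"
  proof
    fix f :: "real ^ 'd \<Rightarrow> real" assume "f \<in> radials n"
    then obtain l s h where f: "f = (\<lambda>x. sqnorm x ^ l * h x)" "h \<in> harm s" "2 * l + s = n" by (auto simp: radials_def)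
    have "(\<lambda>x. sqnorm x * f x) = (\<lambda>x. sqnorm x ^ Suc l * h x)" by (simp add: f(1) mult.assoc)
    moreover have "\<dots> \<in> radials (n + 2)" unfolding radials_def using f(2,3) by (intro CollectI exI[of _ "Suc l"] exI[of _ s] exI[of _ h]) auto
    ultimately show "f \<in> {f. (\<lambda>x. sqnorm x * f x) \<in> span (radials (n + 2))}" using span_base by auto
  qed
  then have "(span (radials n) :: (real ^ 'd \<Rightarrow> real) set) \<subseteq> {f. (\<lambda>x. sqnorm x * f x) \<in> span (radials (n + 2))}"
    by (rule span_minimal[OF _ subspace_mult_preimage])
  then show ?thesis using assms by blast
qed

text \<open>On each generator \<open>\<parallel>x\<parallel>\<^bsup>2l\<^esup> h\<close> the map \<open>u \<mapsto> \<Delta>(\<parallel>x\<parallel>\<^sup>2 u)\<close> is multiplication by a positive number.\<close>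

lemma laplacian_sqnorm_surj:
  fixes q :: "real ^ 'd \<Rightarrow> real"
  assumes "q \<in> span (radials n)"
  shows "\<exists>u\<in>span (radials n). laplacian (\<lambda>x. sqnorm x * u x) = q"
proof -
  let ?V = "{q :: real ^ 'd \<Rightarrow> real. \<exists>u\<in>span (radials n). laplacian (\<lambda>x. sqnorm x * u x) = q}"
  have r: "rpf (\<lambda>x. sqnorm x * u x)" if "u \<in> span (radials n)" for u :: "real ^ 'd \<Rightarrow> real"
    using that span_radials_homog rpf_sqnorm by (intro rpf_intros(4)) (auto simp: homog_def)
  have "subspace ?V"
  proof (rule subspaceI)
    have "laplacian (\<lambda>x :: real ^ 'd. sqnorm x * (0 :: real ^ 'd \<Rightarrow> real) x) = 0"
      unfolding fun_mult_zero using laplacian_scale[OF rpf_zero, of 0] by (simp only: scaleR_zero_left)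
    then show "0 \<in> ?V" using span_zero by blast
  next
    fix f g :: "real ^ 'd \<Rightarrow> real" assume "f \<in> ?V" "g \<in> ?V"
    then obtain u w where u: "u \<in> span (radials n)" "laplacian (\<lambda>x. sqnorm x * u x) = f"
      and w: "w \<in> span (radials n)" "laplacian (\<lambda>x. sqnorm x * w x) = g" by blast
    have "laplacian (\<lambda>x. sqnorm x * (u + w) x) = f + g"
      unfolding fun_mult_plus laplacian_plus[OF r[OF u(1)] r[OF w(1)]] u(2) w(2) ..
    then show "f + g \<in> ?V" using span_add[OF u(1) w(1)] by blast
  next
    fix c and f :: "real ^ 'd \<Rightarrow> real" assume "f \<in> ?V"
    then obtain u where u: "u \<in> span (radials n)" "laplacian (\<lambda>x. sqnorm x * u x) = f" by blast
    have "laplacian (\<lambda>x. sqnorm x * (c *\<^sub>R u) x) = c *\<^sub>R f"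
      unfolding fun_mult_scale laplacian_scale[OF r[OF u(1)]] u(2) ..
    then show "c *\<^sub>R f \<in> ?V" using span_scale[OF u(1)] by blast
  qed
  moreover have "radials n \<subseteq> ?V"
  proof
    fix f :: "real ^ 'd \<Rightarrow> real" assume f: "f \<in> radials n"
    then obtain l s h where h: "f = (\<lambda>x. sqnorm x ^ l * h x)" "h \<in> harm s" "2 * l + s = n" by (auto simp: radials_def)
    define b where "b = 4 * real (Suc l) * (real (Suc l) + real s + real CARD('d) / 2 - 1)"
    have "real CARD('d) > 0" by simp
    then have "real (Suc l) + real s + real CARD('d) / 2 - 1 > 0" by linarith
    then have b: "b \<noteq> 0" by (simp add: b_def del: of_nat_Suc)
    have "laplacian (\<lambda>x. sqnorm x * f x) = b *\<^sub>R f"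
    proof
      fix x
      have "laplacian (\<lambda>x. sqnorm x * f x) x = laplacian (\<lambda>x. sqnorm x ^ Suc l * h x) x"
        by (simp only: h(1) power_Suc mult.assoc)
      then show "laplacian (\<lambda>x. sqnorm x * f x) x = (b *\<^sub>R f) x"
        unfolding laplacian_radial_harmonic[OF h(2)] by (simp add: scaleR_fun_def h(1) b_def)
    qed
    then have "laplacian (\<lambda>x. sqnorm x * ((1 / b) *\<^sub>R f) x) = f"
      unfolding fun_mult_scale laplacian_scale[OF r[OF span_base[OF f]]] using b by (simp only: scaleR_scaleR) simp
    then show "f \<in> ?V" using span_scale[OF span_base[OF f]] by blast
  qed
  ultimately have "span (radials n) \<subseteq> ?V" by (intro span_minimal)
  then show ?thesis using assms by blast
qed

text \<open>By induction \<open>\<Delta>p\<close> is a combination of the generators, hence of the form \<open>\<Delta>(\<parallel>x\<parallel>\<^sup>2 u)\<close>; then \<open>p - \<parallel>x\<parallel>\<^sup>2 u\<close> is harmonic.\<close>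

theorem fischer_decomposition:
  fixes p :: "real ^ 'd \<Rightarrow> real"
  assumes "p \<in> homog n"
  shows "p \<in> span (radials n)"
  using assms
proof (induction n arbitrary: p rule: less_induct)
  case (less n)
  have harm: "h \<in> span (radials n)" if "h \<in> harm n" for h :: "real ^ 'd \<Rightarrow> real"
  proof (rule span_base)
    show "h \<in> radials n" unfolding radials_def using that by (intro CollectI exI[of _ 0] exI[of _ n] exI[of _ h]) simp
  qed
  show ?case
  proof (cases "n < 2")
    case True
    then show ?thesis using less.prems laplacian_homog_low by (intro harm) (auto simp: harm_eq)
  next
    case False
    then obtain m where n: "n = m + 2" by (metis add.commute le_Suc_ex not_less)
    have "laplacian p \<in> span (radials m)" using less laplacian_homog[of p m] n by simp
    then obtain u where u: "u \<in> span (radials m)" "laplacian (\<lambda>x. sqnorm x * u x) = laplacian p"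
      using laplacian_sqnorm_surj by blast
    let ?w = "\<lambda>x. sqnorm x * u x"
    have w: "?w \<in> span (radials n)" using sqnorm_mult_radials[OF u(1)] n by simp
    then have wh: "?w \<in> homog n" using span_radials_homog by blast
    have r: "rpf p" "rpf ?w" using less.prems wh by (auto simp: homog_def)
    let ?h = "p + (-1) *\<^sub>R ?w"
    have "laplacian ?h = laplacian p + (-1) *\<^sub>R laplacian ?w"
      by (simp only: laplacian_plus[OF r(1) rpf_scale[OF r(2)]] laplacian_scale[OF r(2)])
    also have "\<dots> = 0" unfolding u(2) by (simp only: scaleR_minus1_left add.right_inverse)
    finally have "?h \<in> harm n"
      unfolding harm_eq using subspace_add[OF homog_subspace less.prems subspace_scale[OF homog_subspace wh]] by blast
    then have "?h + ?w \<in> span (radials n)" by (rule span_add[OF harm w])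
    moreover have "?h + ?w = p" by (simp add: fun_eq_iff scaleR_fun_def)
    ultimately show ?thesis by simp
  qed
qed

lemma rpf_homogeneous_parts:
  fixes p :: "real ^ 'd \<Rightarrow> real"
  assumes "rpf p"
  shows "p \<in> span (\<Union>n. homog n)"
  using assms
proof induction
  case (linear f)
  then have "f \<in> homog 1"
    using linear_scale[OF bounded_linear.linear[OF linear]] by (auto simp: homog_def intro: rpf_intros)
  then show ?case by (intro span_base) blast
next
  case (const c)
  have "(\<lambda>x. c) \<in> homog 0" by (auto simp: homog_def)
  then show ?case by (intro span_base) blast
next
  case (add f g)
  have "f + g \<in> span (\<Union>n. homog n)" by (rule span_add[OF add.IH])
  then show ?case by (simp only: plus_fun_def)
next
  case (mult f g)
  let ?H = "\<Union>n. homog n :: (real ^ 'd \<Rightarrow> real) set"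
  have step: "(\<lambda>x. f x * g x) \<in> span ?H"
    if f: "f \<in> homog m" and g: "g \<in> span ?H" for f g :: "real ^ 'd \<Rightarrow> real" and m
  proof -
    have "?H \<subseteq> {g. (\<lambda>x. f x * g x) \<in> span ?H}"
    proof
      fix w :: "real ^ 'd \<Rightarrow> real" assume "w \<in> ?H"
      then obtain n where "w \<in> homog n" by (rule UN_E)
      then have "(\<lambda>x. f x * w x) \<in> ?H" by (intro UN_I[of "m + n"] UNIV_I homog_mult[OF f])
      then show "w \<in> {g. (\<lambda>x. f x * g x) \<in> span ?H}" by (intro CollectI span_base)
    qed
    from subsetD[OF span_minimal[OF this subspace_mult_preimage] g] show ?thesis by (rule CollectD)
  qed
  have comm: "(\<lambda>x. g x * w x) = (\<lambda>x. w x * g x)" for w :: "real ^ 'd \<Rightarrow> real"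
    by (rule ext) (rule mult.commute)
  have "?H \<subseteq> {w. (\<lambda>x. g x * w x) \<in> span ?H}"
  proof
    fix w :: "real ^ 'd \<Rightarrow> real" assume "w \<in> ?H"
    then obtain n where "w \<in> homog n" by (rule UN_E)
    from step[OF this mult.IH(2)] show "w \<in> {w. (\<lambda>x. g x * w x) \<in> span ?H}"
      by (intro CollectI) (simp only: comm)
  qed
  from CollectD[OF subsetD[OF span_minimal[OF this subspace_mult_preimage] mult.IH(1)]]
  show ?case by (simp only: comm)
qed

section \<open>Linearly independent families\<close>

lemma independent_familyI:
  fixes v :: "'i \<Rightarrow> 'v::real_vector"
  assumes "\<And>T c. finite T \<Longrightarrow> T \<subseteq> I \<Longrightarrow> (\<Sum>t\<in>T. c t *\<^sub>R v t) = 0 \<Longrightarrow> \<forall>t\<in>T. c t = 0"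
  shows "inj_on v I \<and> independent (v ` I)"
proof
  show inj: "inj_on v I"
  proof (rule inj_onI, rule ccontr)
    fix s t assume st: "s \<in> I" "t \<in> I" "v s = v t" "s \<noteq> t"
    have "(\<Sum>r\<in>{s, t}. (if r = s then 1 else - 1) *\<^sub>R v r) = 0" using st by simp
    then have "\<forall>r\<in>{s, t}. (if r = s then 1 else - 1 :: real) = 0" by (intro assms) (use st in auto)
    then show False by simp
  qed
  show "independent (v ` I)"
    unfolding independent_explicit_finite_subsets
  proof (intro allI impI ballI)
    fix S u w assume S: "S \<subseteq> v ` I" "finite S" "(\<Sum>w\<in>S. u w *\<^sub>R w) = 0" "w \<in> S"
    obtain T where T: "T \<subseteq> I" "finite T" "S = v ` T" using finite_subset_image[OF S(2,1)] by blast
    have "(\<Sum>t\<in>T. u (v t) *\<^sub>R v t) = 0"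
      using S(3) unfolding T(3) by (subst (asm) sum.reindex) (use inj_on_subset[OF inj T(1)] in auto)
    then have "\<forall>t\<in>T. u (v t) = 0" by (intro assms T)
    then show "u w = 0" using S(4) T(3) by auto
  qed
qed

lemma independent_familyD:
  fixes v :: "'i \<Rightarrow> 'v::real_vector"
  assumes "inj_on v I" "independent (v ` I)" "finite T" "T \<subseteq> I" "(\<Sum>t\<in>T. c t *\<^sub>R v t) = 0" "t \<in> T"
  shows "c t = 0"
proof -
  have inj: "inj_on v T" using assms(1,4) by (rule inj_on_subset)
  have "(\<Sum>w\<in>v ` T. c (inv_into T v w) *\<^sub>R w) = (\<Sum>t\<in>T. c t *\<^sub>R v t)"
    by (subst sum.reindex[OF inj]) (auto intro!: sum.cong simp: inv_into_f_f[OF inj])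
  then have "c (inv_into T v (v t)) = 0"
    using assms by (intro independentD[OF assms(2), of "v ` T"]) auto
  then show ?thesis using assms(6) by (simp add: inv_into_f_f[OF inj])
qed

text \<open>Along a ray the sum is a polynomial in the radius, whose coefficients are the homogeneous parts.\<close>

lemma homogeneous_sum_zero:
  fixes f :: "'i \<Rightarrow> real ^ 'd \<Rightarrow> real"
  assumes "finite T" "\<And>t. t \<in> T \<Longrightarrow> f t \<in> homog (deg t)" "(\<Sum>t\<in>T. f t) = 0"
  shows "(\<Sum>t\<in>{t\<in>T. deg t = s}. f t) = 0"
proof
  fix x
  define p where "p = (\<Sum>t\<in>T. monom (f t x) (deg t))"
  have "poly p r = 0" for r
  proof -
    have "poly p r = (\<Sum>t\<in>T. f t (r *\<^sub>R x))"
      unfolding p_def poly_sum using assms(2) by (intro sum.cong) (auto simp: poly_monom homog_def)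
    also have "\<dots> = (\<Sum>t\<in>T. f t) (r *\<^sub>R x)" by (simp add: sum_fun_app)
    finally show ?thesis using assms(3) by simp
  qed
  then have "p = 0" using poly_all_0_iff_0 by blast
  then have "0 = Polynomial.coeff p s" by simp
  also have "\<dots> = (\<Sum>t\<in>T. if deg t = s then f t x else 0)" by (simp add: p_def coeff_sum)
  also have "\<dots> = (\<Sum>t\<in>{t\<in>T. deg t = s}. f t x)" by (rule sum.inter_filter[symmetric, OF assms(1)])
  finally show "(\<Sum>t\<in>{t\<in>T. deg t = s}. f t) x = 0 x" by (simp add: sum_fun_app)
qed

section \<open>The polynomials \<open>Q\<close>\<close>

abbreviation harm_index :: "'d::finite itself \<Rightarrow> nat \<Rightarrow> nat set" where
  "harm_index _ s \<equiv> {1..dim (harm s :: (real ^ 'd \<Rightarrow> real) set)}"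

lemma Qfun_expand:
  fixes Y :: "nat \<Rightarrow> nat \<Rightarrow> real ^ 'd \<Rightarrow> real"
  assumes "2 * i \<le> n" "\<beta> = real CARD('d) / 2 - 1"
  defines "s \<equiv> n - 2 * i"
  shows "Qfun k \<alpha> a Y (n, i, j) = combo (solid (\<beta> + real s) (Y s j)) i
    (qseq k (real \<alpha> + \<beta> + 1) (\<lambda>i. poly (psi \<alpha> \<beta> a i)) (real s / 2) (int i))"
  by (rule ext) (simp add: Qfun_def qhat_expand combo_solid assms)

lemma harmonic_basis_harm:
  assumes "harmonic_basis Y" "j \<in> {1..dim (harm s :: (real ^ 'd \<Rightarrow> real) set)}"
  shows "(Y s j :: real ^ 'd \<Rightarrow> real) \<in> harm s"
  using assms span_base[of "Y s j" "Y s ` {1..dim (harm s :: (real ^ 'd \<Rightarrow> real) set)}"]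
  unfolding harmonic_basis_def basis_family_def by blast

lemma Q_index_E:
  assumes "t \<in> Q_index TYPE('d::finite)"
  obtains s i j where "t = (s + 2 * i, i, j)" "j \<in> {1..dim (harm s :: (real ^ 'd \<Rightarrow> real) set)}"
proof -
  obtain n i j where t: "t = (n, i, j)" "2 * i \<le> n" "j \<in> {1..dim (harm (n - 2 * i) :: (real ^ 'd \<Rightarrow> real) set)}"
    using assms by (auto simp: Q_index_def)
  show ?thesis by (rule that[of "n - 2 * i" i j]) (use t in auto)
qed

context
  fixes \<alpha> k :: nat and a :: "nat \<Rightarrow> real" and \<beta> :: real
    and Y :: "nat \<Rightarrow> nat \<Rightarrow> real ^ 'd \<Rightarrow> real"
  assumes \<alpha>: "0 < \<alpha>" and k: "k \<le> \<alpha>"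
    and \<beta>: "\<beta> = real CARD('d) / 2 - 1"
    and Y: "harmonic_basis Y"
begin

abbreviation q :: "nat \<Rightarrow> nat \<Rightarrow> nat \<Rightarrow> real" where
  "q s i \<equiv> qseq k (real \<alpha> + \<beta> + 1) (\<lambda>i. poly (psi \<alpha> \<beta> a i)) (real s / 2) (int i)"

abbreviation X1 :: "(real ^ 'd \<Rightarrow> real) \<Rightarrow> real ^ 'd \<Rightarrow> real" where
  "X1 \<equiv> \<lambda>g. (1/2) *\<^sub>R euler g"

abbreviation X2 :: "(real ^ 'd \<Rightarrow> real) \<Rightarrow> real ^ 'd \<Rightarrow> real" where
  "X2 \<equiv> \<lambda>g. (1/4) *\<^sub>R laplacian g"

lemma \<beta>_gt: "\<beta> > -1"
proof -
  have "real CARD('d) > 0" by simp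
  then show ?thesis using \<beta> by linarith
qed

lemma Q_combo: "Qfun k \<alpha> a Y (s + 2 * i, i, j) = combo (solid (\<beta> + real s) (Y s j)) i (q s i)"
  by (subst Qfun_expand[OF _ \<beta>]) simp_all

lemma Y_harm: "j \<in> harm_index TYPE('d) s \<Longrightarrow> Y s j \<in> harm s"
  using harmonic_basis_harm[OF Y] by blast

lemma ladder_Y: "j \<in> harm_index TYPE('d) s \<Longrightarrow> ladder (real s / 2) X1 X2 (solid (\<beta> + real s) (Y s j))"
  by (rule ladder_solid[OF Y_harm]) (simp_all add: \<beta>)

lemma rpf_Q:
  assumes "t \<in> Q_index TYPE('d)"
  shows "rpf (Qfun k \<alpha> a Y t)"
proof -
  from assms obtain s i j where t: "t = (s + 2 * i, i, j)" "j \<in> harm_index TYPE('d) s" by (rule Q_index_E)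
  show ?thesis unfolding t(1) Q_combo combo_def
    by (intro rpf_sum_scale rpf_solid[OF Y_harm[OF t(2)]])
qed

lemma q_top:
  assumes "\<And>m::nat. poly (tau k \<alpha> \<beta> a) (real m / 2 - 1) \<noteq> 0"
  shows "q s i i \<noteq> 0"
proof -
  have half: "real i + real s / 2 - 1 = real (2 * i + s) / 2 - 1" by simp
  have "casoratian k (\<lambda>i. poly (psi \<alpha> \<beta> a i)) (real i + real s / 2 - 1) \<noteq> 0"
    unfolding half poly_tau[symmetric] by (rule assms)
  moreover have "pochhammer (real \<alpha> + \<beta> + 1 + 2 * (real s / 2)) (2 * i) > 0"
    using \<beta>_gt \<alpha> by (intro pochhammer_pos) simp
  ultimately show ?thesis by (simp add: qseq_top)
qed

text \<open>Both the spectral identity for \<open>q\<close> at offset \<open>s / 2\<close> and the substitution of the operators on \<open>\<real>\<^sup>d\<close> take place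
  on coefficient sequences.  With \<open>n = s + 2 i\<close> the eigenvalue is taken at \<open>i + s / 2 - k / 2 = (n - k) / 2\<close>.\<close>

lemma eigenfunction:
  assumes "f \<in> alg k \<alpha> \<beta> a" "(n, i, j) \<in> Q_index TYPE('d)"
  shows "subst_op (B_coeffs k \<alpha> \<beta> a f) X1 X2 (Qfun k \<alpha> a Y (n, i, j))
    = poly f (lam (real \<alpha> + real CARD('d) / 2 - 1) ((real n - real k) / 2)) *\<^sub>R Qfun k \<alpha> a Y (n, i, j)"
proof -
  from assms(2) obtain s where n: "n = s + 2 * i" and j: "j \<in> harm_index TYPE('d) s" by (auto elim: Q_index_E)
  obtain B where B: "B_coeffs k \<alpha> \<beta> a f = coeff_array B"
    and eig: "\<And>\<delta> n. act \<delta> B (qseq k (real \<alpha> + \<beta> + 1) (\<lambda>i. poly (psi \<alpha> \<beta> a i)) \<delta> n)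
      = poly f (lam (real \<alpha> + \<beta>) (of_int n + \<delta> - real k / 2)) *\<^sub>R
        qseq k (real \<alpha> + \<beta> + 1) (\<lambda>i. poly (psi \<alpha> \<beta> a i)) \<delta> n"
    using B_coeffs_spectral[OF \<alpha> k \<beta>_gt assms(1)] by blast
  have ev: "lam (real \<alpha> + \<beta>) (real_of_int (int i) + real s / 2 - real k / 2)
      = lam (real \<alpha> + real CARD('d) / 2 - 1) ((real n - real k) / 2)"
    by (rule arg_cong2[of _ _ _ _ lam]) (simp_all add: n \<beta> field_simps)
  have Q: "Qfun k \<alpha> a Y (n, i, j) = combo (solid (\<beta> + real s) (Y s j)) i (q s i)"
    unfolding n by (rule Q_combo)
  have "subst_op (coeff_array B) X1 X2 (combo (solid (\<beta> + real s) (Y s j)) i (q s i))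
      = combo (solid (\<beta> + real s) (Y s j)) i (act (real s / 2) B (q s i))"
    by (rule subst_op_ladder[OF ladder_Y[OF j]]) (simp add: qseq_above)
  then show ?thesis unfolding Q B ev[symmetric] by (simp only: eig combo_scale)
qed

text \<open>For fixed \<open>s, j\<close> the change from \<open>\<parallel>x\<parallel>\<^bsup>2l\<^esup> Y s j\<close> to the \<open>Q\<close> is triangular in \<open>l\<close>, with nonzero diagonal by \<open>q_top\<close>.\<close>

lemma Q_spans:
  assumes tau: "\<And>m::nat. poly (tau k \<alpha> \<beta> a) (real m / 2 - 1) \<noteq> 0" and p: "rpf p"
  shows "p \<in> span (Qfun k \<alpha> a Y ` Q_index TYPE('d))" (is "_ \<in> span ?Q")
proof -
  have solid: "solid (\<beta> + real s) (Y s j) l \<in> span ?Q" if j: "j \<in> harm_index TYPE('d) s" for s j l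
  proof (induction l rule: less_induct)
    case (less l)
    let ?e = "solid (\<beta> + real s) (Y s j)"
    have "(s + 2 * l, l, j) \<in> Q_index TYPE('d)" using j by (simp add: Q_index_def)
    then have "combo ?e l (q s l) \<in> span ?Q" unfolding Q_combo[symmetric] by (intro span_base imageI)
    moreover have "combo ?e l (q s l) = q s l l *\<^sub>R ?e l + (\<Sum>m<l. q s l m *\<^sub>R ?e m)"
      unfolding combo_def by (subst lessThan_Suc_atMost[symmetric]) (simp only: sum.lessThan_Suc add.commute)
    moreover have "(\<Sum>m<l. q s l m *\<^sub>R ?e m) \<in> span ?Q" by (intro span_sum span_scale less) simp
    ultimately have "q s l l *\<^sub>R ?e l \<in> span ?Q" by (simp only: span_add_eq2)
    then have "(1 / q s l l) *\<^sub>R (q s l l *\<^sub>R ?e l) \<in> span ?Q" by (rule span_scale)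
    then show ?case using q_top[OF tau, of s l] by (simp only: scaleR_scaleR) simp
  qed
  have radial: "(\<lambda>x. sqnorm x ^ l * h x) \<in> span ?Q" if h: "h \<in> harm s" for h s l
  proof -
    have "Y s ` harm_index TYPE('d) s \<subseteq> {h. (\<lambda>x. sqnorm x ^ l * h x) \<in> span ?Q}"
    proof
      fix g assume "g \<in> Y s ` harm_index TYPE('d) s"
      then obtain j where j: "j \<in> harm_index TYPE('d) s" and g: "g = Y s j" by blast
      let ?b = "pochhammer (\<beta> + real s + 1) l * fact l :: real"
      have "pochhammer (\<beta> + real s + 1) l > 0" using \<beta>_gt by (intro pochhammer_pos) linarith
      then have "(\<lambda>x. sqnorm x ^ l * g x) = ?b *\<^sub>R solid (\<beta> + real s) (Y s j) l"
        unfolding solid_eq g by (simp only: scaleR_scaleR) simp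
      then show "g \<in> {h. (\<lambda>x. sqnorm x ^ l * h x) \<in> span ?Q}"
        using span_scale[OF solid[OF j, of l], of ?b] by (simp only: mem_Collect_eq)
    qed
    moreover have "harm s = span (Y s ` harm_index TYPE('d) s)"
      using Y unfolding harmonic_basis_def basis_family_def by blast
    ultimately show ?thesis
      using subsetD[OF span_minimal[OF _ subspace_mult_preimage[of "\<lambda>x. sqnorm x ^ l" ?Q]]] h by blast
  qed
  have "radials n \<subseteq> span ?Q" for n
    unfolding radials_def using radial by blast
  then have "span (radials n) \<subseteq> span ?Q" for n by (intro span_minimal subspace_span)
  then have "(\<Union>n. homog n) \<subseteq> span ?Q" using fischer_decomposition by blast
  then have "span (\<Union>n. homog n) \<subseteq> span ?Q" by (intro span_minimal subspace_span)
  then show ?thesis using rpf_homogeneous_parts[OF p] by blast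
qed

lemma X2_power_sum:
  assumes "finite T" "\<And>t. t \<in> T \<Longrightarrow> rpf (f t)"
  shows "(X2 ^^ m) (\<Sum>t\<in>T. c t *\<^sub>R f t) = (\<Sum>t\<in>T. c t *\<^sub>R (X2 ^^ m) (f t)) \<and> (\<forall>t\<in>T. rpf ((X2 ^^ m) (f t)))"
proof (induction m)
  case 0
  then show ?case using assms by simp
next
  case (Suc m)
  have "X2 (\<Sum>t\<in>T. c t *\<^sub>R (X2 ^^ m) (f t)) = (\<Sum>t\<in>T. c t *\<^sub>R X2 ((X2 ^^ m) (f t)))"
  proof (rule linear_on_rpf_sum[where T = X2])
    show "X2 (f + g) = X2 f + X2 g" if "rpf f" "rpf g" for f g
      by (simp only: laplacian_plus[OF that] scaleR_add_right)
    show "X2 (c *\<^sub>R f) = c *\<^sub>R X2 f" if "rpf f" for f c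
      by (simp only: laplacian_scale[OF that] scaleR_scaleR mult.commute)
  qed (use Suc assms in auto)
  then show ?case using Suc by (auto intro: rpf_scale rpf_laplacian)
qed

text \<open>Let \<open>m\<close> be the largest radial degree \<open>i\<close> that occurs in a relation.  Applying \<open>(\<Delta> / 4)\<^sup>m\<close> annihilates the
  members with \<open>i < m\<close> and maps those with \<open>i = m\<close> to nonzero multiples of \<open>Y\<close>.  The homogeneous parts of the resulting
  relation between harmonics contradict the independence of the \<open>Y s\<close>.\<close>

lemma Q_independent:
  assumes tau: "\<And>m::nat. poly (tau k \<alpha> \<beta> a) (real m / 2 - 1) \<noteq> 0"
    and T: "finite T" "T \<subseteq> Q_index TYPE('d)" and sum: "(\<Sum>t\<in>T. c t *\<^sub>R Qfun k \<alpha> a Y t) = 0"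
  shows "\<forall>t\<in>T. c t = 0"
proof (rule ccontr)
  assume nonzero: "\<not> ?thesis"
  define S where "S = {t\<in>T. c t \<noteq> 0}"
  have S: "finite S" "S \<noteq> {}" "S \<subseteq> Q_index TYPE('d)" using nonzero T by (auto simp: S_def)
  have "(\<Sum>t\<in>S. c t *\<^sub>R Qfun k \<alpha> a Y t) = (\<Sum>t\<in>T. c t *\<^sub>R Qfun k \<alpha> a Y t)"
    by (rule sum.mono_neutral_left) (use T in \<open>auto simp: S_def\<close>)
  then have sumS: "(\<Sum>t\<in>S. c t *\<^sub>R Qfun k \<alpha> a Y t) = 0" using sum by simp
  define r :: "nat \<times> nat \<times> nat \<Rightarrow> nat" where "r = (\<lambda>(n, i, j). i)"
  define deg :: "nat \<times> nat \<times> nat \<Rightarrow> nat" where "deg = (\<lambda>(n, i, j). n - 2 * i)"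
  define num :: "nat \<times> nat \<times> nat \<Rightarrow> nat" where "num = (\<lambda>(n, i, j). j)"
  define m where "m = Max (r ` S)"
  have m: "r t \<le> m" if "t \<in> S" for t unfolding m_def using S that by simp
  obtain t0 where t0: "t0 \<in> S" "r t0 = m" using Max_in[of "r ` S"] S unfolding m_def by fastforce
  have index: "num t \<in> harm_index TYPE('d) (deg t) \<and> t = (deg t + 2 * r t, r t, num t)" if "t \<in> S" for t
    using S(3) that by (auto simp: r_def deg_def num_def Q_index_def)
  have X2Q: "(X2 ^^ m) (Qfun k \<alpha> a Y t) = (if r t = m then q (deg t) m m *\<^sub>R Y (deg t) (num t) else 0)"
    if t: "t \<in> S" for t
  proof -
    let ?e = "solid (\<beta> + real (deg t)) (Y (deg t) (num t))"
    have "Qfun k \<alpha> a Y t = combo ?e (r t) (q (deg t) (r t))"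
      using index[OF t] Q_combo by metis
    then have "(X2 ^^ m) (Qfun k \<alpha> a Y t) = combo ?e (r t) (\<lambda>l. q (deg t) (r t) (l + m))"
      using ladder_funpow2[OF ladder_Y, of "num t" "deg t" "r t" "q (deg t) (r t)" m] index[OF t]
      by (simp add: qseq_above)
    also have "\<dots> = (\<Sum>l\<le>r t. if l = 0 \<and> r t = m then q (deg t) m m *\<^sub>R ?e 0 else 0)"
      unfolding combo_def
    proof (intro sum.cong refl)
      fix l
      show "q (deg t) (r t) (l + m) *\<^sub>R ?e l = (if l = 0 \<and> r t = m then q (deg t) m m *\<^sub>R ?e 0 else 0)"
        using m[OF t] qseq_above[of "r t" "l + m"] by (cases "l = 0 \<and> r t = m") auto
    qed
    also have "\<dots> = (if r t = m then q (deg t) m m *\<^sub>R ?e 0 else 0)" by simp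
    also have "?e 0 = Y (deg t) (num t)" by (rule ext) (simp add: solid_def hyp_term_def)
    finally show ?thesis .
  qed
  define S' where "S' = {t\<in>S. r t = m}"
  have "0 = (X2 ^^ m) (\<Sum>t\<in>S. c t *\<^sub>R Qfun k \<alpha> a Y t)"
    using X2_power_sum[of "{}" "\<lambda>_. 0" m c] unfolding sumS by simp
  also have "\<dots> = (\<Sum>t\<in>S. c t *\<^sub>R (X2 ^^ m) (Qfun k \<alpha> a Y t))"
    using X2_power_sum[OF S(1), of "Qfun k \<alpha> a Y" m c] rpf_Q S(3) by blast
  also have "\<dots> = (\<Sum>t\<in>S. if r t = m then (c t * q (deg t) m m) *\<^sub>R Y (deg t) (num t) else 0)"
    by (intro sum.cong refl) (simp add: X2Q)
  also have "\<dots> = (\<Sum>t\<in>S'. (c t * q (deg t) m m) *\<^sub>R Y (deg t) (num t))"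
    unfolding S'_def by (rule sum.inter_filter[symmetric, OF S(1)])
  finally have zero: "(\<Sum>t\<in>S'. (c t * q (deg t) m m) *\<^sub>R Y (deg t) (num t)) = 0" by simp
  define s where "s = deg t0"
  define S'' where "S'' = {t\<in>S'. deg t = s}"
  have fin: "finite S'" "finite S''" using S(1) by (auto simp: S'_def S''_def)
  have "(c t * q (deg t) m m) *\<^sub>R Y (deg t) (num t) \<in> homog (deg t)" if "t \<in> S'" for t
    using Y_harm[of "num t" "deg t"] index[of t] that subspace_scale[OF homog_subspace]
    by (auto simp: S'_def harm_eq)
  note homogeneous_sum_zero[OF fin(1) this zero, of s]
  moreover have "(\<Sum>t\<in>S''. (c t * q s m m) *\<^sub>R Y s (num t))
      = (\<Sum>t\<in>{t\<in>S'. deg t = s}. (c t * q (deg t) m m) *\<^sub>R Y (deg t) (num t))"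
    by (rule sum.cong) (auto simp: S''_def)
  ultimately have layer: "(\<Sum>t\<in>S''. (c t * q s m m) *\<^sub>R Y s (num t)) = 0" by simp
  have inj: "inj_on num S''"
    using index by (auto simp: inj_on_def S''_def S'_def) metis
  have "(\<Sum>j\<in>num ` S''. (c (s + 2 * m, m, j) * q s m m) *\<^sub>R Y s j) = 0"
  proof -
    have "(\<Sum>j\<in>num ` S''. (c (s + 2 * m, m, j) * q s m m) *\<^sub>R Y s j)
        = (\<Sum>t\<in>S''. (c (s + 2 * m, m, num t) * q s m m) *\<^sub>R Y s (num t))"
      by (simp add: sum.reindex[OF inj])
    also have "\<dots> = (\<Sum>t\<in>S''. (c t * q s m m) *\<^sub>R Y s (num t))"
    proof (intro sum.cong refl)
      fix t assume "t \<in> S''"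
      then have "t = (s + 2 * m, m, num t)" using index[of t] by (auto simp: S''_def S'_def)
      then show "(c (s + 2 * m, m, num t) * q s m m) *\<^sub>R Y s (num t) = (c t * q s m m) *\<^sub>R Y s (num t)" by metis
    qed
    finally show ?thesis using layer by simp
  qed
  moreover have "num ` S'' \<subseteq> harm_index TYPE('d) s"
  proof (rule image_subsetI)
    fix t assume "t \<in> S''"
    then have "t \<in> S" "deg t = s" by (simp_all add: S''_def S'_def)
    then show "num t \<in> harm_index TYPE('d) s" using index[of t] by simp
  qed
  moreover have "num t0 \<in> num ` S''" using t0 by (auto simp: S''_def S'_def s_def)
  moreover have "inj_on (Y s) (harm_index TYPE('d) s)" "independent (Y s ` harm_index TYPE('d) s)"
    using Y unfolding harmonic_basis_def basis_family_def by blast+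
  ultimately have "c (s + 2 * m, m, num t0) * q s m m = 0"
    using independent_familyD[of "Y s" "harm_index TYPE('d) s" "num ` S''" "\<lambda>j. c (s + 2 * m, m, j) * q s m m" "num t0"] fin(2)
    by blast
  then have "c (s + 2 * m, m, num t0) = 0" using q_top[OF tau] by simp
  moreover have "t0 = (s + 2 * m, m, num t0)" using index[OF t0(1)] t0(2) s_def by simp
  ultimately show False using t0(1) by (simp add: S_def)
qed

lemma Q_basis:
  assumes tau: "\<And>m::nat. poly (tau k \<alpha> \<beta> a) (real m / 2 - 1) \<noteq> 0"
  shows "basis_family (Qfun k \<alpha> a Y) (Q_index TYPE('d)) {p. rpf p}"
proof -
  have "span (Qfun k \<alpha> a Y ` Q_index TYPE('d)) = {p. rpf p}"
  proof
    show "span (Qfun k \<alpha> a Y ` Q_index TYPE('d)) \<subseteq> {p. rpf p}"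
      by (rule span_minimal[OF _ rpf_subspace]) (use rpf_Q in blast)
    show "{p. rpf p} \<subseteq> span (Qfun k \<alpha> a Y ` Q_index TYPE('d))"
      using Q_spans[OF tau] by blast
  qed
  then show ?thesis
    unfolding basis_family_def using independent_familyI Q_independent[OF tau] by blast
qed

end

theorem theorem5p1:
  fixes \<alpha> k :: nat and a :: "nat \<Rightarrow> real" and \<beta> :: real
    and Y :: "nat \<Rightarrow> nat \<Rightarrow> real ^ 'd \<Rightarrow> real"
  assumes "0 < \<alpha>" and "0 < k" and "k \<le> \<alpha>"
    and "\<beta> = real CARD('d) / 2 - 1"
    and "harmonic_basis Y"
  shows "((\<forall>m::nat. poly (tau k \<alpha> \<beta> a) (real m / 2 - 1) \<noteq> 0) \<longrightarrow>
            basis_family (Qfun k \<alpha> a Y) (Q_index TYPE('d)) {p. real_polynomial_function p})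
       \<and> (\<forall>f\<in>alg k \<alpha> \<beta> a. \<forall>(n, i, j)\<in>Q_index TYPE('d).
            subst_op (B_coeffs k \<alpha> \<beta> a f)
                (\<lambda>g. (1/2) *\<^sub>R euler g) (\<lambda>g. (1/4) *\<^sub>R laplacian g) (Qfun k \<alpha> a Y (n, i, j))
              = poly f (lam (real \<alpha> + real CARD('d) / 2 - 1) ((real n - real k) / 2))
                  *\<^sub>R Qfun k \<alpha> a Y (n, i, j))"
  using Q_basis[OF assms(1,3,4,5)] eigenfunction[OF assms(1,3,4,5)] by blast

end
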